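(* Let $P$ be a Noetherian left cancellative right LCM monoid with set of atoms $P_a$, let $\{X_p\}_{p\in P}$ be a compactly aligned product system of essential $C^*$-correspondences over $P$ with $X_e=A$, let $N:P\to(0,\infty)$ be a multiplicative homomorphism with $N(u)=1$ for every invertible $u\in P$, and let $\beta\in\mathbb{R}$. Assume that $\tau$ is a tracial state of $A$ such that $$\tau(a)+\sum_{\emptyset\neq U\subset J}(-1)^{|U|}N(\vee U)^{-\beta}\,\mathrm{Tr}_\tau^{\vee U}(a)\ \geq\ 0\quad\text{for all } a\in A_+\text{ and all finite } J\subset P_a .$$ Let $\lambda:I_n\to P\cup\{\infty\}$ be a list that is not a leaf, and let $\lambda_1,\lambda_2$ be the lists obtained from $\lambda$ by the recursive step with $\lambda(i)=pq$. Then $$Z(\lambda,\tau,a)=Z(\lambda_1,\tau,a)+\frac{1}{N(p)^{\beta}}\sum_{U\subset I_n}(-1)^{|U|}N(\vee\lambda_2(U))^{-\beta}\,\mathrm{Tr}^p_{F_{\vee\lambda_2(U)}(\tau)}(a)\quad\text{for all } a\in A_+ .$$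
   Context: Monoids. A right LCM monoid is a left-cancellative monoid $P$ (identity $e$) such that any two elements having a common right multiple have a right LCM; $r$ is a right LCM of $U\subset P$ if $r\in\bigcap_{q\in U}qP$ and every element of $\bigcap_{q\in U}qP$ lies in $rP$. $P^*$ is the group of invertible elements. $P$ is Noetherian if there is no infinite descending sequence for the proper factor relation ($p$ is a proper factor of $q$ if $q=xpy$ with at least one of $x,y$ non-invertible). An atom is $s\in P\setminus P^*$ such that every decomposition of $s$ as a finite product contains at most one non-invertible factor. Write $p\le r$ if $r\in pP$, and then $p^{-1}r$ is the unique $q$ with $pq=r$. For finite $K\subset P\cup\{\infty\}$, $\vee K$ denotes a right LCM of $K$ (unique up to right multiplication by an element of $P^*$), with $\vee\emptyset=e$, and $\vee K=\infty$ if $\infty\in K$ or $K$ has no right LCM; $p\vee q=\vee\{p,q\}$. Lists. Let $I_n=\{1,\dots,n\}$. A list is a function $\lambda:I_n\to P\cup\{\infty\}$. It is a leaf if $\lambda(I_n)\subset P_a\cup\{\infty\}$ or $\lambda(I_n)\cap P^*\ne\emptyset$. Recursive step: if $\lambda$ is not a leaf, let $i$ be the smallest index such that $\lambda(i)\in P$ and $\lambda(i)=pq$ with $p,q\in P\setminus P^*$, where $p$ is chosen in $P_a$, and define $\lambda_1(i)=p$, $\lambda_1(j)=\lambda(j)$ for $j\ne i$; and $\lambda_2(j)=p^{-1}(p\vee\lambda(j))$ if $p\vee\lambda(j)<\infty$, $\lambda_2(j)=\infty$ otherwise ($p\vee\lambda(j)$ is any choice of right LCM; in particular one chooses $\lambda_2(i)=q$).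 The function $Z$. For a list $\lambda$, $Z(\lambda,\tau,a)=\sum_{U\subset I_n}(-1)^{|U|}N(\vee\lambda(U))^{-\beta}\,\mathrm{Tr}_\tau^{\vee\lambda(U)}(a)$, where terms with $\vee\lambda(U)=\infty$ are zero (the same convention applies to terms with $\vee\lambda_2(U)=\infty$). Product systems. A $C^*$-correspondence over a $C^*$-algebra $A$ is a right Hilbert $A$-module $X$ with a left action $\varphi:A\to\mathcal{L}(X)$; it is essential if $\overline{\varphi(A)X}=X$. A product system over $P$ is a family $(X_p)_{p\in P}$ of $C^*$-correspondences over $A$ with a monoid structure on $\bigcup_pX_p$ such that $\xi\zeta\in X_{pq}$ for $\xi\in X_p,\zeta\in X_q$, the map $\xi\otimes\zeta\mapsto\xi\zeta$ extends to an isometric isomorphism $X_p\otimes_AX_q\simeq X_{pq}$ for all $p,q\in P$ with $p\ne e$, $X_e={}_AA_A$, and multiplication by $X_e$ gives the bimodule structure. For $p\le r$ let $\iota_p^r:\mathcal{L}(X_p)\to\mathcal{L}(X_r)$ be $S\mapsto S\otimes I_{p^{-1}r}$ under $X_r\simeq X_p\otimes_AX_{p^{-1}r}$. $X$ is compactly aligned if $\iota^r_p(\mathcal{K}(X_p))\iota^r_q(\mathcal{K}(X_q))\subset\mathcal{K}(X_r)$ whenever $pP\cap qP=rP$. Induced traces. For a finite positive trace $\tau$ on $A$ and a $C^*$-correspondence $Y$, $\mathrm{Tr}^Y_\tau(T)=\sup_H\sum_{\xi\in H}\tau(\langle\xi,T\xi\rangle)$ for $T\in\mathcal{L}(Y)_+$,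 the supremum over finite $H\subset Y$ with $\sum_{\xi\in H}\theta_{\xi,\xi}\le1$, where $\theta_{\xi,\zeta}\eta=\xi\langle\zeta,\eta\rangle$. $\mathrm{Tr}^p_\tau(a)$ means $\mathrm{Tr}^{X_p}_\tau(\varphi_p(a))$ for $a\in A_+$, and $F_p(\tau)$ denotes the trace $a\mapsto\mathrm{Tr}^p_\tau(a)$ on $A$.
   Formalization: It is additionally assumed that, for finite nonempty U ⊂ P_a, Tr_τ^{∨U} on A_+ does not depend on which right LCM ∨U is chosen; without this the displayed terms are ill-defined when P* is nontrivial and the identity can fail. *)

theory Defs
  imports "HOL-Analysis.Analysis"
begin

section \<open>Right LCM monoids\<close>

context monoid_mult
begin

definition invertibles :: "'a set" where
  "invertibles = {u. \<exists>v. u * v = 1 \<and> v * u = 1}"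

definition right_ideal :: "'a \<Rightarrow> 'a set" where
  "right_ideal p = range ((*) p)"

definition is_right_lcm :: "'a \<Rightarrow> 'a set \<Rightarrow> bool" where
  "is_right_lcm r U \<longleftrightarrow>
     r \<in> (\<Inter>q\<in>U. right_ideal q) \<and> (\<Inter>q\<in>U. right_ideal q) \<subseteq> right_ideal r"

definition proper_factor :: "'a \<Rightarrow> 'a \<Rightarrow> bool" where
  "proper_factor p q \<longleftrightarrow>
     (\<exists>x y. q = x * p * y \<and> (x \<notin> invertibles \<or> y \<notin> invertibles))"

definition atoms :: "'a set" where
  "atoms = {s. s \<notin> invertibles \<and>
     (\<forall>xs. prod_list xs = s \<longrightarrow> length (filter (\<lambda>x. x \<notin> invertibles) xs) \<le> 1)}"

definition left_quotient :: "'a \<Rightarrow> 'a \<Rightarrow> 'a" where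
  "left_quotient p r = (THE q. p * q = r)"

end

class right_lcm_monoid = monoid_mult +
  assumes left_cancel: "a * b = a * c \<Longrightarrow> b = c"
    and ex_right_lcm:
      "right_ideal p \<inter> right_ideal q \<noteq> {} \<Longrightarrow> \<exists>r. is_right_lcm r {p, q}"

class noetherian_right_lcm_monoid = right_lcm_monoid +
  assumes noetherian: "\<nexists>f :: nat \<Rightarrow> 'a. \<forall>k. proper_factor (f (Suc k)) (f k)"

text \<open>
  \<open>P \<union> {\<infinity>}\<close> is rendered as \<open>'p option\<close>, with \<open>None\<close> for \<open>\<infinity>\<close>.  Right LCMs are unique
  only up to right multiplication by invertible elements, so \<open>\<or>\<close> is an arbitrary choice
  function \<open>V\<close>.
\<close>

definition join_choice :: "('p::monoid_mult option set \<Rightarrow> 'p option) \<Rightarrow> bool" where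
  "join_choice V \<longleftrightarrow> V {} = Some 1 \<and>
     (\<forall>K. finite K \<and> K \<noteq> {} \<longrightarrow>
        (if None \<notin> K \<and> (\<exists>r. is_right_lcm r (the ` K))
         then \<exists>r. V K = Some r \<and> is_right_lcm r (the ` K)
         else V K = None))"


section \<open>Lists\<close>

text \<open>A list is a function on \<open>{1..n}\<close>; values outside \<open>{1..n}\<close> are irrelevant.\<close>

definition leaf :: "nat \<Rightarrow> (nat \<Rightarrow> 'p::monoid_mult option) \<Rightarrow> bool" where
  "leaf n l \<longleftrightarrow> l ` {1..n} \<subseteq> Some ` atoms \<union> {None} \<or> l ` {1..n} \<inter> Some ` invertibles \<noteq> {}"

definition decomposable :: "'p::monoid_mult option \<Rightarrow> bool" where
  "decomposable x \<longleftrightarrow> (\<exists>p q. x = Some (p * q) \<and> p \<notin> invertibles \<and> q \<notin> invertibles)"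

text \<open>
  The step involves choices (of \<open>p\<close>, \<open>q\<close> and of right LCMs), hence it is a relation between
  \<open>l\<close> and the resulting data rather than a function of \<open>l\<close>.
\<close>

definition recursive_step ::
  "nat \<Rightarrow> (nat \<Rightarrow> 'p::monoid_mult option) \<Rightarrow> nat \<Rightarrow> 'p \<Rightarrow> 'p \<Rightarrow>
    (nat \<Rightarrow> 'p option) \<Rightarrow> (nat \<Rightarrow> 'p option) \<Rightarrow> bool" where
  "recursive_step n l i p q l1 l2 \<longleftrightarrow>
     i \<in> {1..n} \<and> decomposable (l i) \<and> (\<forall>j\<in>{1..n}. j < i \<longrightarrow> \<not> decomposable (l j)) \<and>
     l i = Some (p * q) \<and> p \<in> atoms \<and> q \<notin> invertibles \<and>
     l1 i = Some p \<and> (\<forall>j\<in>{1..n} - {i}. l1 j = l j) \<and>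
     l2 i = Some q \<and>
     (\<forall>j\<in>{1..n} - {i}.
        case l j of
          None \<Rightarrow> l2 j = None
        | Some x \<Rightarrow>
            if \<exists>r. is_right_lcm r {p, x}
            then \<exists>r. is_right_lcm r {p, x} \<and> l2 j = Some (left_quotient p r)
            else l2 j = None)"


section \<open>C*-algebras and tracial states\<close>

class complex_vector = real_vector +
  fixes scaleC :: "complex \<Rightarrow> 'a \<Rightarrow> 'a"
  assumes scaleC_add_right: "scaleC c (x + y) = scaleC c x + scaleC c y"
    and scaleC_add_left: "scaleC (c + d) x = scaleC c x + scaleC d x"
    and scaleC_scaleC: "scaleC c (scaleC d x) = scaleC (c * d) x"
    and scaleC_one: "scaleC 1 x = x"
    and scaleR_scaleC: "scaleR r x = scaleC (complex_of_real r) x"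

global_interpretation complex_vector: vector_space "scaleC :: complex \<Rightarrow> 'a \<Rightarrow> 'a::complex_vector"
  by unfold_locales (simp_all add: scaleC_add_right scaleC_add_left scaleC_scaleC scaleC_one)

text \<open>Not necessarily unital.\<close>

class cstar_algebra = complex_vector + real_normed_algebra + banach +
  fixes star :: "'a \<Rightarrow> 'a"
  assumes mult_scaleC_left: "scaleC c x * y = scaleC c (x * y)"
    and mult_scaleC_right: "x * scaleC c y = scaleC c (x * y)"
    and norm_scaleC: "norm (scaleC c x) = cmod c * norm x"
    and star_star: "star (star x) = x"
    and star_add: "star (x + y) = star x + star y"
    and star_scaleC: "star (scaleC c x) = scaleC (cnj c) (star x)"
    and star_mult: "star (x * y) = star y * star x"
    and cstar_identity: "norm (star x * x) = (norm x)\<^sup>2"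

definition positives :: "'a::cstar_algebra set" where
  "positives = {a. \<exists>b. a = star b * b}"

definition tracial_state :: "('a::cstar_algebra \<Rightarrow> complex) \<Rightarrow> bool" where
  "tracial_state \<tau> \<longleftrightarrow>
     bounded_linear \<tau> \<and> (\<forall>c a. \<tau> (scaleC c a) = c * \<tau> a) \<and>
     (\<forall>a\<in>positives. \<tau> a \<in> \<real> \<and> 0 \<le> Re (\<tau> a)) \<and>
     onorm \<tau> = 1 \<and>
     (\<forall>a b. \<tau> (a * b) = \<tau> (b * a))"


section \<open>C*-correspondences\<close>

text \<open>
  All modules in a family live on subspaces of one complex vector space \<open>'x\<close>, which only
  supplies the linear structure.  This is no restriction: any family of complex vector spaces
  embeds in its direct sum.
\<close>

record ('a, 'x) corr =
  mcarrier :: "'x set"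
  ract :: "'x \<Rightarrow> 'a \<Rightarrow> 'x"
  ip :: "'x \<Rightarrow> 'x \<Rightarrow> 'a"
  lact :: "'a \<Rightarrow> 'x \<Rightarrow> 'x"

definition mnorm :: "('a::cstar_algebra, 'x::complex_vector) corr \<Rightarrow> 'x \<Rightarrow> real" where
  "mnorm E \<xi> = sqrt (norm (ip E \<xi> \<xi>))"

definition dense_in :: "('a::cstar_algebra, 'x::complex_vector) corr \<Rightarrow> 'x set \<Rightarrow> bool" where
  "dense_in E S \<longleftrightarrow> S \<subseteq> mcarrier E \<and>
     (\<forall>\<xi>\<in>mcarrier E. \<forall>\<epsilon>>0. \<exists>\<eta>\<in>S. mnorm E (\<xi> - \<eta>) < \<epsilon>)"

locale hilbert_module =
  fixes E :: "('a::cstar_algebra, 'x::complex_vector) corr"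
  assumes subspace: "complex_vector.subspace (mcarrier E)"
    and ract_closed: "\<xi> \<in> mcarrier E \<Longrightarrow> ract E \<xi> a \<in> mcarrier E"
    and ract_add_left: "\<xi> \<in> mcarrier E \<Longrightarrow> \<eta> \<in> mcarrier E \<Longrightarrow>
      ract E (\<xi> + \<eta>) a = ract E \<xi> a + ract E \<eta> a"
    and ract_add_right: "\<xi> \<in> mcarrier E \<Longrightarrow> ract E \<xi> (a + b) = ract E \<xi> a + ract E \<xi> b"
    and ract_scaleC_left: "\<xi> \<in> mcarrier E \<Longrightarrow> ract E (scaleC c \<xi>) a = scaleC c (ract E \<xi> a)"
    and ract_scaleC_right: "\<xi> \<in> mcarrier E \<Longrightarrow> ract E \<xi> (scaleC c a) = scaleC c (ract E \<xi> a)"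
    and ract_mult: "\<xi> \<in> mcarrier E \<Longrightarrow> ract E \<xi> (a * b) = ract E (ract E \<xi> a) b"
    and ip_add: "\<xi> \<in> mcarrier E \<Longrightarrow> \<eta> \<in> mcarrier E \<Longrightarrow> \<zeta> \<in> mcarrier E \<Longrightarrow>
      ip E \<xi> (\<eta> + \<zeta>) = ip E \<xi> \<eta> + ip E \<xi> \<zeta>"
    and ip_scaleC: "\<xi> \<in> mcarrier E \<Longrightarrow> \<eta> \<in> mcarrier E \<Longrightarrow>
      ip E \<xi> (scaleC c \<eta>) = scaleC c (ip E \<xi> \<eta>)"
    and ip_ract: "\<xi> \<in> mcarrier E \<Longrightarrow> \<eta> \<in> mcarrier E \<Longrightarrow> ip E \<xi> (ract E \<eta> a) = ip E \<xi> \<eta> * a"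
    and ip_star: "\<xi> \<in> mcarrier E \<Longrightarrow> \<eta> \<in> mcarrier E \<Longrightarrow> star (ip E \<xi> \<eta>) = ip E \<eta> \<xi>"
    and ip_pos: "\<xi> \<in> mcarrier E \<Longrightarrow> ip E \<xi> \<xi> \<in> positives"
    and ip_definite: "\<xi> \<in> mcarrier E \<Longrightarrow> ip E \<xi> \<xi> = 0 \<Longrightarrow> \<xi> = 0"
    and complete: "(\<And>k. f k \<in> mcarrier E) \<Longrightarrow>
      (\<And>\<epsilon>. 0 < \<epsilon> \<Longrightarrow> \<exists>M. \<forall>k\<ge>M. \<forall>m\<ge>M. mnorm E (f k - f m) < \<epsilon>) \<Longrightarrow>
      \<exists>\<xi>\<in>mcarrier E. (\<lambda>k. mnorm E (f k - \<xi>)) \<longlonglongrightarrow> 0"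

text \<open>
  Operators on \<open>E\<close> are functions on \<open>'x\<close> of which only the values on \<open>mcarrier E\<close> matter.
\<close>

definition adjoint_pair ::
  "('a::cstar_algebra, 'x::complex_vector) corr \<Rightarrow> ('x \<Rightarrow> 'x) \<Rightarrow> ('x \<Rightarrow> 'x) \<Rightarrow> bool" where
  "adjoint_pair E T S \<longleftrightarrow>
     T \<in> mcarrier E \<rightarrow> mcarrier E \<and> S \<in> mcarrier E \<rightarrow> mcarrier E \<and>
     (\<forall>\<xi>\<in>mcarrier E. \<forall>\<eta>\<in>mcarrier E. ip E (T \<xi>) \<eta> = ip E \<xi> (S \<eta>))"

definition adjointable :: "('a::cstar_algebra, 'x::complex_vector) corr \<Rightarrow> ('x \<Rightarrow> 'x) set" where
  "adjointable E = {T. \<exists>S. adjoint_pair E T S}"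

text \<open>Positivity and order in the C*-algebra of adjointable operators (\<open>T = S\<^sup>*S\<close>).\<close>

definition op_positive :: "('a::cstar_algebra, 'x::complex_vector) corr \<Rightarrow> ('x \<Rightarrow> 'x) \<Rightarrow> bool" where
  "op_positive E T \<longleftrightarrow>
     (\<exists>S S'. adjoint_pair E S S' \<and> (\<forall>\<xi>\<in>mcarrier E. T \<xi> = S' (S \<xi>)))"

definition op_le ::
  "('a::cstar_algebra, 'x::complex_vector) corr \<Rightarrow> ('x \<Rightarrow> 'x) \<Rightarrow> ('x \<Rightarrow> 'x) \<Rightarrow> bool" where
  "op_le E S T \<longleftrightarrow> op_positive E (\<lambda>\<xi>. T \<xi> - S \<xi>)"

definition rank_one :: "('a::cstar_algebra, 'x::complex_vector) corr \<Rightarrow> 'x \<Rightarrow> 'x \<Rightarrow> 'x \<Rightarrow> 'x" where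
  "rank_one E \<xi> \<zeta> \<eta> = ract E \<xi> (ip E \<zeta> \<eta>)"

text \<open>The operator-norm closure of the linear span of the operators \<open>rank_one E \<xi> \<zeta>\<close>.\<close>

definition compacts :: "('a::cstar_algebra, 'x::complex_vector) corr \<Rightarrow> ('x \<Rightarrow> 'x) set" where
  "compacts E = {T \<in> adjointable E. \<forall>\<epsilon>>0. \<exists>(m::nat) c \<xi> \<zeta>.
     (\<forall>k<m. \<xi> k \<in> mcarrier E \<and> \<zeta> k \<in> mcarrier E) \<and>
     (\<forall>\<eta>\<in>mcarrier E.
        mnorm E (T \<eta> - (\<Sum>k<m. scaleC (c k) (rank_one E (\<xi> k) (\<zeta> k) \<eta>))) \<le> \<epsilon> * mnorm E \<eta>)}"

locale correspondence = hilbert_module E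
  for E :: "('a::cstar_algebra, 'x::complex_vector) corr" +
  assumes lact_adjoint: "adjoint_pair E (lact E a) (lact E (star a))"
    and lact_add: "\<xi> \<in> mcarrier E \<Longrightarrow> lact E (a + b) \<xi> = lact E a \<xi> + lact E b \<xi>"
    and lact_scaleC: "\<xi> \<in> mcarrier E \<Longrightarrow> lact E (scaleC c a) \<xi> = scaleC c (lact E a \<xi>)"
    and lact_mult: "\<xi> \<in> mcarrier E \<Longrightarrow> lact E (a * b) \<xi> = lact E a (lact E b \<xi>)"

text \<open>\<open>\<phi>(A)E\<close> denotes the linear span of the vectors \<open>\<phi>(a)\<xi>\<close>.\<close>

definition essential :: "('a::cstar_algebra, 'x::complex_vector) corr \<Rightarrow> bool" where
  "essential E \<longleftrightarrow> dense_in E (complex_vector.span {lact E a \<xi> | a \<xi>. \<xi> \<in> mcarrier E})"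

definition self_corr :: "('a::cstar_algebra, 'a) corr" where
  "self_corr = \<lparr>mcarrier = UNIV, ract = (*), ip = (\<lambda>a b. star a * b), lact = (*)\<rparr>"

definition corr_iso ::
  "('a::cstar_algebra, 'x::complex_vector) corr \<Rightarrow> ('a, 'y::complex_vector) corr \<Rightarrow>
    ('x \<Rightarrow> 'y) \<Rightarrow> bool" where
  "corr_iso E F f \<longleftrightarrow> bij_betw f (mcarrier E) (mcarrier F) \<and>
     (\<forall>\<xi>\<in>mcarrier E. \<forall>\<eta>\<in>mcarrier E.
        f (\<xi> + \<eta>) = f \<xi> + f \<eta> \<and> ip F (f \<xi>) (f \<eta>) = ip E \<xi> \<eta>) \<and>
     (\<forall>\<xi>\<in>mcarrier E. \<forall>c. f (scaleC c \<xi>) = scaleC c (f \<xi>)) \<and>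
     (\<forall>\<xi>\<in>mcarrier E. \<forall>a. f (ract E \<xi> a) = ract F (f \<xi>) a \<and> f (lact E a \<xi>) = lact F a (f \<xi>))"

text \<open>
  \<open>\<xi> \<otimes> \<zeta> \<mapsto> m \<xi> \<zeta>\<close> extends to an isometric isomorphism of correspondences from the interior
  tensor product of \<open>E\<close> and \<open>F\<close> onto \<open>G\<close>.  The interior tensor product is the completion of the
  algebraic balanced tensor product for the semi-inner product
  \<open>\<langle>\<xi> \<otimes> \<zeta>, \<xi>' \<otimes> \<zeta>'\<rangle> = \<langle>\<zeta>, \<langle>\<xi>, \<xi>'\<rangle>\<zeta>'\<rangle>\<close>; so this says that \<open>m\<close> is a balanced bimodule map for which
  the induced map on the algebraic tensor product preserves this form and has dense range.
\<close>

definition interior_tensor_iso ::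
  "('a::cstar_algebra, 'x::complex_vector) corr \<Rightarrow> ('a, 'y::complex_vector) corr \<Rightarrow>
    ('a, 'z::complex_vector) corr \<Rightarrow> ('x \<Rightarrow> 'y \<Rightarrow> 'z) \<Rightarrow> bool" where
  "interior_tensor_iso E F G m \<longleftrightarrow>
     (\<forall>\<xi>\<in>mcarrier E. \<forall>\<zeta>\<in>mcarrier F. m \<xi> \<zeta> \<in> mcarrier G) \<and>
     (\<forall>\<xi>\<in>mcarrier E. \<forall>\<xi>'\<in>mcarrier E. \<forall>\<zeta>\<in>mcarrier F. m (\<xi> + \<xi>') \<zeta> = m \<xi> \<zeta> + m \<xi>' \<zeta>) \<and>
     (\<forall>\<xi>\<in>mcarrier E. \<forall>\<zeta>\<in>mcarrier F. \<forall>\<zeta>'\<in>mcarrier F. m \<xi> (\<zeta> + \<zeta>') = m \<xi> \<zeta> + m \<xi> \<zeta>') \<and>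
     (\<forall>\<xi>\<in>mcarrier E. \<forall>\<zeta>\<in>mcarrier F. \<forall>c.
        m (scaleC c \<xi>) \<zeta> = scaleC c (m \<xi> \<zeta>) \<and> m \<xi> (scaleC c \<zeta>) = scaleC c (m \<xi> \<zeta>)) \<and>
     (\<forall>\<xi>\<in>mcarrier E. \<forall>\<zeta>\<in>mcarrier F. \<forall>a.
        m (ract E \<xi> a) \<zeta> = m \<xi> (lact F a \<zeta>) \<and>
        m (lact E a \<xi>) \<zeta> = lact G a (m \<xi> \<zeta>) \<and>
        m \<xi> (ract F \<zeta> a) = ract G (m \<xi> \<zeta>) a) \<and>
     (\<forall>\<xi>\<in>mcarrier E. \<forall>\<zeta>\<in>mcarrier F. \<forall>\<xi>'\<in>mcarrier E. \<forall>\<zeta>'\<in>mcarrier F.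
        ip G (m \<xi> \<zeta>) (m \<xi>' \<zeta>') = ip F \<zeta> (lact F (ip E \<xi> \<xi>') \<zeta>')) \<and>
     dense_in G (complex_vector.span {m \<xi> \<zeta> | \<xi> \<zeta>. \<xi> \<in> mcarrier E \<and> \<zeta> \<in> mcarrier F})"


section \<open>Product systems\<close>

text \<open>
  The fibres \<open>X p\<close> may overlap as subsets of \<open>'x\<close>; their disjoint union carries the
  multiplication \<open>mul p q :: X p \<times> X q \<rightarrow> X (p * q)\<close>.  It is a semigroup; an identity element
  exists precisely when \<open>A\<close> is unital.  The map \<open>j\<close> identifies \<open>A\<close> with the fibre over \<open>1\<close>.
\<close>

locale product_system =
  fixes X :: "'p::right_lcm_monoid \<Rightarrow> ('a::cstar_algebra, 'x::complex_vector) corr"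
    and mul :: "'p \<Rightarrow> 'p \<Rightarrow> 'x \<Rightarrow> 'x \<Rightarrow> 'x"
    and j :: "'a \<Rightarrow> 'x"
  assumes fibre: "correspondence (X p)"
    and mul_closed: "\<xi> \<in> mcarrier (X p) \<Longrightarrow> \<zeta> \<in> mcarrier (X q) \<Longrightarrow>
      mul p q \<xi> \<zeta> \<in> mcarrier (X (p * q))"
    and mul_assoc: "\<xi> \<in> mcarrier (X p) \<Longrightarrow> \<zeta> \<in> mcarrier (X q) \<Longrightarrow> \<eta> \<in> mcarrier (X r) \<Longrightarrow>
      mul (p * q) r (mul p q \<xi> \<zeta>) \<eta> = mul p (q * r) \<xi> (mul q r \<zeta> \<eta>)"
    and mul_tensor: "p \<noteq> 1 \<Longrightarrow> interior_tensor_iso (X p) (X q) (X (p * q)) (mul p q)"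
    and unit_fibre: "corr_iso self_corr (X 1) j"
    and mul_left: "\<xi> \<in> mcarrier (X p) \<Longrightarrow> mul 1 p (j a) \<xi> = lact (X p) a \<xi>"
    and mul_right: "\<xi> \<in> mcarrier (X p) \<Longrightarrow> mul p 1 \<xi> (j a) = ract (X p) \<xi> a"

text \<open>
  For \<open>r \<in> pP\<close> and an adjointable \<open>S\<close>, \<open>amplify X mul p r S\<close> is \<open>S \<otimes> I\<close> on \<open>X r\<close>; by density its
  values on \<open>mcarrier (X r)\<close> are uniquely determined.
\<close>

definition amplify ::
  "('p::right_lcm_monoid \<Rightarrow> ('a::cstar_algebra, 'x::complex_vector) corr) \<Rightarrow>
    ('p \<Rightarrow> 'p \<Rightarrow> 'x \<Rightarrow> 'x \<Rightarrow> 'x) \<Rightarrow> 'p \<Rightarrow> 'p \<Rightarrow> ('x \<Rightarrow> 'x) \<Rightarrow> 'x \<Rightarrow> 'x" where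
  "amplify X mul p r S =
     (SOME T. T \<in> adjointable (X r) \<and>
        (\<forall>\<xi>\<in>mcarrier (X p). \<forall>\<zeta>\<in>mcarrier (X (left_quotient p r)).
           T (mul p (left_quotient p r) \<xi> \<zeta>) = mul p (left_quotient p r) (S \<xi>) \<zeta>))"

definition compactly_aligned ::
  "('p::right_lcm_monoid \<Rightarrow> ('a::cstar_algebra, 'x::complex_vector) corr) \<Rightarrow>
    ('p \<Rightarrow> 'p \<Rightarrow> 'x \<Rightarrow> 'x \<Rightarrow> 'x) \<Rightarrow> bool" where
  "compactly_aligned X mul \<longleftrightarrow>
     (\<forall>p q r. right_ideal p \<inter> right_ideal q = right_ideal r \<longrightarrow>
        (\<forall>S\<in>compacts (X p). \<forall>T\<in>compacts (X q).
           amplify X mul p r S \<circ> amplify X mul q r T \<in> compacts (X r)))"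


section \<open>Induced traces\<close>

text \<open>
  Traces enter only through their values on \<open>A\<^sub>+\<close> and induced traces may be infinite, so they
  are functions \<open>'a \<Rightarrow> ereal\<close> whose values outside \<open>A\<^sub>+\<close> are irrelevant.  Positivity of
  \<open>\<tau>(a) - N(s)\<^sup>-\<^sup>\<beta> Tr\<^sub>\<tau>\<^sup>s(a)\<close> fails in \<open>ereal\<close> when the second trace is infinite, so the subinvariance
  condition for one-element sets of atoms already forces the traces in it to be finite.
\<close>

definition Tr ::
  "('a::cstar_algebra, 'x::complex_vector) corr \<Rightarrow> ('a \<Rightarrow> ereal) \<Rightarrow> ('x \<Rightarrow> 'x) \<Rightarrow> ereal" where
  "Tr Y \<sigma> T =
     (SUP H \<in> {H. finite H \<and> H \<subseteq> mcarrier Y \<and> op_le Y (\<lambda>\<eta>. \<Sum>\<xi>\<in>H. rank_one Y \<xi> \<xi> \<eta>) (\<lambda>\<eta>. \<eta>)}.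
        \<Sum>\<xi>\<in>H. \<sigma> (ip Y \<xi> (T \<xi>)))"

definition weight_of :: "('a \<Rightarrow> complex) \<Rightarrow> 'a \<Rightarrow> ereal" where
  "weight_of \<tau> a = ereal (Re (\<tau> a))"

text \<open>\<open>F X p \<sigma> a\<close> is \<open>F\<^sub>p(\<sigma>)(a) = Tr\<^sub>\<sigma>\<^sup>p(a)\<close>.\<close>

definition F ::
  "('p \<Rightarrow> ('a::cstar_algebra, 'x::complex_vector) corr) \<Rightarrow> 'p \<Rightarrow> ('a \<Rightarrow> ereal) \<Rightarrow> 'a \<Rightarrow> ereal" where
  "F X p \<sigma> a = Tr (X p) \<sigma> (lact (X p) a)"

definition weighted :: "('p \<Rightarrow> real) \<Rightarrow> real \<Rightarrow> ('p \<Rightarrow> ereal) \<Rightarrow> 'p option \<Rightarrow> ereal" where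
  "weighted N \<beta> f v = (case v of None \<Rightarrow> 0 | Some r \<Rightarrow> ereal (N r powr (- \<beta>)) * f r)"

definition Z ::
  "('p::monoid_mult \<Rightarrow> ('a::cstar_algebra, 'x::complex_vector) corr) \<Rightarrow> ('p \<Rightarrow> real) \<Rightarrow> real \<Rightarrow>
    ('p option set \<Rightarrow> 'p option) \<Rightarrow> nat \<Rightarrow> (nat \<Rightarrow> 'p option) \<Rightarrow> ('a \<Rightarrow> ereal) \<Rightarrow> 'a \<Rightarrow> ereal" where
  "Z X N \<beta> V n l \<sigma> a =
     (\<Sum>U\<in>Pow {1..n}. ereal ((-1) ^ card U) * weighted N \<beta> (\<lambda>r. F X r \<sigma> a) (V (l ` U)))"

text \<open>
  The value \<open>Tr\<^sub>\<tau>\<^sup>\<or>\<^sup>U\<close>, \<open>U\<close> a finite nonempty set of atoms, does not depend on which right LCM of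
  \<open>U\<close> is chosen.  Unlike for \<open>N\<close>, this is not automatic when there are nontrivial invertible
  elements: \<open>X\<^sub>p\<^sub>u = X\<^sub>p \<otimes> X\<^sub>u\<close> for invertible \<open>u\<close>, and \<open>X\<^sub>u\<close> may move \<open>\<tau>\<close>.
\<close>

definition trace_well_defined ::
  "('p::monoid_mult \<Rightarrow> ('a::cstar_algebra, 'x::complex_vector) corr) \<Rightarrow> ('a \<Rightarrow> ereal) \<Rightarrow> bool" where
  "trace_well_defined X \<sigma> \<longleftrightarrow>
     (\<forall>U r r'. finite U \<and> U \<noteq> {} \<and> U \<subseteq> atoms \<and> is_right_lcm r U \<and> is_right_lcm r' U \<longrightarrow>
        (\<forall>a\<in>positives. F X r \<sigma> a = F X r' \<sigma> a))"

end

theory Submission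
  imports Defs
begin

text \<open>
  Fix \<open>U \<subseteq> {1..n}\<close>.  If \<open>i \<notin> U\<close>, then \<open>\<lambda>\<close> and \<open>\<lambda>\<^sub>1\<close> agree on \<open>U\<close>, so only the sets containing \<open>i\<close>
  contribute to \<open>Z(\<lambda>) - Z(\<lambda>\<^sub>1)\<close>.  By construction of \<open>\<lambda>\<^sub>2\<close>, an element \<open>p y\<close> is a common multiple of
  \<open>\<lambda>(U)\<close> precisely when \<open>y\<close> is a common multiple of \<open>\<lambda>\<^sub>2(U)\<close>; hence \<open>p (\<or>\<lambda>\<^sub>2(U))\<close> is a join of
  \<open>{p} \<union> \<lambda>(U)\<close>, for every \<open>U\<close> (\<open>recursive_step_common_multiples\<close>, \<open>join_left_factor\<close>).  If \<open>i \<in> U\<close>, then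
  \<open>{p} \<union> \<lambda>(U)\<close> has the same multiples as \<open>\<lambda>(U)\<close>, and the term is one of \<open>Z(\<lambda>)\<close>.  If \<open>i \<notin> U\<close>, then
  \<open>{p} \<union> \<lambda>(U) = \<lambda>\<^sub>1(U \<union> {i})\<close>, and the term is one of \<open>Z(\<lambda>\<^sub>1)\<close>, with the opposite sign because of the
  additional element.  So the last sum of the formula is \<open>Z(\<lambda>) - Z(\<lambda>\<^sub>1)\<close>, term by term, provided that
  \<open>N(p r)\<^sup>-\<^sup>\<beta> F\<^sub>p\<^sub>r(\<tau>) = N(p)\<^sup>-\<^sup>\<beta> N(r)\<^sup>-\<^sup>\<beta> F\<^sub>p(F\<^sub>r(\<tau>))\<close>, that the value does not depend on the choice of the
  join, and that it is finite.

  The first point is the formula \<open>F\<^sub>p\<^sub>r(\<tau>) = F\<^sub>p(F\<^sub>r(\<tau>))\<close> for the induced trace of an interior tensor product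
  (\<open>Tr_tensor\<close>).  If \<open>\<xi>\<close> runs through a finite family with \<open>\<Sum>\<theta>\<^bsub>\<xi>,\<xi>\<^esub> \<le> 1\<close> and, for every \<open>\<xi>\<close>, \<open>\<eta>\<close> runs through such
  a family of the second module, then the vectors \<open>\<xi> \<otimes> \<eta>\<close> form such a family too; this gives one
  inequality.  For the other one, product families contain approximate units, and the trace property
  exchanges such an approximate unit with an arbitrary family of the tensor product
  (\<open>sum_weight_subframe_swap\<close>).  The other two points follow from the first by Noetherian induction:
  for a single atom, finiteness is subinvariance and independence of the join is assumed, and both
  pass to products of noninvertible elements (\<open>F_unit\<close>, \<open>F_bounded\<close>).  Only noninvertible elements occur
  in the terms that have to be compared, as these are all multiples of \<open>p\<close>.

  Behind the tensor product formula stands the order theory of C*-algebras and Hilbert modules: sums of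
  elements \<open>b\<^sup>* b\<close> are positive, the norm is monotone on positive elements, and inequalities between operators,
  which are defined by factorisations \<open>S\<^sup>* S\<close>, can be verified on inner products.  It is developed from
  square roots alone, without spectral theory; \<open>star_mult_neg_square_zero\<close> and
  \<open>sqrt_one_minus_contraction\<close> are the crucial steps.
\<close>

section \<open>Square roots by iteration\<close>

lemma star_zero [simp]: "star (0::'a::cstar_algebra) = 0"
  by (metis add_cancel_right_right star_add)

lemma star_uminus: "star (- x) = - star (x::'a::cstar_algebra)"
  by (metis add_eq_0_iff star_add star_zero)

lemma star_diff: "star (x - y) = star x - star (y::'a::cstar_algebra)"
  by (metis diff_conv_add_uminus star_add star_uminus)

lemma star_scaleR: "star (r *\<^sub>R x) = r *\<^sub>R star (x::'a::cstar_algebra)"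
  by (simp add: scaleR_scaleC star_scaleC)

lemma star_sum: "star (sum f I) = (\<Sum>i\<in>I. star (f i :: 'a::cstar_algebra))"
  by (induction I rule: infinite_finite_induct) (auto simp: star_add)

lemma norm_star: "norm (star x) = norm (x::'a::cstar_algebra)"
proof -
  have le: "norm x \<le> norm (star x)" for x :: 'a
    using cstar_identity[of x] norm_mult_ineq[of "star x" x]
    by (cases "x = 0") (auto simp: power2_eq_square)
  show ?thesis using le[of x] le[of "star x"] by (simp add: star_star)
qed

lemma tendsto_star:
  "(f \<longlongrightarrow> (a::'a::cstar_algebra)) G \<Longrightarrow> ((\<lambda>x. star (f x)) \<longlongrightarrow> star a) G"
  unfolding tendsto_iff dist_norm star_diff[symmetric] norm_star .

text \<open>
  Visser's iteration \<open>y\<^sub>n\<^sub>+\<^sub>1 = (h + y\<^sub>n\<^sup>2) / 2\<close>.  A limit \<open>y\<close> satisfies \<open>2y - y\<^sup>2 = h\<close>, that is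
  \<open>(1 - y)\<^sup>2 = 1 - h\<close>: it is \<open>1\<close> minus a square root of \<open>1 - h\<close>, computed without using a unit.
  The iterates are polynomials in \<open>h\<close> with nonnegative coefficients, as are their successive
  differences, so for \<open>\<parallel>h\<parallel> \<le> 1\<close> everything is dominated by the same iteration for the real number
  \<open>1\<close>, which is bounded and increasing.
\<close>

primrec visser :: "'a::real_normed_algebra \<Rightarrow> nat \<Rightarrow> 'a" where
  "visser h 0 = 0"
| "visser h (Suc n) = (1/2) *\<^sub>R (h + visser h n * visser h n)"

lemma visser_real: "0 \<le> visser (1::real) n \<and> visser (1::real) n \<le> 1"
proof (induction n)
  case (Suc n)
  then have "visser (1::real) n * visser 1 n \<le> 1 * 1" by (intro mult_mono) auto
  then show ?case by simp
qed simp

lemma visser_step: "visser (h::'a::real_normed_algebra) (Suc (Suc n)) - visser h (Suc n) =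
    (1/2) *\<^sub>R (visser h (Suc n) * (visser h (Suc n) - visser h n) +
      (visser h (Suc n) - visser h n) * visser h n)"
proof -
  have "visser h (Suc (Suc n)) - visser h (Suc n) =
      (1/2) *\<^sub>R (h + visser h (Suc n) * visser h (Suc n)) - (1/2) *\<^sub>R (h + visser h n * visser h n)"
    by (rule arg_cong2[of _ _ _ _ minus]; rule visser.simps)
  also have "\<dots> = (1/2) *\<^sub>R (visser h (Suc n) * visser h (Suc n) - visser h n * visser h n)"
    by (simp only: scaleR_diff_right[symmetric] add_diff_cancel_left)
  also have "visser h (Suc n) * visser h (Suc n) - visser h n * visser h n =
      visser h (Suc n) * (visser h (Suc n) - visser h n) +
      (visser h (Suc n) - visser h n) * visser h n"
    by (simp add: right_diff_distrib left_diff_distrib del: visser.simps)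
  finally show ?thesis .
qed

lemma norm_visser:
  fixes h :: "'a::real_normed_algebra"
  assumes "norm h \<le> 1"
  shows "norm (visser h n) \<le> visser (1::real) n"
proof (induction n)
  case (Suc n)
  have "norm (visser h n * visser h n) \<le> visser 1 n * visser (1::real) n"
    using visser_real[of n] Suc by (intro order_trans[OF norm_mult_ineq] mult_mono) auto
  then show ?case using norm_triangle_ineq[of h "visser h n * visser h n"] assms by simp
qed simp

lemma norm_visser_step:
  fixes h :: "'a::real_normed_algebra"
  assumes "norm h \<le> 1"
  shows "norm (visser h (Suc n) - visser h n) \<le> visser 1 (Suc n) - visser (1::real) n"
proof (induction n)
  case 0 then show ?case using assms by simp
next
  case (Suc n)
  let ?q = "visser (1::real)" and ?d = "visser h (Suc n) - visser h n"
  have "norm (visser h (Suc n) * ?d) \<le> ?q (Suc n) * (?q (Suc n) - ?q n)"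
    using visser_real[of "Suc n"] Suc norm_visser[OF assms, of "Suc n"]
    by (intro order_trans[OF norm_mult_ineq] mult_mono) (auto simp del: visser.simps)
  moreover have "norm (?d * visser h n) \<le> (?q (Suc n) - ?q n) * ?q n"
    using visser_real[of n] Suc norm_visser[OF assms, of n] order_trans[OF norm_ge_zero Suc]
    by (intro order_trans[OF norm_mult_ineq] mult_mono) (auto simp del: visser.simps)
  moreover have "?q (Suc (Suc n)) - ?q (Suc n) =
      (1/2) * (?q (Suc n) * (?q (Suc n) - ?q n) + (?q (Suc n) - ?q n) * ?q n)"
    using visser_step[of "1::real" n] by (simp del: visser.simps)
  ultimately show ?case
    using norm_triangle_ineq[of "visser h (Suc n) * ?d" "?d * visser h n"]
    by (simp add: visser_step del: visser.simps)
qed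

lemma telescope_norm:
  fixes f :: "nat \<Rightarrow> 'a::real_normed_vector" and q :: "nat \<Rightarrow> real"
  assumes "\<And>n. norm (f (Suc n) - f n) \<le> q (Suc n) - q n" and "m \<le> n"
  shows "norm (f n - f m) \<le> q n - q m"
  using assms(2)
proof (induction n rule: dec_induct)
  case (step n)
  have "norm (f (Suc n) - f m) \<le> norm (f (Suc n) - f n) + norm (f n - f m)"
    by (metis norm_triangle_ineq diff_add_cancel add_diff_eq)
  then show ?case using step.IH assms(1)[of n] by linarith
qed simp

lemma visser_real_convergent: "convergent (visser (1::real))"
proof (rule Bseq_monoseq_convergent)
  show "Bseq (visser (1::real))" using visser_real by (intro BseqI'[of _ 1]) auto
  have "visser (1::real) n \<le> visser 1 (Suc n)" for n
    using norm_visser_step[of "1::real" n] norm_ge_zero[of "visser 1 (Suc n) - visser (1::real) n"]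
    by (simp del: visser.simps norm_ge_zero)
  then show "monoseq (visser (1::real))" by (simp add: monoseq_Suc del: visser.simps)
qed

lemma Cauchy_of_telescope:
  fixes q :: "nat \<Rightarrow> real"
  assumes "Cauchy q" and "\<And>m n. m \<le> n \<Longrightarrow> d m n \<le> q n - q m" "\<And>m n. d m n = d n m" "0 < e"
  shows "\<exists>M. \<forall>m\<ge>M. \<forall>n\<ge>M. d m n < (e::real)"
proof -
  obtain M where M: "\<And>m n. m \<ge> M \<Longrightarrow> n \<ge> M \<Longrightarrow> norm (q m - q n) < e"
    using CauchyD[OF assms(1,4)] by blast
  have "d m n < e" if "m \<ge> M" "n \<ge> M" for m n
    using assms(2)[of m n] assms(2)[of n m] assms(3)[of m n] M[OF that]
    by (cases "m \<le> n") auto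
  then show ?thesis by blast
qed

lemma visser_convergent:
  fixes h :: "'a::{real_normed_algebra,banach}"
  assumes "norm h \<le> 1"
  shows "convergent (visser h)"
proof -
  have "Cauchy (visser h)"
    unfolding Cauchy_iff
  proof (intro allI impI)
    fix e :: real assume "0 < e"
    from Cauchy_of_telescope[of "visser (1::real)" "\<lambda>m n. norm (visser h m - visser h n)" e]
    show "\<exists>M. \<forall>m\<ge>M. \<forall>n\<ge>M. norm (visser h m - visser h n) < e"
      using telescope_norm[of "visser h" "visser (1::real)", OF norm_visser_step[OF assms]] \<open>0<e\<close>
      by (simp add: convergent_Cauchy[OF visser_real_convergent] norm_minus_commute)
  qed
  then show ?thesis by (rule Cauchy_convergent)
qed

definition half_root :: "'a::{real_normed_algebra,banach} \<Rightarrow> 'a" where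
  "half_root h = lim (visser h)"

lemma visser_LIMSEQ: "norm h \<le> 1 \<Longrightarrow> visser h \<longlonglongrightarrow> half_root h"
  using visser_convergent[of h] by (simp add: half_root_def convergent_LIMSEQ_iff)

lemma half_root_eq:
  assumes "norm h \<le> 1"
  shows "half_root h + half_root h - half_root h * half_root h = h"
proof -
  note L = visser_LIMSEQ[OF assms]
  have "(\<lambda>n. visser h (Suc n)) \<longlonglongrightarrow> (1/2) *\<^sub>R (h + half_root h * half_root h)"
    by (simp only: visser.simps) (intro tendsto_intros L)
  then have "(1/2) *\<^sub>R (h + half_root h * half_root h) = half_root h"
    using LIMSEQ_Suc[OF L] LIMSEQ_unique by blast
  then have "2 *\<^sub>R ((1/2) *\<^sub>R (h + half_root h * half_root h)) = 2 *\<^sub>R half_root h" by simp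
  then show ?thesis by (simp add: scaleR_2) (simp add: algebra_simps)
qed

lemma norm_half_root: "norm h \<le> 1 \<Longrightarrow> norm (half_root h) \<le> 1"
  using visser_LIMSEQ[of h] norm_visser[of h] visser_real
  by (intro LIMSEQ_le_const2[OF tendsto_norm]) (auto intro: order_trans)

text \<open>
  Allowing two different elements, instead of stating only that \<open>half_root h\<close> commutes with the
  commutant of \<open>h\<close>, is what later compares the roots of \<open>(c c\<^sup>*)\<^sup>2\<close> and \<open>(c\<^sup>* c)\<^sup>2\<close>.
\<close>

lemma half_root_intertwine:
  assumes "norm h \<le> 1" "norm h' \<le> 1" "h * c = c * h'"
  shows "half_root h * c = c * half_root h'"
proof -
  have "visser h n * c = c * visser h' n" for n
  proof (induction n)
    case (Suc n)
    have "visser h n * visser h n * c = c * (visser h' n * visser h' n)"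
      by (metis Suc mult.assoc)
    then show ?case using assms(3) by (simp add: algebra_simps)
  qed simp
  then have "(\<lambda>n. visser h n * c) \<longlonglongrightarrow> c * half_root h'"
    using visser_LIMSEQ[OF assms(2)] by (simp add: tendsto_mult_left)
  moreover have "(\<lambda>n. visser h n * c) \<longlonglongrightarrow> half_root h * c"
    using visser_LIMSEQ[OF assms(1)] by (simp add: tendsto_mult_right)
  ultimately show ?thesis using LIMSEQ_unique by blast
qed

lemma star_half_root:
  fixes h :: "'a::cstar_algebra"
  assumes "norm h \<le> 1" "star h = h"
  shows "star (half_root h) = half_root h"
proof -
  have "star (visser h n) = visser h n" for n
    by (induction n) (auto simp: star_scaleR star_add star_mult assms)
  then have "visser h \<longlonglongrightarrow> star (half_root h)"
    using tendsto_star[OF visser_LIMSEQ[OF assms(1)]] by simp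
  then show ?thesis using visser_LIMSEQ[OF assms(1)] LIMSEQ_unique by blast
qed

section \<open>Positive elements of unital C*-algebras\<close>

lemma star_one: "star (1::'a::{cstar_algebra,monoid_mult}) = 1"
  by (metis mult_1_right star_mult star_star)

lemma norm_one_le: "norm (1::'a::{cstar_algebra,monoid_mult}) \<le> 1"
proof -
  have "norm (1::'a) = norm (1::'a) * norm (1::'a)"
    using cstar_identity[of "1::'a"] by (simp add: star_one power2_eq_square)
  then show ?thesis by (metis mult_cancel_right1 norm_ge_zero order_refl zero_le_one)
qed

lemma norm_scaleR_one_le: "0 \<le> t \<Longrightarrow> norm (t *\<^sub>R (1::'a::{cstar_algebra,monoid_mult})) \<le> t"
  using mult_left_mono[OF norm_one_le, of t] by simp

text \<open>
  If \<open>a\<close> and \<open>b\<close> are self-adjoint and commute, then \<open>z = a + \<i>b\<close> is normal with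
  \<open>z\<^sup>* z = a\<^sup>2 + b\<^sup>2 = t\<close>, so \<open>\<parallel>z\<parallel>\<^sup>2 \<le> t\<close> by the C*-identity, and \<open>a\<close> is the real part of \<open>z\<close>.  This
  replaces the spectral argument for norm estimates between commuting positive elements.
\<close>

lemma norm_le_of_commuting_squares:
  fixes a b :: "'a::{cstar_algebra,monoid_mult}"
  assumes sa: "star a = a" "star b = b" and comm: "a * b = b * a"
    and sum: "a * a + b * b = t *\<^sub>R 1" and t: "0 \<le> t"
  shows "norm (a * a) \<le> t"
proof -
  define z where "z = a + scaleC \<i> b"
  have sz: "star z = a - scaleC \<i> b"
    by (simp add: z_def star_add star_scaleC sa complex_vector.scale_minus_left)
  have "star z * z = a * a + b * b"
    unfolding sz unfolding z_def
    by (simp add: algebra_simps mult_scaleC_left mult_scaleC_right scaleC_scaleC comm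
        complex_vector.scale_minus_left scaleC_one)
  then have "(norm z)\<^sup>2 \<le> t"
    using cstar_identity[of z] sum norm_scaleR_one_le[OF t, where 'a='a] by simp
  moreover have "norm a \<le> norm z"
  proof -
    have "2 *\<^sub>R a = z + star z" unfolding sz by (simp add: z_def scaleR_2)
    then have "norm (2 *\<^sub>R a) \<le> norm z + norm (star z)" by (metis norm_triangle_ineq)
    then show ?thesis by (simp add: norm_star)
  qed
  ultimately show ?thesis
    using norm_mult_ineq[of a a] power_mono[of "norm a" "norm z" 2]
    by (simp add: power2_eq_square)
qed

text \<open>
  Positivity is taken to mean being the square of a self-adjoint element.  For these elements a norm
  criterion is available at once (\<open>norm_diff_of_psd\<close>, \<open>psdI\<close>); that elements \<open>b\<^sup>* b\<close> are of this
  form is a theorem (\<open>psd_star_mult\<close>).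
\<close>

definition psd :: "'a::cstar_algebra \<Rightarrow> bool" where
  "psd h \<longleftrightarrow> (\<exists>g. star g = g \<and> h = g * g)"

lemma psd_star: "psd h \<Longrightarrow> star h = h"
  by (auto simp: psd_def star_mult)

text \<open>
  With \<open>h = g\<^sup>2\<close> scaled to norm at most \<open>1\<close>, let \<open>d\<close> be the root of \<open>1 - h\<close>.  It commutes with \<open>g\<close>, and
  \<open>d\<^sup>2 + g\<^sup>2 = 1\<close> bounds \<open>d\<^sup>2\<close>.
\<close>

lemma norm_diff_of_psd:
  fixes h :: "'a::{cstar_algebra,monoid_mult}"
  assumes "psd h" "norm h \<le> t"
  shows "norm (t *\<^sub>R 1 - h) \<le> t"
proof (cases "t = 0")
  case True with assms show ?thesis by simp
next
  case False
  then have t: "0 < t" using assms(2) norm_ge_zero[of h] by linarith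
  obtain g where g: "star g = g" "h = g * g" using assms(1) by (auto simp: psd_def)
  define u where "u = (1/t) *\<^sub>R h"
  have u: "norm u \<le> 1" "star u = u"
    using assms t by (auto simp: u_def star_scaleR psd_star)
  define d where "d = 1 - half_root u"
  have dd: "d * d = 1 - u"
    using half_root_eq[OF u(1)] by (simp add: d_def algebra_simps)
  have "norm (d * d) \<le> 1"
  proof (rule norm_le_of_commuting_squares[where b = "(1 / sqrt t) *\<^sub>R g"])
    show "star d = d" using star_half_root[OF u] by (simp add: d_def star_diff star_one)
    show "star ((1 / sqrt t) *\<^sub>R g) = (1 / sqrt t) *\<^sub>R g" by (simp add: star_scaleR g)
    have "half_root u * g = g * half_root u"
      by (rule half_root_intertwine[OF u(1) u(1)]) (simp add: u_def g mult.assoc)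
    then show "d * (1 / sqrt t) *\<^sub>R g = (1 / sqrt t) *\<^sub>R g * d"
      by (simp add: d_def algebra_simps)
    show "d * d + (1 / sqrt t) *\<^sub>R g * (1 / sqrt t) *\<^sub>R g = 1 *\<^sub>R 1"
      using t by (simp add: dd u_def g)
  qed simp
  then have "norm (1 - u) \<le> 1" by (simp add: dd)
  moreover have "t *\<^sub>R 1 - h = t *\<^sub>R (1 - u)" using t by (simp add: u_def algebra_simps)
  ultimately show ?thesis using t by simp
qed

text \<open>
  The positive square root of \<open>h\<close>, obtained as \<open>\<surd>t \<cdot> \<surd>(1 - (1 - h/t))\<close>.  The scale \<open>t\<close> is kept as a
  parameter because intertwining two roots requires the same scale in both.
\<close>

definition root_at :: "real \<Rightarrow> 'a::{cstar_algebra,monoid_mult} \<Rightarrow> 'a" where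
  "root_at t h = sqrt t *\<^sub>R (1 - half_root (1 - (1/t) *\<^sub>R h))"

lemma root_at_arg:
  assumes "0 < t" "norm (t *\<^sub>R 1 - h) \<le> t"
  shows "norm (1 - (1/t) *\<^sub>R h :: 'a::{cstar_algebra,monoid_mult}) \<le> 1"
proof -
  have "1 - (1/t) *\<^sub>R h = (1/t) *\<^sub>R (t *\<^sub>R 1 - h)" using assms(1) by (simp add: algebra_simps)
  then show ?thesis using assms by simp
qed

lemma
  fixes h :: "'a::{cstar_algebra,monoid_mult}"
  assumes "0 < t" "norm (t *\<^sub>R 1 - h) \<le> t" "star h = h"
  shows root_at_square: "root_at t h * root_at t h = h"
    and star_root_at: "star (root_at t h) = root_at t h"
proof -
  note n = root_at_arg[OF assms(1,2)]
  have "(1 - half_root (1 - (1/t) *\<^sub>R h)) * (1 - half_root (1 - (1/t) *\<^sub>R h)) = (1/t) *\<^sub>R h"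
    using half_root_eq[OF n] by (simp add: algebra_simps)
  then show "root_at t h * root_at t h = h"
    using assms(1) by (simp add: root_at_def)
  have "star (half_root (1 - (1/t) *\<^sub>R h)) = half_root (1 - (1/t) *\<^sub>R h)"
    by (rule star_half_root[OF n]) (simp add: star_diff star_one star_scaleR assms(3))
  then show "star (root_at t h) = root_at t h"
    by (simp add: root_at_def star_scaleR star_diff star_one)
qed

lemma psdI:
  fixes h :: "'a::{cstar_algebra,monoid_mult}"
  assumes "norm (t *\<^sub>R 1 - h) \<le> t" "star h = h"
  shows "psd h"
proof (cases "t = 0")
  case True with assms show ?thesis unfolding psd_def by (intro exI[of _ 0]) simp
next
  case False
  then have "0 < t" using assms(1) norm_ge_zero[of "t *\<^sub>R 1 - h"] by linarith
  then show ?thesis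
    unfolding psd_def using root_at_square[OF _ assms] star_root_at[OF _ assms] by metis
qed

lemma psd_root_at:
  fixes h :: "'a::{cstar_algebra,monoid_mult}"
  assumes "0 < t" "norm (t *\<^sub>R 1 - h) \<le> t" "star h = h"
  shows "psd (root_at t h)"
proof (rule psdI[where t = "sqrt t"])
  have "sqrt t *\<^sub>R 1 - root_at t h = sqrt t *\<^sub>R half_root (1 - (1/t) *\<^sub>R h)"
    by (simp add: root_at_def algebra_simps)
  then show "norm (sqrt t *\<^sub>R 1 - root_at t h) \<le> sqrt t"
    using norm_half_root[OF root_at_arg[OF assms(1,2)]] assms(1) mult_left_mono[of _ 1 "sqrt t"]
    by simp
qed (rule star_root_at[OF assms])

lemma root_at_intertwine:
  fixes h h' :: "'a::{cstar_algebra,monoid_mult}"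
  assumes "0 < t" "norm (t *\<^sub>R 1 - h) \<le> t" "norm (t *\<^sub>R 1 - h') \<le> t" "h * c = c * h'"
  shows "root_at t h * c = c * root_at t h'"
proof -
  have "half_root (1 - (1/t) *\<^sub>R h) * c = c * half_root (1 - (1/t) *\<^sub>R h')"
    using assms by (intro half_root_intertwine root_at_arg) (auto simp: algebra_simps)
  then show ?thesis by (simp add: root_at_def algebra_simps)
qed

lemma psd_commuting_root:
  fixes h :: "'a::{cstar_algebra,monoid_mult}"
  assumes "psd h"
  obtains g where "star g = g" "h = g * g" "psd g" "\<And>c. h * c = c * h \<Longrightarrow> g * c = c * g"
proof -
  have 1: "0 < norm h + 1" "norm h \<le> norm h + 1" by (simp_all add: add_nonneg_pos)
  note 2 = norm_diff_of_psd[OF assms 1(2)] psd_star[OF assms]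
  show thesis
  proof (rule that)
    show "star (root_at (norm h + 1) h) = root_at (norm h + 1) h" by (rule star_root_at[OF 1(1) 2])
    show "h = root_at (norm h + 1) h * root_at (norm h + 1) h"
      by (rule root_at_square[OF 1(1) 2, symmetric])
    show "psd (root_at (norm h + 1) h)" by (rule psd_root_at[OF 1(1) 2])
    show "root_at (norm h + 1) h * c = c * root_at (norm h + 1) h" if "h * c = c * h" for c
      by (rule root_at_intertwine[OF 1(1) 2(1) 2(1) that])
  qed
qed

lemma psd_add:
  fixes a b :: "'a::{cstar_algebra,monoid_mult}"
  assumes "psd a" "psd b"
  shows "psd (a + b)"
proof (rule psdI[where t = "norm a + norm b"])
  have "(norm a + norm b) *\<^sub>R 1 - (a + b) = (norm a *\<^sub>R 1 - a) + (norm b *\<^sub>R 1 - b)"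
    by (simp add: algebra_simps)
  then show "norm ((norm a + norm b) *\<^sub>R 1 - (a + b)) \<le> norm a + norm b"
    using norm_diff_of_psd[OF assms(1)] norm_diff_of_psd[OF assms(2)]
    by (metis add_mono norm_triangle_le order_refl)
qed (simp add: star_add assms psd_star)

lemma psd_scaleR: "psd a \<Longrightarrow> 0 \<le> r \<Longrightarrow> psd (r *\<^sub>R a)"
  unfolding psd_def by (elim exE, rule_tac x="sqrt r *\<^sub>R g" in exI) (auto simp: star_scaleR)

lemma psd_diff_of_norm:
  fixes h :: "'a::{cstar_algebra,monoid_mult}"
  assumes "psd h" "norm h \<le> t"
  shows "psd (t *\<^sub>R 1 - h)"
  by (rule psdI[where t=t]) (use assms in \<open>simp_all add: star_diff star_scaleR star_one psd_star\<close>)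

text \<open>
  With \<open>t = \<parallel>a + b\<parallel>\<close>, the element \<open>t - a = (t - (a + b)) + b\<close> is positive.  Its root commutes with the
  root of \<open>a\<close>, and the squares of both add up to \<open>t\<close>.
\<close>

lemma psd_norm_mono:
  fixes a b :: "'a::{cstar_algebra,monoid_mult}"
  assumes "psd a" "psd b"
  shows "norm a \<le> norm (a + b)"
proof -
  let ?t = "norm (a + b)"
  have "psd ((?t *\<^sub>R 1 - (a + b)) + b)"
    using assms by (intro psd_add psd_diff_of_norm) auto
  then have "psd (?t *\<^sub>R 1 - a)" by (simp add: algebra_simps)
  then obtain f where f: "star f = f" "?t *\<^sub>R 1 - a = f * f"
    and fc: "\<And>c. (?t *\<^sub>R 1 - a) * c = c * (?t *\<^sub>R 1 - a) \<Longrightarrow> f * c = c * f"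
    using psd_commuting_root by metis
  obtain g where g: "star g = g" "a = g * g" using assms(1) by (auto simp: psd_def)
  have "norm (g * g) \<le> ?t"
  proof (rule norm_le_of_commuting_squares[OF g(1) f(1)])
    show "g * f = f * g" by (rule fc[symmetric]) (simp add: algebra_simps g(2))
    show "g * g + f * f = ?t *\<^sub>R 1" unfolding f(2)[symmetric] g(2)[symmetric] by simp
  qed simp
  then show ?thesis using g by simp
qed

lemma psd_antisym:
  fixes a b :: "'a::{cstar_algebra,monoid_mult}"
  shows "psd a \<Longrightarrow> psd b \<Longrightarrow> a + b = 0 \<Longrightarrow> a = 0"
  using psd_norm_mono[of a b] by simp

lemma self_adjoint_cube_zero:
  fixes a :: "'a::cstar_algebra"
  assumes "star a = a" "a * a * a = 0"
  shows "a = 0"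
proof -
  have "star (a * a) * (a * a) = 0" by (simp add: assms star_mult mult.assoc[symmetric])
  then have "a * a = 0" using cstar_identity[of "a * a"] by simp
  then show ?thesis using cstar_identity[of a] assms(1) by simp
qed

text \<open>
  For commuting positive \<open>a\<close>, \<open>b\<close> with \<open>a\<^sup>2 = b\<^sup>2\<close>, the elements \<open>(a - b) a (a - b)\<close> and
  \<open>(a - b) b (a - b)\<close> are positive and their sum is \<open>(a - b)(a\<^sup>2 - b\<^sup>2) = 0\<close>; so both vanish, and so
  does their difference \<open>(a - b)\<^sup>3\<close>.
\<close>

lemma psd_root_unique:
  fixes a b :: "'a::{cstar_algebra,monoid_mult}"
  assumes "psd a" "psd b" "a * b = b * a" "a * a = b * b"
  shows "a = b"
proof -
  have psd: "psd ((a - b) * c * (a - b))" if c: "psd c" "c * a = a * c" "c * b = b * c" for c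
  proof -
    obtain g where g: "star g = g" "c = g * g" "\<And>d. c * d = d * c \<Longrightarrow> g * d = d * g"
      using psd_commuting_root[OF c(1)] by metis
    have gd: "g * (a - b) = (a - b) * g"
      using g(3) c by (simp add: algebra_simps)
    have "star (g * (a - b)) = g * (a - b)"
      by (simp add: star_mult g(1) star_diff psd_star assms(1,2) gd)
    moreover have "(a - b) * c * (a - b) = g * (a - b) * (g * (a - b))"
      unfolding g(2) gd mult.assoc by (simp only: mult.assoc[symmetric] gd)
    ultimately show ?thesis unfolding psd_def by blast
  qed
  have "(a - b) * a * (a - b) + (a - b) * b * (a - b) = (a - b) * ((a + b) * (a - b))"
    by (simp add: algebra_simps)
  also have "(a + b) * (a - b) = 0" using assms(3,4) by (simp add: algebra_simps)
  finally have sum: "(a - b) * a * (a - b) + (a - b) * b * (a - b) = 0" by simp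
  have "(a - b) * a * (a - b) = 0" 
    by (rule psd_antisym[OF psd[OF assms(1) refl] psd[OF assms(2) _ refl] sum])
      (rule assms(3), rule assms(3)[symmetric])
  with sum have "(a - b) * (a - b) * (a - b) = 0"
    by (simp add: right_diff_distrib left_diff_distrib mult.assoc)
  then show ?thesis
    using self_adjoint_cube_zero[of "a - b"] assms(1,2) by (simp add: star_diff psd_star)
qed

lemma cartesian_decomposition:
  fixes c :: "'a::cstar_algebra"
  obtains x y where "star x = x" "star y = y"
    "star c * c + c * star c = 2 *\<^sub>R (x * x) + 2 *\<^sub>R (y * y)"
proof
  let ?x = "(1/2) *\<^sub>R (c + star c)" and ?y = "scaleC (\<i>/2) (star c - c)"
  show "star ?x = ?x" by (simp add: star_scaleR star_add star_star add.commute)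
  show "star ?y = ?y"
    by (simp add: star_scaleC star_diff star_star complex_vector.scale_right_diff_distrib
       complex_vector.scale_minus_left)
  have "?y * ?y = (- 1/4) *\<^sub>R ((star c - c) * (star c - c))"
    by (simp add: mult_scaleC_left mult_scaleC_right scaleC_scaleC scaleR_scaleC)
  then show "star c * c + c * star c = 2 *\<^sub>R (?x * ?x) + 2 *\<^sub>R (?y * ?y)"
    by (simp only:) (simp add: algebra_simps scaleR_left_distrib[symmetric])
qed

text \<open>
  The core of the Fukamiya-Kaplansky theorem.  Usually it is derived from the equality of the nonzero
  spectra of \<open>c\<^sup>* c\<close> and \<open>c c\<^sup>*\<close>; here an identity of roots replaces the spectra.  The element
  \<open>k = c c\<^sup>*\<close> is positive, because \<open>c\<^sup>* c + c c\<^sup>*\<close> is a sum of squares.  Now \<open>k\<^sup>2 c = c (c\<^sup>* c)\<^sup>2 = c g\<^sup>4\<close>,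
  and passing to positive roots gives \<open>k c = c g\<^sup>2\<close>; but \<open>k c = c (c\<^sup>* c) = - c g\<^sup>2\<close>.
\<close>

lemma star_mult_neg_square_zero:
  fixes c g :: "'a::{cstar_algebra,monoid_mult}"
  assumes "star c * c = - (g * g)" "star g = g"
  shows "c = 0"
proof -
  obtain x y where xy: "star x = x" "star y = y"
    "star c * c + c * star c = 2 *\<^sub>R (x * x) + 2 *\<^sub>R (y * y)" by (rule cartesian_decomposition)
  define k where "k = c * star c"
  have "k = 2 *\<^sub>R (x * x) + 2 *\<^sub>R (y * y) + g * g"
    using xy(3) assms(1) by (simp add: k_def algebra_simps)
  then have k: "psd k"
    using xy(1,2) assms(2) by (simp only:) (intro psd_add psd_scaleR; auto simp: psd_def)
  have g: "psd (g * g)" using assms(2) by (auto simp: psd_def)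
  define t where "t = max (norm (k * k)) (norm (g * g * (g * g))) + 1"
  have t: "0 < t" "norm (k * k) \<le> t" "norm (g * g * (g * g)) \<le> t"
    by (auto simp: t_def add_nonneg_pos le_max_iff_disj)
  have kk: "psd (k * k)" and gg: "psd (g * g * (g * g))"
    using psd_star[OF k] psd_star[OF g] by (auto simp: psd_def)
  note nk = norm_diff_of_psd[OF kk t(2)] and ng = norm_diff_of_psd[OF gg t(3)]
  have r: "root_at t (h * h) = h" if h: "psd h" and n: "norm (t *\<^sub>R 1 - h * h) \<le> t" for h :: 'a
  proof (rule psd_root_unique[OF _ h])
    have s: "star (h * h) = h * h" by (simp add: star_mult psd_star[OF h])
    show "psd (root_at t (h * h))" by (rule psd_root_at[OF t(1) n s])
    show "root_at t (h * h) * h = h * root_at t (h * h)"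
      by (rule root_at_intertwine[OF t(1) n n]) (simp add: mult.assoc)
    show "root_at t (h * h) * root_at t (h * h) = h * h" by (rule root_at_square[OF t(1) n s])
  qed
  have "k * k * c = c * ((star c * c) * (star c * c))" by (simp add: k_def mult.assoc)
  then have "k * k * c = c * (g * g * (g * g))" by (simp add: assms(1))
  then have "root_at t (k * k) * c = c * root_at t (g * g * (g * g))"
    by (rule root_at_intertwine[OF t(1) nk ng])
  then have "k * c = c * (g * g)" by (simp only: r[OF k nk] r[OF g ng])
  also have "\<dots> = - (k * c)"
    using assms(1) by (simp add: k_def mult.assoc)
  finally have "2 *\<^sub>R (k * c) = 0" by (metis scaleR_2 add.right_inverse)
  then have "c * star c * c = 0" by (simp add: k_def)
  then have "star (star c * c) * (star c * c) = 0" by (simp add: star_mult star_star mult.assoc)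
  then show ?thesis using cstar_identity[of "star c * c"] cstar_identity[of c] by simp
qed

text \<open>
  Let \<open>h = b\<^sup>* b\<close>, \<open>m = \<bar>h\<bar>\<close> the root of \<open>h\<^sup>2\<close>, and \<open>n = (m - h)/2\<close> the negative part of \<open>h\<close>.  Then
  \<open>(b n)\<^sup>* (b n) = n h n = - n m n\<close> is the negative of a square, so \<open>b n = 0\<close>.  It follows that \<open>n = 0\<close>
  and \<open>h = m\<close>.
\<close>

lemma psd_star_mult:
  fixes b :: "'a::{cstar_algebra,monoid_mult}"
  shows "psd (star b * b)"
proof -
  define h where "h = star b * b"
  have sh: "star h = h" by (simp add: h_def star_mult star_star)
  then have "psd (h * h)" by (auto simp: psd_def)
  then obtain m where m: "star m = m" "h * h = m * m" "psd m" "\<And>c. h * h * c = c * (h * h) \<Longrightarrow> m * c = c * m"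
    using psd_commuting_root by metis
  obtain k where k: "star k = k" "m = k * k" "\<And>c. m * c = c * m \<Longrightarrow> k * c = c * k"
    using psd_commuting_root[OF m(3)] by metis
  define n where "n = (1/2) *\<^sub>R (m - h)"
  have sn: "star n = n" by (simp add: n_def star_scaleR star_diff sh m)
  have mh: "m * h = h * m" by (rule m(4)) (simp add: mult.assoc)
  have mn: "m * n = n * m" by (simp add: n_def algebra_simps mh)
  have hn: "h * n = - (m * n)" "n * h = - (m * n)" "n * n = m * n"
    by (simp_all add: n_def algebra_simps mh m(2) scaleR_2[symmetric])
  have kn: "k * n = n * k" by (rule k(3)[OF mn])
  have "star (b * n) * (b * n) = n * (h * n)" by (simp add: star_mult sn h_def mult.assoc)
  also have "\<dots> = - (k * n * (k * n))"
    by (simp add: hn k(2)) (metis kn mult.assoc)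
  finally have "b * n = 0"
    by (rule star_mult_neg_square_zero) (simp add: star_mult k sn kn)
  then have "h * n = 0" by (simp add: h_def mult.assoc)
  then have "m * n = 0" using hn by simp
  then have "n = 0" using hn(3) by (intro self_adjoint_cube_zero[OF sn]) simp
  then have "m = h" by (simp add: n_def)
  then show ?thesis using m(3) by (simp add: h_def)
qed

section \<open>The multiplier algebra\<close>

text \<open>
  Testing on \<open>x = a - b\<close> makes up for the missing unit.
\<close>

lemma cstar_nondegenerate:
  fixes a b :: "'a::cstar_algebra"
  assumes "\<And>x. star x * a = star x * b"
  shows "a = b"
proof -
  have "star (a - b) * (a - b) = 0" using assms by (simp add: right_diff_distrib)
  then show ?thesis using cstar_identity[of "a - b"] by simp
qed

definition adjoints :: "('a::cstar_algebra \<Rightarrow> 'a) \<Rightarrow> ('a \<Rightarrow> 'a) \<Rightarrow> bool" where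
  "adjoints f g \<longleftrightarrow> bounded_linear f \<and> bounded_linear g \<and> (\<forall>x y. star (f x) * y = star x * g y)"

lemma adjoints_sym:
  assumes "adjoints f g"
  shows "adjoints g f"
proof -
  have "star (g x) * y = star x * f y" for x y
  proof -
    have "star (star (f y) * x) = star (star y * g x)" using assms by (simp add: adjoints_def)
    then show ?thesis by (simp add: star_mult star_star)
  qed
  then show ?thesis using assms by (simp add: adjoints_def)
qed

lemma adjoints_unique:
  assumes "adjoints f g" "adjoints f g'"
  shows "g = g'"
proof (rule ext, rule cstar_nondegenerate)
  show "star x * g y = star x * g' y" for x y
  proof -
    have "star (f x) * y = star x * g y" "star (f x) * y = star x * g' y"
      using assms unfolding adjoints_def by blast+
    then show ?thesis by simp
  qed
qed

lemma bounded_linear_scaleC: "bounded_linear (scaleC c :: 'a::cstar_algebra \<Rightarrow> 'a)"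
  by (rule bounded_linear_intro[where K="cmod c"])
    (simp_all add: scaleC_add_right scaleR_scaleC scaleC_scaleC norm_scaleC mult.commute)

lemma adjoints_zero: "adjoints (\<lambda>x. 0) (\<lambda>x. 0)"
  by (simp add: adjoints_def)

lemma adjoints_id: "adjoints (\<lambda>x. x) (\<lambda>x. x)"
  by (simp add: adjoints_def)

lemma adjoints_add: "adjoints f g \<Longrightarrow> adjoints f' g' \<Longrightarrow> adjoints (\<lambda>x. f x + f' x) (\<lambda>x. g x + g' x)"
  by (simp add: adjoints_def bounded_linear_add star_add algebra_simps)

lemma adjoints_scaleC: "adjoints f g \<Longrightarrow> adjoints (\<lambda>x. scaleC c (f x)) (\<lambda>x. scaleC (cnj c) (g x))"
  by (simp add: adjoints_def bounded_linear_compose[OF bounded_linear_scaleC] star_scaleC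
      mult_scaleC_left mult_scaleC_right)

lemma adjoints_scaleR: "adjoints f g \<Longrightarrow> adjoints (\<lambda>x. r *\<^sub>R f x) (\<lambda>x. r *\<^sub>R g x)"
  using adjoints_scaleC[of f g "complex_of_real r"] by (simp add: scaleR_scaleC)

lemma adjoints_comp: "adjoints f g \<Longrightarrow> adjoints f' g' \<Longrightarrow> adjoints (\<lambda>x. f (f' x)) (\<lambda>x. g' (g x))"
  by (simp add: adjoints_def bounded_linear_compose)

lemma adjoints_mult: "adjoints ((*) a) ((*) (star a))"
  by (simp add: adjoints_def bounded_linear_mult_right star_mult mult.assoc)

text \<open>
  The multiplier algebra, as the algebra of adjointable operators on the algebra regarded as a Hilbert
  module over itself.  It provides a unit without leaving the world of C*-algebras: the operator norm
  is automatically a C*-norm, which it would fail to be on pairs \<open>(a, \<lambda>)\<close> when the algebra already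
  has a unit.  The algebra may be \<open>0\<close>, hence the class \<open>monoid_mult\<close> instead of \<open>ring_1\<close>, which would
  impose \<open>0 \<noteq> 1\<close>.
\<close>

typedef (overloaded) 'a multiplier = "{T :: 'a::cstar_algebra \<Rightarrow>\<^sub>L 'a. \<exists>g. adjoints (blinfun_apply T) g}"
  by (rule exI[of _ "0"]) (auto intro!: exI adjoints_zero simp: zero_blinfun.rep_eq)

definition mapply :: "'a::cstar_algebra multiplier \<Rightarrow> 'a \<Rightarrow> 'a" where
  "mapply m = blinfun_apply (Rep_multiplier m)"

definition multiplier_of :: "('a::cstar_algebra \<Rightarrow> 'a) \<Rightarrow> 'a multiplier" where
  "multiplier_of f = Abs_multiplier (Blinfun f)"

definition madj :: "'a::cstar_algebra multiplier \<Rightarrow> 'a multiplier" where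
  "madj m = multiplier_of (SOME g. adjoints (mapply m) g)"

lemma mapply_multiplier_of: "adjoints f g \<Longrightarrow> mapply (multiplier_of f) = f"
  unfolding mapply_def multiplier_of_def
  by (subst Abs_multiplier_inverse)
    (auto simp: bounded_linear_Blinfun_apply adjoints_def intro!: exI[of _ g])

lemma multiplier_eqI: "(\<And>x. mapply m x = mapply m' x) \<Longrightarrow> m = m'"
  by (metis Rep_multiplier_inject blinfun_eqI mapply_def)

lemma adjoints_madj: "adjoints (mapply m) (mapply (madj m))"
proof -
  have "\<exists>g. adjoints (mapply m) g" using Rep_multiplier[of m] by (simp add: mapply_def)
  then have *: "adjoints (mapply m) (SOME g. adjoints (mapply m) g)" by (rule someI_ex)
  then show ?thesis by (simp add: madj_def mapply_multiplier_of[OF adjoints_sym[OF *]])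
qed

lemma bounded_linear_mapply: "bounded_linear (mapply m)"
  using adjoints_madj[of m] by (simp add: adjoints_def)

lemma star_mapply_mult: "star (mapply m x) * y = star x * mapply (madj m) y"
  using adjoints_madj[of m] by (simp add: adjoints_def)

lemma madj_eqI: "adjoints (mapply m) (mapply m') \<Longrightarrow> madj m = m'"
  by (rule multiplier_eqI) (metis adjoints_madj adjoints_unique)

instantiation multiplier :: (cstar_algebra) "{real_normed_algebra, monoid_mult}"
begin

definition zero_multiplier :: "'a multiplier" where "0 = multiplier_of (\<lambda>x. 0)"
definition one_multiplier :: "'a multiplier" where "1 = multiplier_of (\<lambda>x. x)"
definition scaleR_multiplier :: "real \<Rightarrow> 'a multiplier \<Rightarrow> 'a multiplier" where
  "scaleR r m = multiplier_of (\<lambda>x. r *\<^sub>R mapply m x)"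
definition plus_multiplier :: "'a multiplier \<Rightarrow> 'a multiplier \<Rightarrow> 'a multiplier" where
  "m + n = multiplier_of (\<lambda>x. mapply m x + mapply n x)"
definition uminus_multiplier :: "'a multiplier \<Rightarrow> 'a multiplier" where
  "- m = (- 1) *\<^sub>R (m :: 'a multiplier)"
definition minus_multiplier :: "'a multiplier \<Rightarrow> 'a multiplier \<Rightarrow> 'a multiplier" where
  "m - n = m + - (n :: 'a multiplier)"
definition times_multiplier :: "'a multiplier \<Rightarrow> 'a multiplier \<Rightarrow> 'a multiplier" where
  "m * n = multiplier_of (\<lambda>x. mapply m (mapply n x))"
definition norm_multiplier :: "'a multiplier \<Rightarrow> real" where
  "norm m = norm (Rep_multiplier m)"
definition dist_multiplier :: "'a multiplier \<Rightarrow> 'a multiplier \<Rightarrow> real" where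
  "dist m n = norm (m - n :: 'a multiplier)"
definition sgn_multiplier :: "'a multiplier \<Rightarrow> 'a multiplier" where
  "sgn m = inverse (norm m) *\<^sub>R (m :: 'a multiplier)"
definition uniformity_multiplier :: "('a multiplier \<times> 'a multiplier) filter" where
  "uniformity = (INF e\<in>{0 <..}. principal {(x, y :: 'a multiplier). dist x y < e})"
definition open_multiplier :: "'a multiplier set \<Rightarrow> bool" where
  "open U = (\<forall>x\<in>U. eventually (\<lambda>(x', y :: 'a multiplier). x' = x \<longrightarrow> y \<in> U) uniformity)"

lemma mapply_simps [simp]:
  "mapply 0 x = (0::'a)" "mapply 1 x = (x::'a)" "mapply (m + n) x = mapply m x + mapply n (x::'a)"
  "mapply (r *\<^sub>R m) x = r *\<^sub>R mapply m (x::'a)"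
  "mapply (m * n) x = mapply m (mapply n (x::'a))"
  unfolding zero_multiplier_def one_multiplier_def plus_multiplier_def scaleR_multiplier_def
    times_multiplier_def
  by (simp_all add: mapply_multiplier_of[OF adjoints_zero] mapply_multiplier_of[OF adjoints_id]
      mapply_multiplier_of[OF adjoints_add[OF adjoints_madj adjoints_madj]]
      mapply_multiplier_of[OF adjoints_scaleR[OF adjoints_madj]]
      mapply_multiplier_of[OF adjoints_comp[OF adjoints_madj adjoints_madj]])

lemma mapply_simps2 [simp]:
  "mapply (- m) x = - mapply m (x::'a)" "mapply (m - n) x = mapply m x - mapply n (x::'a)"
  by (simp_all add: uminus_multiplier_def minus_multiplier_def)

lemmas mapply_linear = linear_add[OF bounded_linear.linear[OF bounded_linear_mapply]]
  linear_diff[OF bounded_linear.linear[OF bounded_linear_mapply]]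
  linear_scale[OF bounded_linear.linear[OF bounded_linear_mapply]]
  linear_0[OF bounded_linear.linear[OF bounded_linear_mapply]]

lemma Rep_multiplier_simps:
  "Rep_multiplier (m + n) = Rep_multiplier m + Rep_multiplier (n :: 'a multiplier)"
  "Rep_multiplier (scaleR r m) = scaleR r (Rep_multiplier m)"
  "Rep_multiplier (m * n) = Rep_multiplier m o\<^sub>L Rep_multiplier n"
  "Rep_multiplier (m - n) = Rep_multiplier m - Rep_multiplier n"
  "Rep_multiplier (0 :: 'a multiplier) = 0"
  by (rule blinfun_eqI; simp add: mapply_def[symmetric] plus_blinfun.rep_eq scaleR_blinfun.rep_eq
      minus_blinfun.rep_eq)+

instance
proof
  fix a b c :: "'a multiplier" and r s :: real
  show "a + b + c = a + (b + c)" by (rule multiplier_eqI) (simp add: add.assoc)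
  show "a + b = b + a" by (rule multiplier_eqI) (simp add: add.commute)
  show "0 + a = a" by (rule multiplier_eqI) simp
  show "- a + a = 0" by (rule multiplier_eqI) simp
  show "a - b = a + - b" by (rule multiplier_eqI) simp
  show "r *\<^sub>R (a + b) = r *\<^sub>R a + r *\<^sub>R b" by (rule multiplier_eqI) (simp add: algebra_simps)
  show "(r + s) *\<^sub>R a = r *\<^sub>R a + s *\<^sub>R a" by (rule multiplier_eqI) (simp add: algebra_simps)
  show "r *\<^sub>R s *\<^sub>R a = (r * s) *\<^sub>R a" by (rule multiplier_eqI) simp
  show "1 *\<^sub>R a = a" by (rule multiplier_eqI) simp
  show "a * b * c = a * (b * c)" by (rule multiplier_eqI) simp
  show "(a + b) * c = a * c + b * c" by (rule multiplier_eqI) simp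
  show "a * (b + c) = a * b + a * c" by (rule multiplier_eqI) (simp add: mapply_linear)
  show "r *\<^sub>R a * b = r *\<^sub>R (a * b)" by (rule multiplier_eqI) simp
  show "a * r *\<^sub>R b = r *\<^sub>R (a * b)" by (rule multiplier_eqI) (simp add: mapply_linear)
  show "1 * a = a" "a * 1 = a" by (rule multiplier_eqI; simp)+
  show "dist a b = norm (a - b)" by (rule dist_multiplier_def)
  show "sgn a = inverse (norm a) *\<^sub>R a" by (rule sgn_multiplier_def)
  show "uniformity = (INF e\<in>{0 <..}. principal {(x, y :: 'a multiplier). dist x y < e})"
    by (rule uniformity_multiplier_def)
  show "open U = (\<forall>x\<in>U. eventually (\<lambda>(x', y :: 'a multiplier). x' = x \<longrightarrow> y \<in> U) uniformity)" for U
    by (rule open_multiplier_def)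
  show "(norm a = 0) = (a = 0)"
    by (metis Rep_multiplier_inject Rep_multiplier_simps(5) norm_eq_zero norm_multiplier_def)
  show "norm (a + b) \<le> norm a + norm b"
    by (simp add: norm_multiplier_def Rep_multiplier_simps norm_triangle_ineq)
  show "norm (r *\<^sub>R a) = \<bar>r\<bar> * norm a"
    by (simp add: norm_multiplier_def Rep_multiplier_simps)
  show "norm (a * b) \<le> norm a * norm b"
    by (simp add: norm_multiplier_def Rep_multiplier_simps norm_blinfun_compose)
qed

end

instantiation multiplier :: (cstar_algebra) complex_vector
begin

definition scaleC_multiplier :: "complex \<Rightarrow> 'a multiplier \<Rightarrow> 'a multiplier" where
  "scaleC c m = multiplier_of (\<lambda>x. scaleC c (mapply m x))"

lemma mapply_scaleC [simp]: "mapply (scaleC c m) x = scaleC c (mapply m (x::'a))"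
  unfolding scaleC_multiplier_def
  by (simp add: mapply_multiplier_of[OF adjoints_scaleC[OF adjoints_madj]])

instance
proof
  fix a b :: "'a multiplier" and r :: real and z w :: complex
  show "scaleC z (a + b) = scaleC z a + scaleC z b"
    by (rule multiplier_eqI) (simp add: scaleC_add_right)
  show "scaleC (z + w) a = scaleC z a + scaleC w a"
    by (rule multiplier_eqI) (simp add: scaleC_add_left)
  show "scaleC z (scaleC w a) = scaleC (z * w) a"
    by (rule multiplier_eqI) (simp add: scaleC_scaleC)
  show "scaleC 1 a = a" by (rule multiplier_eqI) (simp add: scaleC_one)
  show "r *\<^sub>R a = scaleC (complex_of_real r) a" by (rule multiplier_eqI) (simp add: scaleR_scaleC)
qed

end

lemma norm_mapply: "norm (mapply m x) \<le> norm m * norm x"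
  by (simp add: mapply_def norm_multiplier_def norm_blinfun)

lemma norm_multiplier_le: "0 \<le> b \<Longrightarrow> (\<And>x. norm (mapply m x) \<le> b * norm x) \<Longrightarrow> norm m \<le> b"
  by (simp add: mapply_def norm_multiplier_def norm_blinfun_bound)

lemma mapply_madj_mult: "mapply (madj (m * n)) x = mapply (madj n) (mapply (madj m) x)"
proof -
  have "adjoints (mapply (m * n)) (mapply (madj n * madj m))"
    using adjoints_comp[OF adjoints_madj[of m] adjoints_madj[of n]]
    by (simp add: mapply_simps(5)[abs_def])
  from madj_eqI[OF this] show ?thesis by simp
qed

lemma madj_madj: "madj (madj m) = m"
  by (rule madj_eqI, rule adjoints_sym, rule adjoints_madj)

lemma norm_madj_mult: "norm (madj m * m) = (norm m)\<^sup>2" and norm_madj: "norm (madj m) = norm m"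
proof -
  have sq: "(norm m)\<^sup>2 \<le> norm (madj m * m)" for m :: "'a multiplier"
  proof -
    have "norm m \<le> sqrt (norm (madj m * m))"
    proof (rule norm_multiplier_le)
      fix x
      have "(norm (mapply m x))\<^sup>2 = norm (star x * mapply (madj m * m) x)"
        by (simp add: cstar_identity[symmetric] star_mapply_mult)
      also have "\<dots> \<le> norm x * (norm (madj m * m) * norm x)"
        using mult_left_mono[OF norm_mapply[of "madj m * m" x], of "norm x"]
        by (intro order_trans[OF norm_mult_ineq]) (simp add: norm_star)
      also have "\<dots> = (sqrt (norm (madj m * m)) * norm x)\<^sup>2"
        by (simp add: power_mult_distrib power2_eq_square)
      finally show "norm (mapply m x) \<le> sqrt (norm (madj m * m)) * norm x"
        by (rule power2_le_imp_le) simp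
    qed simp
    from power_mono[OF this, of 2] show ?thesis by simp
  qed
  have le: "norm m \<le> norm (madj m)" for m :: "'a multiplier"
    using order_trans[OF sq norm_mult_ineq[of "madj m" m]] by (cases "norm m = 0") (auto simp: power2_eq_square)
  show eq: "norm (madj m) = norm m" using le[of m] le[of "madj m"] by (simp add: madj_madj)
  show "norm (madj m * m) = (norm m)\<^sup>2"
    using sq[of m] norm_mult_ineq[of "madj m" m] by (simp add: eq power2_eq_square)
qed

lemma madj_add: "madj (m + n) = madj m + madj n"
  using adjoints_add[OF adjoints_madj[of m] adjoints_madj[of n]]
  by (intro madj_eqI) (simp add: mapply_simps(3)[abs_def])

lemma madj_scaleC: "madj (scaleC c m) = scaleC (cnj c) (madj m)"
  using adjoints_scaleC[OF adjoints_madj[of m]]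
  by (intro madj_eqI) (simp add: mapply_scaleC[abs_def])

lemma madj_diff: "madj (m - n) = madj m - madj n"
proof -
  have "madj (m - n) + madj n = madj m" by (simp add: madj_add[symmetric])
  then show ?thesis by (simp add: eq_diff_eq)
qed

instance multiplier :: (cstar_algebra) banach
proof
  fix X :: "nat \<Rightarrow> 'a multiplier" assume X: "Cauchy X"
  have Rep: "convergent (\<lambda>n. Rep_multiplier (Y n))" if "Cauchy Y" for Y :: "nat \<Rightarrow> 'a multiplier"
  proof (rule Cauchy_convergent)
    show "Cauchy (\<lambda>n. Rep_multiplier (Y n))"
      using that unfolding Cauchy_def dist_norm Rep_multiplier_simps(4)[symmetric]
      by (simp add: norm_multiplier_def)
  qed
  have "Cauchy (\<lambda>n. madj (X n))"
    using X unfolding Cauchy_def dist_norm madj_diff[symmetric] norm_madj .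
  from Rep[OF X] Rep[OF this] obtain T S where
    T: "(\<lambda>n. Rep_multiplier (X n)) \<longlonglongrightarrow> T" and S: "(\<lambda>n. Rep_multiplier (madj (X n))) \<longlonglongrightarrow> S"
    by (auto simp: convergent_def)
  have "star (blinfun_apply T x) * y = star x * blinfun_apply S y" for x y
  proof (rule LIMSEQ_unique)
    show "(\<lambda>n. star (mapply (X n) x) * y) \<longlonglongrightarrow> star (blinfun_apply T x) * y"
      unfolding mapply_def
      by (intro tendsto_mult tendsto_star tendsto_const blinfun.tendsto T)
    show "(\<lambda>n. star (mapply (X n) x) * y) \<longlonglongrightarrow> star x * blinfun_apply S y"
      unfolding star_mapply_mult unfolding mapply_def
      by (intro tendsto_mult tendsto_star tendsto_const blinfun.tendsto S)
  qed
  then have "adjoints (blinfun_apply T) (blinfun_apply S)"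
    by (simp add: adjoints_def blinfun.bounded_linear_right)
  then have T': "Rep_multiplier (Abs_multiplier T) = T"
    by (intro Abs_multiplier_inverse) auto
  have "X \<longlonglongrightarrow> Abs_multiplier T"
    using T unfolding LIMSEQ_def dist_norm
    by (subst (asm) T'[symmetric]) (simp only: Rep_multiplier_simps(4)[symmetric] norm_multiplier_def)
  then show "convergent X" by (auto simp: convergent_def)
qed

instantiation multiplier :: (cstar_algebra) cstar_algebra
begin

definition star_multiplier :: "'a multiplier \<Rightarrow> 'a multiplier" where "star m = madj m"

instance
proof
  fix a b :: "'a multiplier" and z :: complex
  show "scaleC z a * b = scaleC z (a * b)" by (rule multiplier_eqI) simp
  have "mapply a (scaleC z x) = scaleC z (mapply a x)" for x
  proof (rule cstar_nondegenerate)
    fix y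
    have "star y * mapply a (scaleC z x) = scaleC z (star (mapply (madj a) y) * x)"
      using star_mapply_mult[of "madj a" y "scaleC z x"] by (simp add: madj_madj mult_scaleC_right)
    then show "star y * mapply a (scaleC z x) = star y * scaleC z (mapply a x)"
      by (simp add: star_mapply_mult madj_madj mult_scaleC_right)
  qed
  then show "a * scaleC z b = scaleC z (a * b)" by (intro multiplier_eqI) simp
  have le: "norm (scaleC z a) \<le> cmod z * norm a" for z and a :: "'a multiplier"
  proof (rule norm_multiplier_le)
    show "norm (mapply (scaleC z a) x) \<le> cmod z * norm a * norm x" for x
      using mult_left_mono[OF norm_mapply[of a x], of "cmod z"] by (simp add: norm_scaleC mult.assoc)
  qed simp
  show "norm (scaleC z a) = cmod z * norm a"
  proof (cases "z = 0")
    case True with le[of z a] show ?thesis by simp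
  next
    case False
    then have "norm a \<le> cmod (inverse z) * norm (scaleC z a)"
      using le[of "inverse z" "scaleC z a"] by (simp add: scaleC_scaleC scaleC_one)
    then have "cmod z * norm a \<le> norm (scaleC z a)"
      using False by (simp add: norm_divide divide_simps mult.commute)
    with le[of z a] show ?thesis by simp
  qed
  show "star (star a) = a" by (simp add: star_multiplier_def madj_madj)
  show "star (a + b) = star a + star b" by (simp add: star_multiplier_def madj_add)
  show "star (scaleC z a) = scaleC (cnj z) (star a)" by (simp add: star_multiplier_def madj_scaleC)
  show "star (a * b) = star b * star a"
    by (rule multiplier_eqI) (simp add: star_multiplier_def mapply_madj_mult)
  show "norm (star a * a) = (norm a)\<^sup>2" by (simp add: star_multiplier_def norm_madj_mult)
qed

end

definition left_mult :: "'a::cstar_algebra \<Rightarrow> 'a multiplier" where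
  "left_mult a = multiplier_of ((*) a)"

lemma mapply_left_mult [simp]: "mapply (left_mult a) x = a * x"
  by (simp add: left_mult_def mapply_multiplier_of[OF adjoints_mult])

lemma left_mult_linear:
  "left_mult (a + b) = left_mult a + left_mult b" "left_mult (a - b) = left_mult a - left_mult b"
  "left_mult (r *\<^sub>R a) = r *\<^sub>R left_mult a" "left_mult (a * b) = left_mult a * left_mult b"
  "left_mult 0 = 0"
  by (rule multiplier_eqI; simp add: algebra_simps)+

lemma left_mult_star: "left_mult (star a) = star (left_mult a)"
proof -
  have "adjoints (mapply (left_mult a)) (mapply (left_mult (star a)))"
    using adjoints_mult[of a] by (simp add: mapply_left_mult[abs_def])
  then show ?thesis by (simp add: star_multiplier_def madj_eqI)
qed

lemma norm_left_mult: "norm (left_mult a) = norm a"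
proof (rule antisym)
  show "norm (left_mult a) \<le> norm a" by (rule norm_multiplier_le) (simp_all add: norm_mult_ineq)
  have "(norm (star a))\<^sup>2 \<le> norm (left_mult a) * norm (star a)"
    using norm_mapply[of "left_mult a" "star a"] cstar_identity[of "star a"] by (simp add: star_star)
  then show "norm a \<le> norm (left_mult a)"
    by (cases "a = 0") (auto simp: power2_eq_square norm_star)
qed

section \<open>Positive elements in the absence of a unit\<close>

definition nonneg :: "'a::cstar_algebra \<Rightarrow> bool" where
  "nonneg a \<longleftrightarrow> psd (left_mult a)"

lemma nonneg_star_mult: "nonneg (star b * b)"
  by (simp add: nonneg_def left_mult_linear left_mult_star psd_star_mult)

lemma nonneg_positives: "a \<in> positives \<Longrightarrow> nonneg a"
  by (auto simp: positives_def nonneg_star_mult)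

lemma nonneg_add: "nonneg a \<Longrightarrow> nonneg b \<Longrightarrow> nonneg (a + b)"
  by (simp add: nonneg_def left_mult_linear psd_add)

lemma nonneg_zero: "nonneg 0"
  using nonneg_star_mult[of 0] by simp

lemma nonneg_sum: "(\<And>i. i \<in> I \<Longrightarrow> nonneg (f i)) \<Longrightarrow> nonneg (sum f I)"
  by (induction I rule: infinite_finite_induct) (auto simp: nonneg_zero nonneg_add)

lemma nonneg_scaleR: "nonneg a \<Longrightarrow> 0 \<le> r \<Longrightarrow> nonneg (r *\<^sub>R a)"
  by (simp add: nonneg_def left_mult_linear psd_scaleR)

lemma norm_mono_nonneg:
  assumes "nonneg a" "nonneg (b - a)"
  shows "norm a \<le> norm b"
  using psd_norm_mono[of "left_mult a" "left_mult (b - a)"] assms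
  by (simp add: nonneg_def left_mult_linear(1)[symmetric] norm_left_mult)

text \<open>
  The inequality \<open>x\<^sup>* a x \<le> t x\<^sup>* x\<close>: the difference is \<open>(e x)\<^sup>* (e x)\<close> for a root \<open>e\<close> of the multiplier
  \<open>t - a\<close>.
\<close>

lemma nonneg_conj_diff:
  assumes "nonneg a" "norm a \<le> t"
  shows "nonneg (t *\<^sub>R (star x * x) - star x * (a * x))"
proof -
  have "psd (t *\<^sub>R 1 - left_mult a)"
    using assms by (intro psd_diff_of_norm) (auto simp: nonneg_def norm_left_mult)
  then obtain e where e: "star e = e" "t *\<^sub>R 1 - left_mult a = e * e" by (auto simp: psd_def)
  have "left_mult (t *\<^sub>R (star x * x) - star x * (a * x)) =
      star (left_mult x) * ((t *\<^sub>R 1 - left_mult a) * left_mult x)"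
    by (simp add: left_mult_linear left_mult_star algebra_simps)
  also have "\<dots> = star (e * left_mult x) * (e * left_mult x)"
    by (simp add: e star_mult mult.assoc)
  finally show ?thesis by (simp add: nonneg_def psd_star_mult)
qed

lemma psd_iff_norm:
  fixes h :: "'a::{cstar_algebra,monoid_mult}"
  shows "psd h \<longleftrightarrow> star h = h \<and> norm (norm h *\<^sub>R 1 - h) \<le> norm h"
  using psd_star[of h] norm_diff_of_psd[of h "norm h"] psdI[of "norm h" h] by blast

text \<open>
  The norm criterion \<open>psd_iff_norm\<close> is a closed condition.
\<close>

lemma nonneg_LIMSEQ:
  assumes "f \<longlonglongrightarrow> a" "\<And>n. nonneg (f n)"
  shows "nonneg a"
proof -
  have L: "(\<lambda>n. left_mult (f n)) \<longlonglongrightarrow> left_mult a"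
    using assms(1) by (simp add: LIMSEQ_def dist_norm left_mult_linear(2)[symmetric] norm_left_mult)
  have "star (left_mult a) = left_mult a"
    using LIMSEQ_unique[OF tendsto_star[OF L]] L assms(2) by (simp add: nonneg_def psd_star)
  moreover have "norm (norm (left_mult a) *\<^sub>R 1 - left_mult a) \<le> norm (left_mult a)"
  proof (rule LIMSEQ_le)
    show "(\<lambda>n. norm (norm (left_mult (f n)) *\<^sub>R 1 - left_mult (f n))) \<longlonglongrightarrow>
        norm (norm (left_mult a) *\<^sub>R 1 - left_mult a)"
      by (intro tendsto_intros L)
    show "(\<lambda>n. norm (left_mult (f n))) \<longlonglongrightarrow> norm (left_mult a)"
      by (intro tendsto_intros L)
    show "\<exists>N. \<forall>n\<ge>N. norm (norm (left_mult (f n)) *\<^sub>R 1 - left_mult (f n)) \<le> norm (left_mult (f n))"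
      using assms(2) by (simp add: nonneg_def psd_iff_norm[symmetric]) (metis psd_iff_norm)
  qed
  ultimately show ?thesis by (simp add: nonneg_def psd_iff_norm)
qed

text \<open>
  The root stays inside the algebra, so that it can be inserted into a left action, which is defined
  on the algebra only.
\<close>

lemma half_root_nonunital:
  fixes a :: "'a::cstar_algebra"
  assumes "norm a \<le> 1"
  obtains y where "star y = y" "star a * a = y + y - y * y"
proof (rule that)
  have n: "norm (star a * a) \<le> 1" "star (star a * a) = star a * a"
    using assms by (simp_all add: cstar_identity power_le_one star_mult star_star)
  show "star (half_root (star a * a)) = half_root (star a * a)" by (rule star_half_root[OF n])
  show "star a * a = half_root (star a * a) + half_root (star a * a) - half_root (star a * a) * half_root (star a * a)"
    by (rule half_root_eq[OF n(1), symmetric])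
qed

section \<open>Inner products and norms of Hilbert modules\<close>

lemma adjoint_pair_sym:
  assumes "hilbert_module E" "adjoint_pair E T S"
  shows "adjoint_pair E S T"
proof -
  interpret hilbert_module E by fact
  have "ip E (S \<xi>) \<eta> = ip E \<xi> (T \<eta>)" if "\<xi> \<in> mcarrier E" "\<eta> \<in> mcarrier E" for \<xi> \<eta>
    using assms(2) that ip_star[of \<eta> "S \<xi>"] ip_star[of "T \<eta>" \<xi>] unfolding adjoint_pair_def
    by (metis PiE)
  then show ?thesis using assms(2) by (simp add: adjoint_pair_def)
qed

context hilbert_module
begin

lemma carrier_closed [simp, intro]:
  "0 \<in> mcarrier E"
  "x \<in> mcarrier E \<Longrightarrow> y \<in> mcarrier E \<Longrightarrow> x + y \<in> mcarrier E"
  "x \<in> mcarrier E \<Longrightarrow> y \<in> mcarrier E \<Longrightarrow> x - y \<in> mcarrier E"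
  "x \<in> mcarrier E \<Longrightarrow> scaleC c x \<in> mcarrier E"
  "x \<in> mcarrier E \<Longrightarrow> r *\<^sub>R x \<in> mcarrier E"
  "x \<in> mcarrier E \<Longrightarrow> ract E x a \<in> mcarrier E"
  using subspace complex_vector.subspace_diff[OF subspace, of x y]
  by (auto simp: complex_vector.subspace_def scaleR_scaleC ract_closed)

lemma carrier_sum [intro]: "(\<And>i. i \<in> I \<Longrightarrow> f i \<in> mcarrier E) \<Longrightarrow> sum f I \<in> mcarrier E"
  by (rule complex_vector.subspace_sum[OF subspace])

lemma ip_zero_right [simp]: "x \<in> mcarrier E \<Longrightarrow> ip E x 0 = 0"
  using ip_add[of x 0 0] by simp

lemma ip_diff_right:
  assumes "x \<in> mcarrier E" "y \<in> mcarrier E" "z \<in> mcarrier E"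
  shows "ip E x (y - z) = ip E x y - ip E x z"
  using ip_add[of x "y - z" z] assms by (simp add: eq_diff_eq)

lemma ip_scaleR_right:
  "x \<in> mcarrier E \<Longrightarrow> y \<in> mcarrier E \<Longrightarrow> ip E x (r *\<^sub>R y) = r *\<^sub>R ip E x y"
  by (simp add: scaleR_scaleC ip_scaleC)

lemma ip_sum_right:
  "x \<in> mcarrier E \<Longrightarrow> (\<And>i. i \<in> I \<Longrightarrow> f i \<in> mcarrier E) \<Longrightarrow> ip E x (sum f I) = (\<Sum>i\<in>I. ip E x (f i))"
  by (induction I rule: infinite_finite_induct) (simp_all add: ip_add carrier_sum)

lemma ip_zero_left [simp]: "x \<in> mcarrier E \<Longrightarrow> ip E 0 x = 0"
  using ip_star[of x 0] by simp

lemma ip_add_left: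
  "x \<in> mcarrier E \<Longrightarrow> y \<in> mcarrier E \<Longrightarrow> z \<in> mcarrier E \<Longrightarrow> ip E (x + y) z = ip E x z + ip E y z"
  using ip_star[of z "x + y"] by (simp add: ip_add star_add ip_star)

lemma ip_diff_left:
  "x \<in> mcarrier E \<Longrightarrow> y \<in> mcarrier E \<Longrightarrow> z \<in> mcarrier E \<Longrightarrow> ip E (x - y) z = ip E x z - ip E y z"
  using ip_star[of z "x - y"] by (simp add: ip_diff_right star_diff ip_star)

lemma ip_scaleC_left:
  "x \<in> mcarrier E \<Longrightarrow> y \<in> mcarrier E \<Longrightarrow> ip E (scaleC c x) y = scaleC (cnj c) (ip E x y)"
  using ip_star[of y "scaleC c x"] by (simp add: ip_scaleC star_scaleC ip_star)

lemma ip_scaleR_left: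
  "x \<in> mcarrier E \<Longrightarrow> y \<in> mcarrier E \<Longrightarrow> ip E (r *\<^sub>R x) y = r *\<^sub>R ip E x y"
  by (simp add: scaleR_scaleC ip_scaleC_left)

lemma ip_sum_left:
  assumes "x \<in> mcarrier E" "\<And>i. i \<in> I \<Longrightarrow> f i \<in> mcarrier E"
  shows "ip E (sum f I) x = (\<Sum>i\<in>I. ip E (f i) x)"
proof -
  have "ip E (sum f I) x = star (ip E x (sum f I))" using assms by (simp add: ip_star carrier_sum)
  also have "\<dots> = (\<Sum>i\<in>I. ip E (f i) x)" using assms by (simp add: ip_sum_right star_sum ip_star)
  finally show ?thesis .
qed

lemma ip_ract_left:
  "x \<in> mcarrier E \<Longrightarrow> y \<in> mcarrier E \<Longrightarrow> ip E (ract E x a) y = star a * ip E x y"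
  using ip_star[of y "ract E x a"] by (simp add: ip_ract star_mult ip_star)

lemma ip_nondegenerate:
  assumes "x \<in> mcarrier E" "y \<in> mcarrier E" "\<And>z. z \<in> mcarrier E \<Longrightarrow> ip E z x = ip E z y"
  shows "x = y"
proof -
  have "ip E (x - y) (x - y) = 0" using assms by (simp add: ip_diff_right)
  then show ?thesis using ip_definite[of "x - y"] assms by simp
qed

lemma nonneg_ip: "x \<in> mcarrier E \<Longrightarrow> nonneg (ip E x x)"
  by (rule nonneg_positives[OF ip_pos])

lemma
  assumes "adjoint_pair E T S"
  shows adjoint_closed: "x \<in> mcarrier E \<Longrightarrow> T x \<in> mcarrier E"
    and adjoint_closed': "x \<in> mcarrier E \<Longrightarrow> S x \<in> mcarrier E"
    and adjoint_ip: "x \<in> mcarrier E \<Longrightarrow> y \<in> mcarrier E \<Longrightarrow> ip E (T x) y = ip E x (S y)"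
    and adjoint_ip': "x \<in> mcarrier E \<Longrightarrow> y \<in> mcarrier E \<Longrightarrow> ip E (S x) y = ip E x (T y)"
  using assms adjoint_pair_sym[OF hilbert_module_axioms assms] by (auto simp: adjoint_pair_def)

lemma
  assumes T: "adjoint_pair E T S" and x: "x \<in> mcarrier E"
  shows adjoint_add: "y \<in> mcarrier E \<Longrightarrow> T (x + y) = T x + T y"
    and adjoint_diff: "y \<in> mcarrier E \<Longrightarrow> T (x - y) = T x - T y"
    and adjoint_scaleC: "T (scaleC c x) = scaleC c (T x)"
    and adjoint_scaleR: "T (r *\<^sub>R x) = r *\<^sub>R T x"
    and adjoint_ract: "T (ract E x a) = ract E (T x) a"
proof -
  note [simp] = adjoint_ip'[OF T, symmetric] adjoint_closed[OF T] adjoint_closed'[OF T] x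
    ip_add ip_diff_right ip_scaleC ip_scaleR_right ip_ract
  show "T (x + y) = T x + T y" "T (x - y) = T x - T y" if [simp]: "y \<in> mcarrier E"
    by (rule ip_nondegenerate; simp)+
  show "T (scaleC c x) = scaleC c (T x)" "T (r *\<^sub>R x) = r *\<^sub>R T x"
    "T (ract E x a) = ract E (T x) a"
    by (rule ip_nondegenerate; simp)+
qed

lemma adjoint_sum:
  assumes T: "adjoint_pair E T S" and "\<And>i. i \<in> I \<Longrightarrow> f i \<in> mcarrier E"
  shows "T (sum f I) = (\<Sum>i\<in>I. T (f i))"
proof -
  have "T 0 = 0" using adjoint_scaleR[OF T, of 0 0] by simp
  then show ?thesis using assms(2)
    by (induction I rule: infinite_finite_induct) (simp_all add: adjoint_add[OF T] carrier_sum)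
qed

lemma adjoint_pair_id: "adjoint_pair E (\<lambda>x. x) (\<lambda>x. x)"
  by (simp add: adjoint_pair_def)

text \<open>
  The Cauchy-Schwarz inequality for the semi-inner product \<open>\<langle>y, K x\<rangle>\<close> of a positive operator \<open>K\<close>, from
  positivity of the form at \<open>x - y c / t\<close>, where \<open>c = \<langle>y, K x\<rangle>\<close> and \<open>t \<ge> \<parallel>\<langle>y, K y\<rangle>\<parallel>\<close>.  The case
  \<open>K = 1\<close> makes \<open>mnorm\<close> a norm; the general case yields \<open>contraction_of_nonneg\<close>.
\<close>

lemma semi_cauchy_schwarz:
  assumes K: "adjoint_pair E K K" and pos: "\<And>z. z \<in> mcarrier E \<Longrightarrow> nonneg (ip E z (K z))"
    and x: "x \<in> mcarrier E" and y: "y \<in> mcarrier E"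
  shows "(norm (ip E y (K x)))\<^sup>2 \<le> norm (ip E y (K y)) * norm (ip E x (K x))"
proof -
  define c where "c = ip E y (K x)"
  define b where "b = ip E y (K y)"
  define d where "d = ip E x (K x)"
  note [simp] = x y adjoint_closed[OF K]
  have star_c: "ip E x (K y) = star c"
    using ip_star[of "y" "K x"] by (simp add: c_def adjoint_ip[OF K])
  have *: "(norm c)\<^sup>2 \<le> t * norm d" if t: "0 < t" "norm b \<le> t" for t
  proof -
    define v where "v = x - ract E y ((1/t) *\<^sub>R c)"
    have Kv: "K v = K x - ract E (K y) ((1/t) *\<^sub>R c)"
      by (simp add: v_def adjoint_diff[OF K] adjoint_ract[OF K])
    have "ip E v (K v) = d - (1/t) *\<^sub>R (star c * c) - (1/t) *\<^sub>R (star c * c) + (1/t^2) *\<^sub>R (star c * (b * c))"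
      unfolding Kv unfolding v_def
      by (simp add: ip_diff_left ip_diff_right ip_ract ip_ract_left star_c star_scaleR
          d_def[symmetric] c_def[symmetric] b_def[symmetric] power2_eq_square algebra_simps)
    moreover have "v \<in> mcarrier E" by (simp add: v_def)
    ultimately have "nonneg (d - (1/t) *\<^sub>R (star c * c) - (1/t) *\<^sub>R (star c * c) + (1/t^2) *\<^sub>R (star c * (b * c)))"
      using pos[of v] by simp
    moreover have "nonneg ((1/t^2) *\<^sub>R (t *\<^sub>R (star c * c) - star c * (b * c)))"
      using pos[of y] t by (intro nonneg_scaleR nonneg_conj_diff) (auto simp: b_def)
    ultimately have "nonneg ((d - (1/t) *\<^sub>R (star c * c) - (1/t) *\<^sub>R (star c * c) + (1/t^2) *\<^sub>R (star c * (b * c)))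
        + (1/t^2) *\<^sub>R (t *\<^sub>R (star c * c) - star c * (b * c)))"
      by (rule nonneg_add)
    also have "(d - (1/t) *\<^sub>R (star c * c) - (1/t) *\<^sub>R (star c * c) + (1/t^2) *\<^sub>R (star c * (b * c)))
        + (1/t^2) *\<^sub>R (t *\<^sub>R (star c * c) - star c * (b * c)) = d - (1/t) *\<^sub>R (star c * c)"
      using t(1) by (simp add: algebra_simps power2_eq_square)
    finally have "norm ((1/t) *\<^sub>R (star c * c)) \<le> norm d"
      using t(1) by (intro norm_mono_nonneg nonneg_scaleR nonneg_star_mult) auto
    then show ?thesis using t(1) by (simp add: cstar_identity field_simps)
  qed
  have "(norm c)\<^sup>2 \<le> norm b * norm d"
  proof (rule field_le_epsilon)
    fix e :: real assume e: "0 < e"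
    have "0 < norm b + e / (norm d + 1)" using e by (intro add_nonneg_pos divide_pos_pos) (auto intro: add_nonneg_pos)
    moreover have "0 < norm d + 1" by (rule add_nonneg_pos) auto
    moreover from this have "e / (norm d + 1) * norm d \<le> e" using e by (simp add: field_simps)
    ultimately show "(norm c)\<^sup>2 \<le> norm b * norm d + e"
      using *[of "norm b + e / (norm d + 1)"] e by (simp add: distrib_right)
  qed
  then show ?thesis by (simp add: c_def b_def d_def)
qed

lemma mnorm_square: "(mnorm E x)\<^sup>2 = norm (ip E x x)"
  by (simp add: mnorm_def)

lemma mnorm_ge_zero [simp]: "0 \<le> mnorm E x"
  by (simp add: mnorm_def)

lemma norm_ip_le:
  assumes "x \<in> mcarrier E" "y \<in> mcarrier E"
  shows "norm (ip E y x) \<le> mnorm E y * mnorm E x"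
proof (rule power2_le_imp_le)
  show "(norm (ip E y x))\<^sup>2 \<le> (mnorm E y * mnorm E x)\<^sup>2"
    using semi_cauchy_schwarz[OF adjoint_pair_id nonneg_ip assms]
    by (simp add: power_mult_distrib mnorm_square)
qed simp

lemma mnorm_triangle:
  assumes "x \<in> mcarrier E" "y \<in> mcarrier E"
  shows "mnorm E (x + y) \<le> mnorm E x + mnorm E y"
proof (rule power2_le_imp_le)
  have "norm (ip E (x + y) (x + y)) \<le> norm (ip E x x) + norm (ip E x y) + (norm (ip E y x) + norm (ip E y y))"
    using assms by (simp add: ip_add ip_add_left norm_triangle_ineq norm_triangle_le add_mono add.assoc)
  also have "\<dots> \<le> norm (ip E x x) + mnorm E x * mnorm E y + (mnorm E y * mnorm E x + norm (ip E y y))"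
    using assms by (intro add_mono norm_ip_le) auto
  finally show "(mnorm E (x + y))\<^sup>2 \<le> (mnorm E x + mnorm E y)\<^sup>2"
    by (simp add: mnorm_square power2_sum)
qed simp

lemma mnorm_scaleC: "x \<in> mcarrier E \<Longrightarrow> mnorm E (scaleC c x) = cmod c * mnorm E x"
  by (simp add: mnorm_def ip_scaleC ip_scaleC_left norm_scaleC real_sqrt_mult norm_mult)

lemma mnorm_scaleR: "x \<in> mcarrier E \<Longrightarrow> mnorm E (r *\<^sub>R x) = \<bar>r\<bar> * mnorm E x"
  by (simp add: scaleR_scaleC mnorm_scaleC)

lemma mnorm_zero [simp]: "mnorm E 0 = 0"
  by (simp add: mnorm_def)

lemma mnorm_eq_zero: "x \<in> mcarrier E \<Longrightarrow> mnorm E x = 0 \<Longrightarrow> x = 0"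
  by (simp add: mnorm_def ip_definite)

lemma mnorm_minus_commute:
  assumes "x \<in> mcarrier E" "y \<in> mcarrier E"
  shows "mnorm E (x - y) = mnorm E (y - x)"
  using mnorm_scaleR[of "x - y" "-1"] assms by simp

lemma mnorm_triangle_diff:
  assumes "x \<in> mcarrier E" "y \<in> mcarrier E" "z \<in> mcarrier E"
  shows "mnorm E (x - z) \<le> mnorm E (x - y) + mnorm E (y - z)"
  using mnorm_triangle[of "x - y" "y - z"] assms by simp

lemma mnorm_sum:
  "(\<And>i. i \<in> I \<Longrightarrow> f i \<in> mcarrier E) \<Longrightarrow> mnorm E (sum f I) \<le> (\<Sum>i\<in>I. mnorm E (f i))"
proof (induction I rule: infinite_finite_induct)
  case (insert i I)
  then show ?case using mnorm_triangle[of "f i" "sum f I"] by (simp add: carrier_sum)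
qed simp_all

lemma mnorm_ract:
  assumes "x \<in> mcarrier E"
  shows "mnorm E (ract E x a) \<le> mnorm E x * norm a"
proof (rule power2_le_imp_le)
  have "norm (star a * (ip E x x * a)) \<le> norm (star a) * (norm (ip E x x) * norm a)"
    by (rule order_trans[OF norm_mult_ineq]) (simp add: norm_mult_ineq mult_left_mono)
  also have "\<dots> = norm (ip E x x) * (norm a)\<^sup>2"
    by (simp add: norm_star power2_eq_square)
  finally show "(mnorm E (ract E x a))\<^sup>2 \<le> (mnorm E x * norm a)\<^sup>2"
    using assms by (simp add: mnorm_square ip_ract ip_ract_left power_mult_distrib mult.assoc)
qed simp

text \<open>
  An operator with \<open>0 \<le> K \<le> 1\<close> in the weak sense is a contraction: apply Cauchy-Schwarz for the form of
  \<open>K\<close> to the pair \<open>K x\<close>, \<open>x\<close>.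
\<close>

lemma contraction_of_nonneg:
  assumes K: "adjoint_pair E K K" and pos: "\<And>z. z \<in> mcarrier E \<Longrightarrow> nonneg (ip E z (K z))"
    and le: "\<And>z. z \<in> mcarrier E \<Longrightarrow> nonneg (ip E z z - ip E z (K z))"
    and x: "x \<in> mcarrier E"
  shows "mnorm E (K x) \<le> mnorm E x"
proof -
  note [simp] = x adjoint_closed[OF K]
  let ?n = "norm (ip E (K x) (K x))"
  have "?n * ?n \<le> norm (ip E (K x) (K (K x))) * norm (ip E x (K x))"
    using semi_cauchy_schwarz[OF K pos x, of "K x"] by (simp add: power2_eq_square)
  also have "\<dots> \<le> ?n * norm (ip E x x)"
    using norm_mono_nonneg[OF pos[of "K x"] le[of "K x"]] norm_mono_nonneg[OF pos[of x] le[of x]]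
    by (intro mult_mono) auto
  finally have "?n \<le> norm (ip E x x)" by (cases "?n = 0") auto
  then show ?thesis by (simp add: mnorm_def)
qed

end

section \<open>Square roots of operators on Hilbert modules\<close>

text \<open>
  The vectors of a module live in a mere vector space, so convergence in the module norm is a notion
  of its own.
\<close>

definition mlim :: "('a::cstar_algebra, 'x::complex_vector) corr \<Rightarrow> (nat \<Rightarrow> 'x) \<Rightarrow> 'x \<Rightarrow> bool" where
  "mlim E f x \<longleftrightarrow> (\<forall>n. f n \<in> mcarrier E) \<and> x \<in> mcarrier E \<and> (\<lambda>n. mnorm E (f n - x)) \<longlonglongrightarrow> 0"

text \<open>
  Visser's iteration once more, for operators and evaluated at vectors.
\<close>

primrec op_visser :: "('x::real_vector \<Rightarrow> 'x) \<Rightarrow> nat \<Rightarrow> 'x \<Rightarrow> 'x" where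
  "op_visser K 0 x = 0"
| "op_visser K (Suc n) x = (1/2) *\<^sub>R (K x + op_visser K n (op_visser K n x))"

context hilbert_module
begin

lemma mlim_bound:
  assumes "mlim E f x" "\<And>n. g n \<in> mcarrier E" "y \<in> mcarrier E"
    "\<And>n. mnorm E (g n - y) \<le> c * mnorm E (f n - x)"
  shows "mlim E g y"
proof -
  have "(\<lambda>n. c * mnorm E (f n - x)) \<longlonglongrightarrow> 0"
    using assms(1) by (auto simp: mlim_def intro: tendsto_mult_right_zero)
  then have "(\<lambda>n. mnorm E (g n - y)) \<longlonglongrightarrow> 0"
    by (rule Lim_null_comparison[rotated]) (use assms(4) in simp)
  then show ?thesis using assms(2,3) by (simp add: mlim_def)
qed

lemma mlim_add:
  assumes "mlim E f x" "mlim E g y"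
  shows "mlim E (\<lambda>n. f n + g n) (x + y)"
proof -
  have lim: "(\<lambda>n. mnorm E (f n - x) + mnorm E (g n - y)) \<longlonglongrightarrow> 0"
    using assms by (intro tendsto_add_zero) (auto simp: mlim_def)
  have "mnorm E (f n + g n - (x + y)) \<le> mnorm E (f n - x) + mnorm E (g n - y)" for n
    using mnorm_triangle[of "f n - x" "g n - y"] assms by (simp add: mlim_def algebra_simps)
  then have "(\<lambda>n. mnorm E (f n + g n - (x + y))) \<longlonglongrightarrow> 0"
    by (intro Lim_null_comparison[OF _ lim]) simp
  then show ?thesis using assms by (simp add: mlim_def)
qed

lemma mlim_scaleR: "mlim E f x \<Longrightarrow> mlim E (\<lambda>n. r *\<^sub>R f n) (r *\<^sub>R x)"
  by (rule mlim_bound[where c="\<bar>r\<bar>"])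
    (auto simp: mlim_def scaleR_diff_right[symmetric] mnorm_scaleR)

lemma mlim_const: "x \<in> mcarrier E \<Longrightarrow> mlim E (\<lambda>n. x) x"
  by (simp add: mlim_def)

lemma mlim_unique:
  assumes "mlim E f x" "mlim E f y"
  shows "x = y"
proof -
  have "mlim E (\<lambda>n. f n + (-1) *\<^sub>R f n) (x + (-1) *\<^sub>R y)"
    by (intro mlim_add mlim_scaleR assms)
  then have "(\<lambda>n. mnorm E (0 - (x - y))) \<longlonglongrightarrow> 0" by (simp add: mlim_def)
  then have "mnorm E (0 - (x - y)) = 0" by (simp add: LIMSEQ_const_iff)
  then show ?thesis
    using mnorm_eq_zero[of "0 - (x - y)"] assms by (simp add: mlim_def)
qed

lemma mlim_ip:
  assumes "mlim E f x" "y \<in> mcarrier E"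
  shows "(\<lambda>n. ip E y (f n)) \<longlonglongrightarrow> ip E y x" "(\<lambda>n. ip E (f n) y) \<longlonglongrightarrow> ip E x y"
proof -
  have lim: "(\<lambda>n. mnorm E y * mnorm E (f n - x)) \<longlonglongrightarrow> 0"
    using assms(1) by (auto simp: mlim_def intro: tendsto_mult_right_zero)
  have "(\<lambda>n. ip E y (f n) - ip E y x) \<longlonglongrightarrow> 0"
    by (rule Lim_null_comparison[OF _ lim])
      (use norm_ip_le[of "f _ - x" y] assms in \<open>simp add: ip_diff_right mlim_def\<close>)
  then show 1: "(\<lambda>n. ip E y (f n)) \<longlonglongrightarrow> ip E y x" by (rule LIM_zero_cancel)
  from tendsto_star[OF this] show "(\<lambda>n. ip E (f n) y) \<longlonglongrightarrow> ip E x y"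
    using assms by (simp add: mlim_def ip_star)
qed

text \<open>
  The square root that turns a weak inequality \<open>K \<le> 1\<close> into the factorisation \<open>1 - K = S\<^sup>* S\<close> demanded by
  \<open>op_positive\<close>.  The estimates are those for \<open>visser\<close>; the iterates converge at every vector because
  the module is complete, and the limit inherits symmetry and the commutation with \<open>K\<close>.
\<close>

lemma sqrt_one_minus_contraction:
  assumes K: "adjoint_pair E K K" and con: "\<And>x. x \<in> mcarrier E \<Longrightarrow> mnorm E (K x) \<le> mnorm E x"
  shows "\<exists>S. adjoint_pair E S S \<and> (\<forall>x\<in>mcarrier E. S (S x) = x - K x \<and> S (K x) = K (S x))"
proof -
  let ?v = "op_visser K" and ?q = "visser (1::real)"
  have v: "adjoint_pair E (?v n) (?v n)" for n
  proof (induction n)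
    case 0 then show ?case by (simp add: adjoint_pair_def)
  next
    case (Suc n)
    then show ?case using K adjoint_ip[OF K] adjoint_ip[OF Suc] adjoint_closed[OF K] adjoint_closed[OF Suc]
      by (simp add: adjoint_pair_def ip_add ip_add_left ip_scaleR_left ip_scaleR_right)
  qed
  note [simp] = adjoint_closed[OF v] adjoint_closed[OF K]
  have comm: "T (?v n x) = ?v n (T x)"
    if T: "adjoint_pair E T T" and TK: "\<And>x. x \<in> mcarrier E \<Longrightarrow> T (K x) = K (T x)"
      and x: "x \<in> mcarrier E" for T n x
    using x
  proof (induction n arbitrary: x)
    case 0 then show ?case using adjoint_scaleR[OF T, of 0 0] by simp
  next
    case (Suc n)
    then show ?case
      by (simp add: adjoint_scaleR[OF T] adjoint_add[OF T] TK)
  qed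
  have vK: "?v n (K x) = K (?v n x)" if "x \<in> mcarrier E" for n x
    using comm[OF K _ that] by simp
  have vv: "?v m (?v n x) = ?v n (?v m x)" if "x \<in> mcarrier E" for m n x
    using comm[OF v vK that] by simp
  have bd: "mnorm E (?v n x) \<le> ?q n * mnorm E x" if "x \<in> mcarrier E" for n x
    using that
  proof (induction n arbitrary: x)
    case (Suc n)
    have "mnorm E (?v n (?v n x)) \<le> ?q n * (?q n * mnorm E x)"
      using Suc visser_real[of n] by (intro order_trans[OF Suc.IH] mult_left_mono) auto
    then show ?case
      using mnorm_triangle[of "K x" "?v n (?v n x)"] con[of x] Suc.prems
      by (simp add: mnorm_scaleR distrib_right add_divide_distrib mult.assoc del: scaleR_add_right)
  qed simp
  have vstep: "mnorm E (?v (Suc n) x - ?v n x) \<le> (?q (Suc n) - ?q n) * mnorm E x"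
    if x: "x \<in> mcarrier E" for n x
    using x
  proof (induction n arbitrary: x)
    case 0 then show ?case using con[of x] by (simp add: mnorm_scaleR)
  next
    case (Suc n)
    note [simp] = Suc.prems
    define d where "d = ?v (Suc n) x - ?v n x"
    have [simp]: "d \<in> mcarrier E" unfolding d_def by (simp del: op_visser.simps)
    have "?v (Suc (Suc n)) x - ?v (Suc n) x =
        (1/2) *\<^sub>R (K x + ?v (Suc n) (?v (Suc n) x)) - (1/2) *\<^sub>R (K x + ?v n (?v n x))"
      by (rule arg_cong2[of _ _ _ _ minus]; rule op_visser.simps)
    also have "\<dots> = (1/2) *\<^sub>R (?v (Suc n) (?v (Suc n) x) - ?v n (?v n x))"
      by (simp only: scaleR_diff_right[symmetric] add_diff_cancel_left)
    also have "?v (Suc n) (?v (Suc n) x) - ?v n (?v n x) = ?v (Suc n) d + ?v n d"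
      unfolding d_def using vv[of x n "Suc n"]
      by (simp add: adjoint_diff[OF v] del: op_visser.simps)
    finally have eq: "?v (Suc (Suc n)) x - ?v (Suc n) x = (1/2) *\<^sub>R (?v (Suc n) d + ?v n d)" .
    have d: "mnorm E d \<le> (?q (Suc n) - ?q n) * mnorm E x" unfolding d_def by (rule Suc.IH) simp
    have d1: "mnorm E (?v (Suc n) d) \<le> ?q (Suc n) * ((?q (Suc n) - ?q n) * mnorm E x)"
      using visser_real[of "Suc n"] d
      by (intro order_trans[OF bd] mult_left_mono) (auto simp del: visser.simps op_visser.simps)
    have d2: "mnorm E (?v n d) \<le> ?q n * ((?q (Suc n) - ?q n) * mnorm E x)"
      using visser_real[of n] d
      by (intro order_trans[OF bd] mult_left_mono) (auto simp del: visser.simps op_visser.simps)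
    have "mnorm E ((1/2) *\<^sub>R (?v (Suc n) d + ?v n d)) \<le>
        (1/2) * (mnorm E (?v (Suc n) d) + mnorm E (?v n d))"
      using mnorm_triangle[of "?v (Suc n) d" "?v n d"]
      by (subst mnorm_scaleR) (auto simp del: visser.simps op_visser.simps)
    also have "\<dots> \<le> (1/2) * (?q (Suc n) * ((?q (Suc n) - ?q n) * mnorm E x)
        + ?q n * ((?q (Suc n) - ?q n) * mnorm E x))"
      by (intro mult_left_mono add_mono d1 d2) simp
    also have "\<dots> = (?q (Suc (Suc n)) - ?q (Suc n)) * mnorm E x"
      unfolding visser_step[of "1::real" n] by (simp add: algebra_simps del: visser.simps)
    finally show ?case unfolding eq .
  qed
  have tele: "mnorm E (?v n x - ?v m x) \<le> ?q n * mnorm E x - ?q m * mnorm E x"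
    if x: "x \<in> mcarrier E" and mn: "m \<le> n" for m n x
    using mn
  proof (induction n rule: dec_induct)
    case (step n)
    then show ?case
      using mnorm_triangle_diff[of "?v (Suc n) x" "?v n x" "?v m x"] vstep[OF x, of n] x
      by (simp add: left_diff_distrib del: visser.simps op_visser.simps)
  qed simp
  have "\<exists>y. mlim E (\<lambda>n. ?v n x) y" if x: "x \<in> mcarrier E" for x
  proof -
    have C: "Cauchy (\<lambda>n. ?q n * mnorm E x)"
      by (intro convergent_Cauchy convergent_mult visser_real_convergent convergent_const)
    have "\<exists>M. \<forall>k\<ge>M. \<forall>m\<ge>M. mnorm E (?v k x - ?v m x) < e" if "0 < e" for e
      using Cauchy_of_telescope[OF C, of "\<lambda>m n. mnorm E (?v m x - ?v n x)" e] tele[OF x] x that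
        mnorm_minus_commute[of "?v _ x" "?v _ x"]
      by simp
    from complete[OF _ this] x show ?thesis by (auto simp: mlim_def)
  qed
  then obtain L where L: "\<And>x. x \<in> mcarrier E \<Longrightarrow> mlim E (\<lambda>n. ?v n x) (L x)" by metis
  then have Lc [simp]: "\<And>x. x \<in> mcarrier E \<Longrightarrow> L x \<in> mcarrier E" by (simp add: mlim_def)
  have LL: "adjoint_pair E L L"
  proof -
    have "ip E (L x) y = ip E x (L y)" if "x \<in> mcarrier E" "y \<in> mcarrier E" for x y
      using mlim_ip(2)[OF L[OF that(1)] that(2)] mlim_ip(1)[OF L[OF that(2)] that(1)]
      by (simp add: adjoint_ip[OF v that] LIMSEQ_unique)
    then show ?thesis by (simp add: adjoint_pair_def)
  qed
  have L2: "L x + L x = K x + L (L x)" if x: "x \<in> mcarrier E" for x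
  proof -
    have "mlim E (\<lambda>n. ?v n (?v n x - L x)) 0"
    proof (rule mlim_bound[OF L[OF x], where c=1])
      show "mnorm E (?v n (?v n x - L x) - 0) \<le> 1 * mnorm E (?v n x - L x)" for n
        using bd[of "?v n x - L x" n] mult_right_mono[of "?q n" 1 "mnorm E (?v n x - L x)"]
          visser_real[of n] x by simp
    qed (use x in simp_all)
    from mlim_add[OF this L[OF Lc[OF x]]] have "mlim E (\<lambda>n. ?v n (?v n x)) (L (L x))"
      using x by (simp add: adjoint_diff[OF v])
    then have "mlim E (\<lambda>n. ?v (Suc n) x) ((1/2) *\<^sub>R (K x + L (L x)))"
      unfolding op_visser.simps using x by (intro mlim_scaleR mlim_add mlim_const) auto
    moreover have "mlim E (\<lambda>n. ?v (Suc n) x) (L x)"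
      using L[OF x] LIMSEQ_Suc[of "\<lambda>n. mnorm E (?v n x - L x)" 0]
      by (auto simp: mlim_def simp del: op_visser.simps)
    ultimately have "L x = (1/2) *\<^sub>R (K x + L (L x))" using mlim_unique by blast
    then have "2 *\<^sub>R L x = 2 *\<^sub>R ((1/2) *\<^sub>R (K x + L (L x)))" by simp
    then show ?thesis by (simp add: scaleR_2)
  qed
  have LK: "L (K x) = K (L x)" if x: "x \<in> mcarrier E" for x
  proof (rule mlim_unique)
    show "mlim E (\<lambda>n. ?v n (K x)) (L (K x))" using L x by simp
    show "mlim E (\<lambda>n. ?v n (K x)) (K (L x))"
      by (rule mlim_bound[OF L[OF x], where c=1])
        (use x con in \<open>simp_all add: vK adjoint_diff[OF K, symmetric]\<close>)
  qed
  show ?thesis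
  proof (intro exI[of _ "\<lambda>x. x - L x"] conjI ballI)
    show "adjoint_pair E (\<lambda>x. x - L x) (\<lambda>x. x - L x)"
      by (simp add: adjoint_pair_def ip_diff_left ip_diff_right adjoint_ip[OF LL])
    fix x assume x: "x \<in> mcarrier E"
    show "x - L x - L (x - L x) = x - K x"
      using L2[OF x] x by (simp add: adjoint_diff[OF LL] algebra_simps)
    show "K x - L (K x) = K (x - L x)"
      using x by (simp add: LK adjoint_diff[OF K])
  qed
qed

end

section \<open>Subframes and induced traces\<close>

text \<open>
  Families of vectors, indexed by an arbitrary set, are more convenient than the finite sets of
  vectors in the definition of \<open>Tr\<close>: a product family, or the output of an approximation, may list a
  vector several times.  \<open>Tr_ge_subframe\<close> reconciles the two.
\<close>

definition frame_sum ::
  "('a::cstar_algebra, 'x::complex_vector) corr \<Rightarrow> 'i set \<Rightarrow> ('i \<Rightarrow> 'x) \<Rightarrow> 'x \<Rightarrow> 'x" where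
  "frame_sum E I f x = (\<Sum>i\<in>I. rank_one E (f i) (f i) x)"

definition subframe ::
  "('a::cstar_algebra, 'x::complex_vector) corr \<Rightarrow> 'i set \<Rightarrow> ('i \<Rightarrow> 'x) \<Rightarrow> bool" where
  "subframe E I f \<longleftrightarrow> finite I \<and> f ` I \<subseteq> mcarrier E \<and> op_le E (frame_sum E I f) (\<lambda>x. x)"

text \<open>
  Repetitions in a family are removed by multiplying its members with scalars of modulus one, which
  changes neither the rank one operators nor the values \<open>\<langle>\<xi>, T \<xi>\<rangle>\<close>.
\<close>

lemma infinite_unit_circle: "infinite {c. cmod c = 1}"
proof
  assume "finite {c. cmod c = 1}"
  then have "finite (Re ` {c. cmod c = 1})" by simp
  moreover have "{0..1} \<subseteq> Re ` {c. cmod c = 1}"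
  proof
    fix t :: real assume "t \<in> {0..1}"
    then have "t\<^sup>2 \<le> 1" by (simp add: power_le_one)
    then have "cmod (Complex t (sqrt (1 - t\<^sup>2))) = 1" by (simp add: cmod_def)
    then show "t \<in> Re ` {c. cmod c = 1}" by (intro image_eqI[of _ _ "Complex t (sqrt (1 - t\<^sup>2))"]) auto
  qed
  ultimately have "finite {0..1::real}" by (rule finite_subset[rotated])
  then show False using infinite_Icc[of "0::real" 1] by simp
qed

lemma ex_separating_phases:
  fixes f :: "'i \<Rightarrow> 'x::complex_vector"
  assumes "finite I"
  shows "\<exists>c. (\<forall>i\<in>I. cmod (c i) = 1) \<and> inj_on (\<lambda>i. scaleC (c i) (f i)) {i\<in>I. f i \<noteq> 0}"
  using assms
proof (induction I)
  case (insert i I)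
  then obtain c where c: "\<forall>i\<in>I. cmod (c i) = 1" "inj_on (\<lambda>i. scaleC (c i) (f i)) {i\<in>I. f i \<noteq> 0}"
    by blast
  show ?case
  proof (cases "f i = 0")
    case True
    have "{k \<in> insert i I. f k \<noteq> 0} = {k \<in> I. f k \<noteq> 0}" using True by auto
    moreover have "inj_on (\<lambda>k. scaleC ((c(i := 1)) k) (f k)) {k \<in> I. f k \<noteq> 0}"
      using c(2) by (rule inj_on_cong[THEN iffD2, rotated]) (use insert.hyps in auto)
    ultimately show ?thesis using c(1) by (intro exI[of _ "c(i := 1)"]) auto
  next
    case False
    let ?B = "(\<lambda>k. scaleC (c k) (f k)) ` I"
    have "inj_on (\<lambda>z. scaleC z (f i)) {z. cmod z = 1}"
      using False by (intro inj_onI) (simp add: complex_vector.scale_right_imp_eq)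
    then have "infinite ((\<lambda>z. scaleC z (f i)) ` {z. cmod z = 1})"
      using infinite_unit_circle by (simp add: finite_image_iff)
    then have "\<not> (\<lambda>z. scaleC z (f i)) ` {z. cmod z = 1} \<subseteq> ?B"
      using insert.hyps(1) finite_subset by blast
    then obtain z where z: "cmod z = 1" "scaleC z (f i) \<notin> ?B" by blast
    have zk: "scaleC (c k) (f k) \<noteq> scaleC z (f i)" "scaleC z (f i) \<noteq> scaleC (c k) (f k)" if "k \<in> I" for k
      using z(2) imageI[OF that, of "\<lambda>k. scaleC (c k) (f k)"] by auto
    have "inj_on (\<lambda>k. scaleC ((c(i := z)) k) (f k)) {k \<in> insert i I. f k \<noteq> 0}"
    proof (rule inj_onI)
      fix k k' assume "k \<in> {k \<in> insert i I. f k \<noteq> 0}" "k' \<in> {k \<in> insert i I. f k \<noteq> 0}"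
        "scaleC ((c(i := z)) k) (f k) = scaleC ((c(i := z)) k') (f k')"
      then show "k = k'"
        using zk insert.hyps(2) inj_onD[OF c(2), of k k'] by (auto split: if_splits)
    qed
    then show ?thesis using c(1) z(1) by (intro exI[of _ "c(i := z)"]) auto
  qed
qed simp

context hilbert_module
begin

lemma frame_sum_closed: "f ` I \<subseteq> mcarrier E \<Longrightarrow> x \<in> mcarrier E \<Longrightarrow> frame_sum E I f x \<in> mcarrier E"
  by (auto simp: frame_sum_def rank_one_def intro!: carrier_sum)

lemma frame_sum_adjoint:
  assumes "f ` I \<subseteq> mcarrier E"
  shows "adjoint_pair E (frame_sum E I f) (frame_sum E I f)"
proof -
  have "ip E (frame_sum E I f x) y = ip E x (frame_sum E I f y)"
    if "x \<in> mcarrier E" "y \<in> mcarrier E" for x y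
    using that assms unfolding frame_sum_def
    by (subst ip_sum_left ip_sum_right;
        (force simp: rank_one_def | subst ip_sum_right; force simp: rank_one_def ip_ract ip_ract_left ip_star intro!: sum.cong)?)
  then show ?thesis using frame_sum_closed[OF assms] by (simp add: adjoint_pair_def)
qed

lemma ip_frame_sum:
  assumes "f ` I \<subseteq> mcarrier E" "x \<in> mcarrier E" "y \<in> mcarrier E"
  shows "ip E y (frame_sum E I f x) = (\<Sum>i\<in>I. ip E y (f i) * ip E (f i) x)"
  using assms unfolding frame_sum_def
  by (subst ip_sum_right) (auto simp: rank_one_def ip_ract image_subset_iff intro!: sum.cong)

lemma nonneg_frame_sum:
  assumes "f ` I \<subseteq> mcarrier E" "x \<in> mcarrier E"
  shows "nonneg (ip E x (frame_sum E I f x))"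
  unfolding ip_frame_sum[OF assms(1,2,2)]
proof (rule nonneg_sum)
  fix i assume "i \<in> I"
  then have "ip E x (f i) = star (ip E (f i) x)" using assms by (auto simp: ip_star)
  then show "nonneg (ip E x (f i) * ip E (f i) x)" by (simp add: nonneg_star_mult)
qed

lemma subframe_defect:
  assumes "subframe E I f"
  obtains S S' where "adjoint_pair E S S'" "\<And>x. x \<in> mcarrier E \<Longrightarrow> x - frame_sum E I f x = S' (S x)"
  using assms by (auto simp: subframe_def op_le_def op_positive_def)

lemma subframe_diff:
  assumes "subframe E I f" "x \<in> mcarrier E"
  obtains v where "v \<in> mcarrier E" "ip E x x - ip E x (frame_sum E I f x) = ip E v v"
proof -
  obtain S S' where S: "adjoint_pair E S S'" "\<And>x. x \<in> mcarrier E \<Longrightarrow> x - frame_sum E I f x = S' (S x)"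
    using subframe_defect[OF assms(1)] by blast
  have "ip E x x - ip E x (frame_sum E I f x) = ip E (S x) (S x)"
    using assms S(2)[OF assms(2)] frame_sum_closed[of f I x] adjoint_ip[OF S(1), of x "S x"] adjoint_closed[OF S(1)]
    by (simp add: subframe_def ip_diff_right[symmetric])
  then show thesis using that adjoint_closed[OF S(1)] assms(2) by blast
qed

lemma subframe_contraction:
  assumes "subframe E I f" "x \<in> mcarrier E"
  shows "mnorm E (frame_sum E I f x) \<le> mnorm E x"
proof (rule contraction_of_nonneg)
  have f: "f ` I \<subseteq> mcarrier E" using assms by (simp add: subframe_def)
  show "adjoint_pair E (frame_sum E I f) (frame_sum E I f)" by (rule frame_sum_adjoint[OF f])
  show "nonneg (ip E z (frame_sum E I f z))" if "z \<in> mcarrier E" for z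
    by (rule nonneg_frame_sum[OF f that])
  show "nonneg (ip E z z - ip E z (frame_sum E I f z))" if "z \<in> mcarrier E" for z
    by (rule subframe_diff[OF assms(1) that]) (simp add: nonneg_ip)
qed (rule assms)

lemma dense_mlim:
  assumes "dense_in E D" "x \<in> mcarrier E"
  obtains d where "\<And>n. d n \<in> D" "mlim E d x"
proof -
  have "\<exists>y\<in>D. mnorm E (x - y) < inverse (real (Suc n))" for n
    using assms by (auto simp: dense_in_def)
  then obtain d where d: "\<And>n. d n \<in> D" "\<And>n. mnorm E (x - d n) < inverse (real (Suc n))" by metis
  have c: "\<And>n. d n \<in> mcarrier E" using d(1) assms(1) by (auto simp: dense_in_def)
  have "(\<lambda>n. mnorm E (d n - x)) \<longlonglongrightarrow> 0"
    by (rule Lim_null_comparison[OF _ LIMSEQ_inverse_real_of_nat])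
      (use d(2) c assms(2) in \<open>simp add: mnorm_minus_commute less_imp_le\<close>)
  then have "mlim E d x" using c assms(2) by (simp add: mlim_def)
  then show thesis by (rule that[OF d(1)])
qed

text \<open>
  The criterion by which families are recognised as subframes.  The inequality extends from a dense
  set to all vectors, as positive elements form a closed set; then the frame operator is a contraction
  and \<open>1\<close> minus it has a square root.
\<close>

lemma subframe_of_dense:
  assumes fin: "finite I" and f: "f ` I \<subseteq> mcarrier E" and D: "dense_in E D"
    and le: "\<And>z. z \<in> D \<Longrightarrow> nonneg (ip E z z - (\<Sum>i\<in>I. ip E z (f i) * ip E (f i) z))"
  shows "subframe E I f"
proof -
  let ?K = "frame_sum E I f"
  note K = frame_sum_adjoint[OF f]
  have le': "nonneg (ip E z z - ip E z (?K z))" if z: "z \<in> mcarrier E" for z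
  proof -
    obtain d where d: "\<And>n. d n \<in> D" "mlim E d z" using dense_mlim[OF D z] by blast
    then have dc: "\<And>n. d n \<in> mcarrier E" by (simp add: mlim_def)
    have sq: "ip E y y - (\<Sum>i\<in>I. ip E y (f i) * ip E (f i) y) = ip E y y - ip E y (?K y)"
      if "y \<in> mcarrier E" for y by (simp add: ip_frame_sum[OF f that that])
    have "(\<lambda>n. norm (mnorm E (d n - z)) * norm (mnorm E (d n - z))) \<longlonglongrightarrow> 0 * 0"
      using d(2) by (intro tendsto_mult tendsto_norm_zero) (auto simp: mlim_def)
    then have "(\<lambda>n. ip E (d n - z) (d n - z)) \<longlonglongrightarrow> 0"
      by (intro Lim_null_comparison[where f="\<lambda>n. ip E (d n - z) (d n - z)"])
        (use norm_ip_le[of "d _ - z" "d _ - z"] dc z in auto)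
    moreover have "(\<lambda>n. ip E (d n) z) \<longlonglongrightarrow> ip E z z" "(\<lambda>n. ip E z (d n)) \<longlonglongrightarrow> ip E z z"
      using mlim_ip[OF d(2) z] by auto
    ultimately have "(\<lambda>n. ip E (d n - z) (d n - z) + ip E (d n) z + (ip E z (d n) - ip E z z)) \<longlonglongrightarrow> 0 + ip E z z + (ip E z z - ip E z z)"
      by (intro tendsto_intros)
    moreover have "ip E (d n - z) (d n - z) + ip E (d n) z + (ip E z (d n) - ip E z z) = ip E (d n) (d n)" for n
      using dc z by (simp add: ip_diff_left ip_diff_right)
    ultimately have "(\<lambda>n. ip E (d n) (d n)) \<longlonglongrightarrow> ip E z z" by simp
    moreover have "(\<lambda>n. \<Sum>i\<in>I. ip E (d n) (f i) * ip E (f i) (d n)) \<longlonglongrightarrow> (\<Sum>i\<in>I. ip E z (f i) * ip E (f i) z)"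
      using f by (intro tendsto_sum tendsto_mult mlim_ip[OF d(2)]) auto
    ultimately have "(\<lambda>n. ip E (d n) (d n) - (\<Sum>i\<in>I. ip E (d n) (f i) * ip E (f i) (d n))) \<longlonglongrightarrow>
        ip E z z - (\<Sum>i\<in>I. ip E z (f i) * ip E (f i) z)" by (rule tendsto_diff)
    then have "nonneg (ip E z z - (\<Sum>i\<in>I. ip E z (f i) * ip E (f i) z))"
      by (rule nonneg_LIMSEQ) (rule le[OF d(1)])
    then show ?thesis by (simp add: sq[OF z])
  qed
  obtain S where "adjoint_pair E S S" "\<forall>x\<in>mcarrier E. S (S x) = x - ?K x"
    using sqrt_one_minus_contraction[OF K contraction_of_nonneg[OF K nonneg_frame_sum[OF f] le']] by blast
  then have "op_le E ?K (\<lambda>x. x)"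
    unfolding op_le_def op_positive_def by (intro exI[of _ S]) auto
  then show ?thesis using fin f by (simp add: subframe_def)
qed

lemma Tr_ge_subframe:
  assumes sub: "subframe E I f" and zero: "\<sigma> 0 = 0"
    and T: "\<And>c x. x \<in> mcarrier E \<Longrightarrow> T (scaleC c x) = scaleC c (T x)" "T ` mcarrier E \<subseteq> mcarrier E"
  shows "(\<Sum>i\<in>I. \<sigma> (ip E (f i) (T (f i)))) \<le> Tr E \<sigma> T"
proof -
  have fin: "finite I" and f: "\<And>i. i \<in> I \<Longrightarrow> f i \<in> mcarrier E" and le: "op_le E (frame_sum E I f) (\<lambda>x. x)"
    using sub by (auto simp: subframe_def)
  obtain c where c: "\<And>i. i \<in> I \<Longrightarrow> cmod (c i) = 1"
    and inj: "inj_on (\<lambda>i. scaleC (c i) (f i)) {i\<in>I. f i \<noteq> 0}"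
    using ex_separating_phases[OF fin, of f] by blast
  let ?J = "{i\<in>I. f i \<noteq> 0}" and ?g = "\<lambda>i. scaleC (c i) (f i)"
  have cc: "c i * cnj (c i) = 1" if "i \<in> I" for i
    using c[OF that] by (simp add: complex_norm_square[symmetric])
  have cc': "cnj (c i) * c i = 1" if "i \<in> I" for i
    using cc[OF that] by (simp add: mult.commute)
  have Tc: "T x \<in> mcarrier E" if "x \<in> mcarrier E" for x using T(2) that by auto
  have ro: "rank_one E (?g i) (?g i) x = rank_one E (f i) (f i) x" if "i \<in> I" "x \<in> mcarrier E" for i x
    using f[OF that(1)] that(2) cc'[OF that(1)]
    by (simp add: rank_one_def ip_scaleC_left ract_scaleC_left ract_scaleC_right scaleC_scaleC scaleC_one)
  have r0: "rank_one E (f i) (f i) x = 0" if "i \<in> I - ?J" "x \<in> mcarrier E" for i x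
    using that ract_scaleC_left[of 0 0] by (auto simp: rank_one_def)
  have "(\<Sum>\<xi>\<in>?g ` ?J. rank_one E \<xi> \<xi> x) = frame_sum E I f x" if x: "x \<in> mcarrier E" for x
  proof -
    have "(\<Sum>\<xi>\<in>?g ` ?J. rank_one E \<xi> \<xi> x) = (\<Sum>i\<in>?J. rank_one E (f i) (f i) x)"
      using ro x by (subst sum.reindex[OF inj]) (auto intro!: sum.cong)
    also have "\<dots> = frame_sum E I f x"
      unfolding frame_sum_def using fin r0[OF _ x] by (intro sum.mono_neutral_left) auto
    finally show ?thesis .
  qed
  then have "op_le E (\<lambda>\<eta>. \<Sum>\<xi>\<in>?g ` ?J. rank_one E \<xi> \<xi> \<eta>) (\<lambda>\<eta>. \<eta>)"
    using le by (auto simp: op_le_def op_positive_def)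
  then have H: "?g ` ?J \<in> {H. finite H \<and> H \<subseteq> mcarrier E \<and> op_le E (\<lambda>\<eta>. \<Sum>\<xi>\<in>H. rank_one E \<xi> \<xi> \<eta>) (\<lambda>\<eta>. \<eta>)}"
    using fin f by auto
  have "(\<Sum>i\<in>I. \<sigma> (ip E (f i) (T (f i)))) = (\<Sum>i\<in>?J. \<sigma> (ip E (f i) (T (f i))))"
    using fin Tc zero by (intro sum.mono_neutral_right) auto
  also have "\<dots> = (\<Sum>i\<in>?J. \<sigma> (ip E (?g i) (T (?g i))))"
    using f Tc cc by (intro sum.cong refl arg_cong[where f=\<sigma>])
      (simp add: T ip_scaleC_left ip_scaleC scaleC_scaleC scaleC_one)
  also have "\<dots> = (\<Sum>\<xi>\<in>?g ` ?J. \<sigma> (ip E \<xi> (T \<xi>)))" by (simp add: sum.reindex[OF inj])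
  also have "\<dots> \<le> Tr E \<sigma> T" unfolding Tr_def by (rule SUP_upper[OF H])
  finally show ?thesis .
qed

end

context hilbert_module
begin

lemma adjoint_funpow:
  assumes S: "adjoint_pair E S S"
  shows "adjoint_pair E (S ^^ n) (S ^^ n)"
proof (induction n)
  case 0 then show ?case by (simp add: adjoint_pair_def)
next
  case (Suc n)
  have "ip E (S ((S ^^ n) x)) y = ip E x (S ((S ^^ n) y))"
    if "x \<in> mcarrier E" "y \<in> mcarrier E" for x y
    using that adjoint_ip[OF S, of "(S ^^ n) x" y] adjoint_ip[OF Suc, of x "S y"]
      adjoint_closed[OF S] adjoint_closed[OF Suc] by (simp add: funpow_swap1)
  then show ?case using adjoint_closed[OF S] adjoint_closed[OF Suc]
    by (auto simp: adjoint_pair_def)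
qed

lemma mnorm_frame_sum_le:
  assumes "f ` I \<subseteq> mcarrier E" "x \<in> mcarrier E"
  shows "mnorm E (frame_sum E I f x) \<le> (\<Sum>i\<in>I. (mnorm E (f i))\<^sup>2) * mnorm E x"
proof -
  have "mnorm E (rank_one E (f i) (f i) x) \<le> (mnorm E (f i))\<^sup>2 * mnorm E x" if "i \<in> I" for i
  proof -
    have "f i \<in> mcarrier E" using assms that by auto
    then show ?thesis
      using mnorm_ract[of "f i" "ip E (f i) x"] mult_left_mono[OF norm_ip_le[of x "f i"], of "mnorm E (f i)"] assms(2)
      by (simp add: rank_one_def power2_eq_square mult.assoc)
  qed
  then have "(\<Sum>i\<in>I. mnorm E (rank_one E (f i) (f i) x)) \<le> (\<Sum>i\<in>I. (mnorm E (f i))\<^sup>2) * mnorm E x"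
    by (simp add: sum_distrib_right sum_mono)
  moreover have "mnorm E (frame_sum E I f x) \<le> (\<Sum>i\<in>I. mnorm E (rank_one E (f i) (f i) x))"
    unfolding frame_sum_def by (rule mnorm_sum) (use assms in \<open>auto simp: rank_one_def\<close>)
  ultimately show ?thesis by linarith
qed

text \<open>
  Let \<open>K\<close> be the frame operator of the family \<open>g\<close> and \<open>S = \<surd>(1 - K)\<close>.  The elements
  \<open>a\<^sub>j = \<langle>S\<^sup>j x, K S\<^sup>j x\<rangle>\<close> decrease in \<open>j\<close>, and they telescope, since \<open>K = 1 - S\<^sup>2\<close>, to a sum below
  \<open>\<langle>x, x\<rangle>\<close>; therefore \<open>N a\<^sub>N \<le> \<langle>x, x\<rangle>\<close>.  As \<open>a\<^sub>N\<close> dominates \<open>\<bar>\<langle>g y, S\<^sup>N x\<rangle>\<bar>\<^sup>2\<close>, the choice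
  \<open>x = S\<^sup>N (g y)\<close> gives the bound.
\<close>

lemma power_defect_decay:
  assumes fin: "finite Y" and g: "g ` Y \<subseteq> mcarrier E"
    and S: "adjoint_pair E S S" and SS: "\<And>x. x \<in> mcarrier E \<Longrightarrow> S (S x) = x - frame_sum E Y g x"
    and SK: "\<And>x. x \<in> mcarrier E \<Longrightarrow> S (frame_sum E Y g x) = frame_sum E Y g (S x)"
    and y: "y \<in> Y" and N: "0 < N"
  shows "real N * (mnorm E ((S ^^ N) (g y)))\<^sup>2 \<le> 1"
proof -
  let ?K = "frame_sum E Y g"
  note K = frame_sum_adjoint[OF g]
  note Sn = adjoint_funpow[OF S]
  define x where "x = (S ^^ N) (g y)"
  have gy: "g y \<in> mcarrier E" using g y by auto
  then have x: "x \<in> mcarrier E" unfolding x_def by (rule adjoint_closed[OF Sn])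
  define v where "v j = (S ^^ j) x" for j
  have v [simp]: "v j \<in> mcarrier E" for j unfolding v_def by (rule adjoint_closed[OF Sn x])
  note [simp] = adjoint_closed[OF K] adjoint_closed[OF S]
  have vSuc: "v (Suc j) = S (v j)" for j by (simp add: v_def)
  define a where "a j = ip E (v j) (?K (v j))" for j
  have diff: "ip E (v j) (v j) - ip E (v (Suc j)) (v (Suc j)) = a j" for j
    by (simp add: vSuc adjoint_ip[OF S] SS ip_diff_right a_def)
  have dec1: "nonneg (a j - a (Suc j))" for j
  proof -
    have "a (Suc j) = ip E (v j) (?K (S (S (v j))))"
      unfolding a_def vSuc by (subst adjoint_ip[OF S]) (auto simp: SK)
    also have "\<dots> = a j - ip E (?K (v j)) (?K (v j))"
      by (simp add: SS adjoint_diff[OF K] ip_diff_right a_def adjoint_ip[OF K])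
    finally show ?thesis by (simp add: nonneg_ip)
  qed
  have dec: "nonneg (a j - a N)" if "j \<le> N" for j
    using that
  proof (induction rule: inc_induct)
    case base then show ?case by (simp add: nonneg_zero)
  next
    case (step m)
    then show ?case using nonneg_add[OF dec1[of m]] by force
  qed
  have tel: "ip E (v 0) (v 0) - ip E (v M) (v M) = (\<Sum>j<M. a j)" for M
    by (induction M) (simp_all add: diff[symmetric] algebra_simps)
  have "ip E x x - real N *\<^sub>R a N = (\<Sum>j<N. a j - a N) + ip E (v N) (v N)"
    using tel[of N] by (simp add: sum_subtractf v_def algebra_simps scaleR_conv_of_real sum_constant_scaleR)
  then have "nonneg (ip E x x - real N *\<^sub>R a N)"
    by (auto intro!: nonneg_add nonneg_sum dec nonneg_ip)
  moreover have aN: "nonneg (a N)" unfolding a_def by (rule nonneg_frame_sum[OF g v])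
  ultimately have 1: "real N * norm (a N) \<le> norm (ip E x x)"
    using norm_mono_nonneg[of "real N *\<^sub>R a N" "ip E x x"] nonneg_scaleR[OF aN, of "real N"] by simp
  have star: "ip E (v N) (g z) = star (ip E (g z) (v N))" if "z \<in> Y" for z
    using that g by (auto simp: ip_star)
  have "a N - ip E (v N) (g y) * ip E (g y) (v N) = (\<Sum>z\<in>Y - {y}. ip E (v N) (g z) * ip E (g z) (v N))"
    unfolding a_def ip_frame_sum[OF g v v] using sum.remove[OF fin y, of "\<lambda>z. ip E (v N) (g z) * ip E (g z) (v N)"] by simp
  then have "nonneg (a N - star (ip E (g y) (v N)) * ip E (g y) (v N))"
    using y by (auto intro!: nonneg_sum simp: star nonneg_star_mult)
  then have 2: "norm (star (ip E (g y) (v N)) * ip E (g y) (v N)) \<le> norm (a N)"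
    by (rule norm_mono_nonneg[OF nonneg_star_mult])
  have "ip E (g y) (v N) = ip E x x"
    using adjoint_ip[OF Sn gy x, of N] by (simp add: v_def x_def)
  with 2 have 3: "(norm (ip E x x))\<^sup>2 \<le> norm (a N)" by (simp add: cstar_identity)
  have "real N * (norm (ip E x x))\<^sup>2 \<le> real N * norm (a N)" by (rule mult_left_mono[OF 3]) simp
  with 1 have 4: "real N * norm (ip E x x) * norm (ip E x x) \<le> 1 * norm (ip E x x)"
    by (simp add: power2_eq_square)
  have "real N * norm (ip E x x) \<le> 1"
  proof (cases "ip E x x = 0")
    case False
    then have "0 < norm (ip E x x)" by simp
    with 4 show ?thesis by (rule mult_right_le_imp_le)
  qed simp
  then show ?thesis by (simp add: mnorm_square x_def[symmetric])
qed

text \<open>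
  Approximate units consisting of finite sums of operators \<open>\<theta>\<^bsub>\<xi>,\<xi>\<^esub>\<close>.  After scaling, the frame operator
  \<open>K\<close> of the given vectors \<open>y\<close> is a contraction; put \<open>S = \<surd>(1 - K)\<close>.  The vectors \<open>S\<^sup>j y\<close> with \<open>j < n\<close>
  have the frame operator \<open>\<Sum>\<^sub>j S\<^sup>j K S\<^sup>j = 1 - S\<^sup>2\<^sup>n\<close>, which is at most \<open>1\<close> and moves \<open>y\<close> by \<open>S\<^sup>2\<^sup>n y\<close> only.
\<close>

lemma ex_approximating_subframe:
  assumes fin: "finite Y" and Y: "Y \<subseteq> mcarrier E" and e: "0 < e"
  shows "\<exists>(I :: (nat \<times> 'x) set) f. subframe E I f \<and> (\<forall>y\<in>Y. mnorm E (y - frame_sum E I f y) \<le> e)"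
proof -
  define s where "s = 1 + (\<Sum>y\<in>Y. (mnorm E y)\<^sup>2)"
  have s: "1 \<le> s" unfolding s_def by (simp add: sum_nonneg)
  define g where "g y = (1 / sqrt s) *\<^sub>R y" for y :: 'x
  have g: "g ` Y \<subseteq> mcarrier E" using Y by (auto simp: g_def)
  let ?K = "frame_sum E Y g"
  note K = frame_sum_adjoint[OF g]
  have "(\<Sum>y\<in>Y. (mnorm E (g y))\<^sup>2) = (\<Sum>y\<in>Y. (mnorm E y)\<^sup>2) / s"
    unfolding sum_divide_distrib using Y s
    by (intro sum.cong) (auto simp: g_def mnorm_scaleR power_divide)
  also have "\<dots> \<le> 1" using s by (simp add: s_def)
  finally have con: "mnorm E (?K x) \<le> mnorm E x" if "x \<in> mcarrier E" for x
    using mnorm_frame_sum_le[OF g that] mult_right_mono[of _ 1 "mnorm E x"] by fastforce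
  obtain S where S: "adjoint_pair E S S" and SS: "\<And>x. x \<in> mcarrier E \<Longrightarrow> S (S x) = x - ?K x"
    and SK: "\<And>x. x \<in> mcarrier E \<Longrightarrow> S (?K x) = ?K (S x)"
    using sqrt_one_minus_contraction[OF K con] by blast
  note Sn = adjoint_funpow[OF S]
  note [simp] = adjoint_closed[OF Sn] adjoint_closed[OF S] adjoint_closed[OF K]
  \<comment> \<open>\<open>power_defect_decay\<close> for the power \<open>2n\<close> bounds the squared error by \<open>s / (2n)\<close>\<close>
  obtain n :: nat where n: "s / e\<^sup>2 < real n" using reals_Archimedean2 by blast
  moreover have "0 < s / e\<^sup>2" using s e by simp
  ultimately have n0: "0 < n" by (metis of_nat_0_less_iff order_less_trans)
  define I where "I = {..<n} \<times> Y"
  define f where "f = (\<lambda>(j, y). (S ^^ j) (g y))"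
  have f: "f ` I \<subseteq> mcarrier E" using g by (auto simp: f_def I_def image_subset_iff)
  have SnK: "(S ^^ j) (?K x) = ?K ((S ^^ j) x)" if "x \<in> mcarrier E" for j x
    by (induction j) (simp_all add: SK that)
  have fs: "frame_sum E I f x = x - (S ^^ (2 * n)) x" if x: "x \<in> mcarrier E" for x
  proof -
    have "frame_sum E I f x = (\<Sum>j<n. \<Sum>y\<in>Y. rank_one E ((S ^^ j) (g y)) ((S ^^ j) (g y)) x)"
      by (simp add: frame_sum_def I_def f_def sum.cartesian_product case_prod_unfold)
    also have "\<dots> = (\<Sum>j<n. (S ^^ j) (?K ((S ^^ j) x)))"
    proof (rule sum.cong[OF refl])
      fix j
      have "rank_one E ((S ^^ j) (g y)) ((S ^^ j) (g y)) x = (S ^^ j) (rank_one E (g y) (g y) ((S ^^ j) x))"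
        if "y \<in> Y" for y
      proof -
        have "g y \<in> mcarrier E" using that g by auto
        then show ?thesis using x by (simp add: rank_one_def adjoint_ract[OF Sn] adjoint_ip[OF Sn])
      qed
      then show "(\<Sum>y\<in>Y. rank_one E ((S ^^ j) (g y)) ((S ^^ j) (g y)) x) = (S ^^ j) (?K ((S ^^ j) x))"
        unfolding frame_sum_def using g x
        by (subst adjoint_sum[OF Sn]) (auto simp: rank_one_def image_subset_iff)
    qed
    also have "\<dots> = (\<Sum>j<n. (S ^^ (2 * j)) x - (S ^^ (2 * Suc j)) x)"
    proof (rule sum.cong[OF refl])
      fix j
      have "(S ^^ j) (?K ((S ^^ j) x)) = (S ^^ (2 * j)) (?K x)"
        using x by (simp add: SnK[symmetric] mult_2 funpow_add)
      also have "?K x = x - S (S x)" using SS[OF x] by simp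
      also have "(S ^^ (2 * j)) (x - S (S x)) = (S ^^ (2 * j)) x - (S ^^ (2 * j)) (S (S x))"
        using x by (simp add: adjoint_diff[OF Sn])
      also have "(S ^^ (2 * j)) (S (S x)) = (S ^^ (2 * Suc j)) x"
        by (simp add: funpow_swap1)
      finally show "(S ^^ j) (?K ((S ^^ j) x)) = (S ^^ (2 * j)) x - (S ^^ (2 * Suc j)) x" .
    qed
    also have "\<dots> = x - (S ^^ (2 * n)) x"
      using sum_lessThan_telescope'[of "\<lambda>j. (S ^^ (2 * j)) x" n] by simp
    finally show ?thesis .
  qed
  have "op_le E (frame_sum E I f) (\<lambda>x. x)"
    unfolding op_le_def op_positive_def
    by (intro exI[of _ "S ^^ n"] conjI ballI Sn) (simp add: fs mult_2 funpow_add)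
  then have sub: "subframe E I f" using f fin by (simp add: subframe_def I_def)
  have "mnorm E (y - frame_sum E I f y) \<le> e" if y: "y \<in> Y" for y
  proof (rule power2_le_imp_le)
    have yc: "y \<in> mcarrier E" using y Y by auto
    have yg: "y = sqrt s *\<^sub>R g y" using s by (simp add: g_def)
    have gc: "g y \<in> mcarrier E" using y g by auto
    have "y - frame_sum E I f y = sqrt s *\<^sub>R (S ^^ (2 * n)) (g y)"
      using yc gc by (simp add: fs) (subst (1) yg, simp add: adjoint_scaleR[OF Sn])
    then have "(mnorm E (y - frame_sum E I f y))\<^sup>2 = s * (mnorm E ((S ^^ (2 * n)) (g y)))\<^sup>2"
      using s gc by (simp add: mnorm_scaleR power_mult_distrib)
    also have "\<dots> \<le> s / real (2 * n)"
      using power_defect_decay[OF fin g S SS SK y, of "2 * n"] n0 s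
      by (simp add: field_simps)
    also have "\<dots> \<le> s / real n" using s n0 by (simp add: frac_le)
    also have "\<dots> \<le> e\<^sup>2" using n n0 e by (simp add: field_simps)
    finally show "(mnorm E (y - frame_sum E I f y))\<^sup>2 \<le> e\<^sup>2" .
  qed (use e in simp)
  with sub show ?thesis by blast
qed

end

section \<open>Tensor products of correspondences\<close>

context correspondence
begin

lemmas lact_closed [simp, intro] = adjoint_closed[OF lact_adjoint]
lemmas lact_ip = adjoint_ip[OF lact_adjoint]
lemmas lact_vector_scaleC = adjoint_scaleC[OF lact_adjoint]

lemma lact_scaleR: "x \<in> mcarrier E \<Longrightarrow> lact E (r *\<^sub>R a) x = r *\<^sub>R lact E a x"
  by (simp add: scaleR_scaleC lact_scaleC)

lemma lact_zero: "x \<in> mcarrier E \<Longrightarrow> lact E 0 x = 0"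
  using lact_scaleR[of x 0 0] by simp

text \<open>
  A left action is contractive: for \<open>\<parallel>a\<parallel> \<le> 1\<close> write \<open>1 - a\<^sup>* a = (1 - y)\<^sup>2\<close> with \<open>y\<close> in the algebra; then
  \<open>\<langle>x, x\<rangle> - \<langle>a x, a x\<rangle> = \<langle>x - y x, x - y x\<rangle>\<close>.
\<close>

lemma mnorm_lact:
  assumes x: "x \<in> mcarrier E"
  shows "mnorm E (lact E a x) \<le> norm a * mnorm E x"
proof (cases "a = 0")
  case True with x show ?thesis by (simp add: lact_zero)
next
  case False
  define b where "b = (1 / norm a) *\<^sub>R a"
  have "norm b \<le> 1" using False by (simp add: b_def)
  then obtain y where y: "star y = y" "star b * b = y + y - y * y" by (rule half_root_nonunital)
  define w where "w = x - lact E y x"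
  have w: "w \<in> mcarrier E" using x by (simp add: w_def)
  have "lact E (star b * b) x + lact E (y * y) x = lact E y x + lact E y x"
    using x by (simp add: lact_add[symmetric] y(2))
  then have *: "ip E x (lact E (star b * b) x) + ip E x (lact E (y * y) x) = ip E x (lact E y x) + ip E x (lact E y x)"
    using x by (metis ip_add lact_closed)
  have "ip E w w = ip E x x - (ip E x (lact E y x) + ip E x (lact E y x)) + ip E x (lact E (y * y) x)"
    unfolding w_def using x
    by (simp add: ip_diff_left ip_diff_right lact_ip lact_mult y(1))
  also have "\<dots> = ip E x x - ip E x (lact E (star b * b) x)"
    by (simp add: *[symmetric])
  also have "ip E x (lact E (star b * b) x) = ip E (lact E b x) (lact E b x)"
    using x by (simp add: lact_ip lact_mult)
  finally have "nonneg (ip E x x - ip E (lact E b x) (lact E b x))"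
    using nonneg_ip[OF w] by simp
  moreover have "nonneg (ip E (lact E b x) (lact E b x))" using x by (simp add: nonneg_ip)
  ultimately have "mnorm E (lact E b x) \<le> mnorm E x"
    using norm_mono_nonneg by (simp add: mnorm_def)
  then show ?thesis
    using False x by (simp add: b_def lact_scaleR mnorm_scaleR field_simps)
qed

end

text \<open>
  A finite sum of suprema is approached by choosing one index in every supremum.
\<close>

lemma sum_SUP_le:
  fixes r :: "'i \<Rightarrow> 'h \<Rightarrow> real"
  assumes "finite I" "\<And>i. i \<in> I \<Longrightarrow> A i \<noteq> {}"
    and "\<And>c. (\<And>i. i \<in> I \<Longrightarrow> c i \<in> A i) \<Longrightarrow> ereal (\<Sum>i\<in>I. r i (c i)) \<le> C"
  shows "(\<Sum>i\<in>I. SUP h\<in>A i. ereal (r i h)) \<le> C"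
  using assms
proof (induction I arbitrary: C)
  case empty
  then show ?case by (simp add: zero_ereal_def)
next
  case (insert i I)
  let ?S = "\<Sum>k\<in>I. SUP h\<in>A k. ereal (r k h)"
  have S: "?S \<noteq> -\<infinity>"
  proof -
    have "\<forall>k\<in>I. \<exists>h. h \<in> A k" using insert.prems(1) by auto
    then obtain c where c: "\<And>k. k \<in> I \<Longrightarrow> c k \<in> A k" by metis
    have "ereal (\<Sum>k\<in>I. r k (c k)) \<le> ?S"
      unfolding sum_ereal[symmetric] by (intro sum_mono SUP_upper c)
    then show ?thesis by auto
  qed
  have le: "ereal (r i h) + ?S \<le> C" if h: "h \<in> A i" for h
  proof -
    have "?S \<le> C - ereal (r i h)"
    proof (rule insert.IH)
      show "A k \<noteq> {}" if "k \<in> I" for k using insert.prems(1)[of k] that by simp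
      fix c assume c: "\<And>k. k \<in> I \<Longrightarrow> c k \<in> A k"
      have "(\<Sum>k\<in>insert i I. r k ((c(i := h)) k)) = r i h + (\<Sum>k\<in>I. r k (c k))"
      proof -
        have "(\<Sum>k\<in>I. r k ((c(i := h)) k)) = (\<Sum>k\<in>I. r k (c k))"
          using insert.hyps by (intro sum.cong) auto
        then show ?thesis using insert.hyps by simp
      qed
      moreover have "ereal (\<Sum>k\<in>insert i I. r k ((c(i := h)) k)) \<le> C"
        by (rule insert.prems(2)) (use c h in auto)
      ultimately have "ereal (\<Sum>k\<in>I. r k (c k)) + ereal (r i h) \<le> C" by (simp add: add.commute)
      then show "ereal (\<Sum>k\<in>I. r k (c k)) \<le> C - ereal (r i h)" by (simp add: ereal_le_minus)
    qed
    then show ?thesis by (simp add: ereal_le_minus add.commute)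
  qed
  have "(SUP h\<in>A i. ereal (r i h)) + ?S = (SUP h\<in>A i. ereal (r i h) + ?S)"
    using insert.prems(1) S by (intro SUP_ereal_add_left[symmetric]) auto
  also have "\<dots> \<le> C" by (rule SUP_least) (rule le)
  finally show ?case using insert.hyps by simp
qed

lemma
  assumes "tracial_state \<tau>"
  shows tracial_state_linear: "bounded_linear \<tau>"
    and tracial_state_trace: "\<tau> (a * b) = \<tau> (b * a)"
    and tracial_state_pos: "0 \<le> Re (\<tau> (star c * c))"
    and tracial_state_le_norm: "Re (\<tau> a) \<le> norm a"
proof -
  show bl: "bounded_linear \<tau>" and "\<tau> (a * b) = \<tau> (b * a)" and "0 \<le> Re (\<tau> (star c * c))"
    using assms by (auto simp: tracial_state_def positives_def)
  show "Re (\<tau> a) \<le> norm a"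
    using onorm[OF bl, of a] complex_Re_le_cmod[of "\<tau> a"] assms by (simp add: tracial_state_def)
qed

lemma Tr_subframe:
  "Tr E \<sigma> T = (SUP H\<in>{H. subframe E H (\<lambda>x. x)}. \<Sum>x\<in>H. \<sigma> (ip E x (T x)))"
  unfolding Tr_def subframe_def frame_sum_def by simp

lemma subframe_empty: "hilbert_module E \<Longrightarrow> subframe E {} f"
  by (auto simp: subframe_def op_le_def op_positive_def frame_sum_def
      intro!: exI[of _ "\<lambda>x. x"] hilbert_module.adjoint_pair_id)

locale correspondence_tensor = X: correspondence Ex + Y: correspondence Ey + W: correspondence Ez
  for Ex :: "('a::cstar_algebra, 'x::complex_vector) corr" and Ey :: "('a, 'y::complex_vector) corr"
    and Ez :: "('a, 'z::complex_vector) corr" +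
  fixes m :: "'x \<Rightarrow> 'y \<Rightarrow> 'z"
  assumes tensor: "interior_tensor_iso Ex Ey Ez m"
begin

lemma m_closed [simp, intro]: "x \<in> mcarrier Ex \<Longrightarrow> y \<in> mcarrier Ey \<Longrightarrow> m x y \<in> mcarrier Ez"
  using tensor by (simp add: interior_tensor_iso_def)

lemma m_scaleC: "x \<in> mcarrier Ex \<Longrightarrow> y \<in> mcarrier Ey \<Longrightarrow> m (scaleC c x) y = scaleC c (m x y)"
  "x \<in> mcarrier Ex \<Longrightarrow> y \<in> mcarrier Ey \<Longrightarrow> m x (scaleC c y) = scaleC c (m x y)"
  using tensor by (simp_all add: interior_tensor_iso_def)

lemma m_add: "x \<in> mcarrier Ex \<Longrightarrow> x' \<in> mcarrier Ex \<Longrightarrow> y \<in> mcarrier Ey \<Longrightarrow> m (x + x') y = m x y + m x' y"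
  "x \<in> mcarrier Ex \<Longrightarrow> y \<in> mcarrier Ey \<Longrightarrow> y' \<in> mcarrier Ey \<Longrightarrow> m x (y + y') = m x y + m x y'"
  using tensor by (simp_all add: interior_tensor_iso_def)

lemma m_zero: "y \<in> mcarrier Ey \<Longrightarrow> m 0 y = 0" "x \<in> mcarrier Ex \<Longrightarrow> m x 0 = 0"
  using m_add(1)[of 0 0 y] m_add(2)[of x 0 0] by simp_all

lemma m_diff: "x \<in> mcarrier Ex \<Longrightarrow> x' \<in> mcarrier Ex \<Longrightarrow> y \<in> mcarrier Ey \<Longrightarrow> m (x - x') y = m x y - m x' y"
  "x \<in> mcarrier Ex \<Longrightarrow> y \<in> mcarrier Ey \<Longrightarrow> y' \<in> mcarrier Ey \<Longrightarrow> m x (y - y') = m x y - m x y'"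
  using m_add(1)[of "x - x'" x' y] m_add(2)[of x "y - y'" y'] by (simp_all add: eq_diff_eq)

lemma m_sum_left: "(\<And>i. i \<in> I \<Longrightarrow> f i \<in> mcarrier Ex) \<Longrightarrow> y \<in> mcarrier Ey \<Longrightarrow>
    m (sum f I) y = (\<Sum>i\<in>I. m (f i) y)"
  by (induction I rule: infinite_finite_induct) (simp_all add: m_zero m_add X.carrier_sum)

lemma m_sum_right: "(\<And>i. i \<in> I \<Longrightarrow> f i \<in> mcarrier Ey) \<Longrightarrow> x \<in> mcarrier Ex \<Longrightarrow>
    m x (sum f I) = (\<Sum>i\<in>I. m x (f i))"
  by (induction I rule: infinite_finite_induct) (simp_all add: m_zero m_add Y.carrier_sum)

lemma
  assumes "x \<in> mcarrier Ex" "y \<in> mcarrier Ey"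
  shows m_balanced: "m (ract Ex x a) y = m x (lact Ey a y)"
    and m_lact: "lact Ez a (m x y) = m (lact Ex a x) y"
    and m_ract: "ract Ez (m x y) a = m x (ract Ey y a)"
  using tensor assms by (simp_all add: interior_tensor_iso_def)

lemma ip_m: "x \<in> mcarrier Ex \<Longrightarrow> y \<in> mcarrier Ey \<Longrightarrow> x' \<in> mcarrier Ex \<Longrightarrow> y' \<in> mcarrier Ey \<Longrightarrow>
    ip Ez (m x y) (m x' y') = ip Ey y (lact Ey (ip Ex x x') y')"
  using tensor by (simp add: interior_tensor_iso_def)

lemma mnorm_m:
  assumes "x \<in> mcarrier Ex" "y \<in> mcarrier Ey"
  shows "mnorm Ez (m x y) \<le> mnorm Ex x * mnorm Ey y"
proof (rule power2_le_imp_le)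
  have "norm (ip Ey y (lact Ey (ip Ex x x) y)) \<le> mnorm Ey y * (norm (ip Ex x x) * mnorm Ey y)"
    using assms by (intro order_trans[OF Y.norm_ip_le] mult_left_mono Y.mnorm_lact) auto
  then show "(mnorm Ez (m x y))\<^sup>2 \<le> (mnorm Ex x * mnorm Ey y)\<^sup>2"
    using assms by (simp add: W.mnorm_square ip_m X.mnorm_square power_mult_distrib)
      (simp add: power2_eq_square mult_ac)
qed simp

abbreviation simple_span :: "'z set" where
  "simple_span \<equiv> complex_vector.span {m x y | x y. x \<in> mcarrier Ex \<and> y \<in> mcarrier Ey}"

lemma dense_simple_span: "dense_in Ez simple_span"
  using tensor by (simp add: interior_tensor_iso_def)

lemma simple_spanE:
  assumes "z \<in> simple_span"
  obtains T :: "'z set" and xs ys where "finite T" "\<And>k. k \<in> T \<Longrightarrow> xs k \<in> mcarrier Ex"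
    "\<And>k. k \<in> T \<Longrightarrow> ys k \<in> mcarrier Ey" "z = (\<Sum>k\<in>T. m (xs k) (ys k))"
proof -
  obtain T r where T: "finite T" "T \<subseteq> {m x y | x y. x \<in> mcarrier Ex \<and> y \<in> mcarrier Ey}"
    "z = (\<Sum>k\<in>T. scaleC (r k) k)"
    using assms unfolding complex_vector.span_explicit by blast
  have "\<exists>p. fst p \<in> mcarrier Ex \<and> snd p \<in> mcarrier Ey \<and> k = m (fst p) (snd p)" if "k \<in> T" for k
  proof -
    obtain x y where "x \<in> mcarrier Ex" "y \<in> mcarrier Ey" "k = m x y"
      using T(2) \<open>k \<in> T\<close> by auto
    then show ?thesis by (intro exI[of _ "(x, y)"]) simp
  qed
  then obtain p where p: "\<And>k. k \<in> T \<Longrightarrow> fst (p k) \<in> mcarrier Ex \<and> snd (p k) \<in> mcarrier Ey \<and> k = m (fst (p k)) (snd (p k))"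
    by metis
  show thesis
  proof (rule that[of T "\<lambda>k. scaleC (r k) (fst (p k))" "\<lambda>k. snd (p k)"])
    show "z = (\<Sum>k\<in>T. m (scaleC (r k) (fst (p k))) (snd (p k)))"
      unfolding T(3) using p by (intro sum.cong refl) (metis m_scaleC(1))
  qed (use T(1) p in auto)
qed

text \<open>
  For \<open>z = \<Sum>\<^sub>k xs k \<otimes> ys k\<close> this is the value at \<open>z\<close> of the adjoint of the creation operator
  \<open>y \<mapsto> x \<otimes> y\<close>.  An explicit formula on finite sums suffices below, so that the adjoint need not be
  constructed on the whole tensor product.
\<close>

definition slice :: "'z set \<Rightarrow> ('z \<Rightarrow> 'x) \<Rightarrow> ('z \<Rightarrow> 'y) \<Rightarrow> 'x \<Rightarrow> 'y" where
  "slice T xs ys x = (\<Sum>k\<in>T. lact Ey (ip Ex x (xs k)) (ys k))"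

context
  fixes T :: "'z set" and xs :: "'z \<Rightarrow> 'x" and ys :: "'z \<Rightarrow> 'y"
  assumes xs: "\<And>k. k \<in> T \<Longrightarrow> xs k \<in> mcarrier Ex" and ys: "\<And>k. k \<in> T \<Longrightarrow> ys k \<in> mcarrier Ey"
begin

lemma slice_closed [simp]: "slice T xs ys x \<in> mcarrier Ey"
  unfolding slice_def using ys by (intro Y.carrier_sum) auto

lemma ip_m_simple:
  assumes "x \<in> mcarrier Ex" "y \<in> mcarrier Ey"
  shows "ip Ez (m x y) (\<Sum>k\<in>T. m (xs k) (ys k)) = ip Ey y (slice T xs ys x)"
    and "ip Ez (\<Sum>k\<in>T. m (xs k) (ys k)) (m x y) = ip Ey (slice T xs ys x) y"
proof -
  show 1: "ip Ez (m x y) (\<Sum>k\<in>T. m (xs k) (ys k)) = ip Ey y (slice T xs ys x)"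
    unfolding slice_def using assms xs ys
    by (subst W.ip_sum_right Y.ip_sum_right; (auto)?)
      (subst Y.ip_sum_right, auto simp: ip_m intro!: sum.cong)
  have "(\<Sum>k\<in>T. m (xs k) (ys k)) \<in> mcarrier Ez" using xs ys by (intro W.carrier_sum) auto
  then have "ip Ez (\<Sum>k\<in>T. m (xs k) (ys k)) (m x y) = star (ip Ez (m x y) (\<Sum>k\<in>T. m (xs k) (ys k)))"
    using assms by (simp add: W.ip_star)
  then show "ip Ez (\<Sum>k\<in>T. m (xs k) (ys k)) (m x y) = ip Ey (slice T xs ys x) y"
    unfolding 1 using assms by (simp add: Y.ip_star)
qed

lemma sum_m_slice:
  assumes "f ` I \<subseteq> mcarrier Ex"
  shows "(\<Sum>i\<in>I. m (f i) (slice T xs ys (f i))) = (\<Sum>k\<in>T. m (frame_sum Ex I f (xs k)) (ys k))"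
proof -
  have "(\<Sum>i\<in>I. m (f i) (slice T xs ys (f i))) = (\<Sum>i\<in>I. \<Sum>k\<in>T. m (rank_one Ex (f i) (f i) (xs k)) (ys k))"
    unfolding slice_def using assms xs ys
    by (intro sum.cong refl) (subst m_sum_right, auto simp: m_balanced rank_one_def image_subset_iff)
  also have "\<dots> = (\<Sum>k\<in>T. \<Sum>i\<in>I. m (rank_one Ex (f i) (f i) (xs k)) (ys k))"
    by (rule sum.swap)
  also have "\<dots> = (\<Sum>k\<in>T. m (frame_sum Ex I f (xs k)) (ys k))"
    unfolding frame_sum_def using assms xs ys
    by (intro sum.cong refl, subst m_sum_left) (auto simp: rank_one_def image_subset_iff)
  finally show ?thesis .
qed

lemma frame_sum_product:
  assumes f: "f ` I \<subseteq> mcarrier Ex" and g: "\<And>i. i \<in> I \<Longrightarrow> g i ` J i \<subseteq> mcarrier Ey"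
    and fin: "finite I" "\<And>i. i \<in> I \<Longrightarrow> finite (J i)"
  shows "frame_sum Ez (Sigma I J) (\<lambda>(i, j). m (f i) (g i j)) (\<Sum>k\<in>T. m (xs k) (ys k)) =
    (\<Sum>i\<in>I. m (f i) (frame_sum Ey (J i) (g i) (slice T xs ys (f i))))"
proof -
  have "frame_sum Ez (Sigma I J) (\<lambda>(i, j). m (f i) (g i j)) (\<Sum>k\<in>T. m (xs k) (ys k)) =
    (\<Sum>i\<in>I. \<Sum>j\<in>J i. rank_one Ez (m (f i) (g i j)) (m (f i) (g i j)) (\<Sum>k\<in>T. m (xs k) (ys k)))"
    unfolding frame_sum_def using fin by (subst sum.Sigma) (auto simp: case_prod_unfold)
  also have "\<dots> = (\<Sum>i\<in>I. \<Sum>j\<in>J i. m (f i) (rank_one Ey (g i j) (g i j) (slice T xs ys (f i))))"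
  proof (intro sum.cong refl)
    fix i j assume "i \<in> I" "j \<in> J i"
    then have "f i \<in> mcarrier Ex" "g i j \<in> mcarrier Ey" using f g[of i] by auto
    then show "rank_one Ez (m (f i) (g i j)) (m (f i) (g i j)) (\<Sum>k\<in>T. m (xs k) (ys k)) =
        m (f i) (rank_one Ey (g i j) (g i j) (slice T xs ys (f i)))"
      by (simp add: rank_one_def ip_m_simple m_ract)
  qed
  also have "\<dots> = (\<Sum>i\<in>I. m (f i) (frame_sum Ey (J i) (g i) (slice T xs ys (f i))))"
    unfolding frame_sum_def using f g
    by (intro sum.cong refl, subst m_sum_right) (auto simp: rank_one_def image_subset_iff)
  finally show ?thesis .
qed

text \<open>
  This is \<open>\<Sum>\<^sub>i T\<^sub>i T\<^sub>i\<^sup>* \<le> 1\<close> for the creation operators \<open>T\<^sub>i\<close> of the vectors \<open>f i\<close>: the sum is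
  \<open>K \<otimes> 1\<close> for the frame operator \<open>K\<close>, and \<open>1 - K = S\<^sup>* S\<close>.
\<close>

lemma nonneg_slice_defect:
  assumes sub: "subframe Ex I f"
  defines "z \<equiv> \<Sum>k\<in>T. m (xs k) (ys k)"
  shows "nonneg (ip Ez z z - (\<Sum>i\<in>I. ip Ey (slice T xs ys (f i)) (slice T xs ys (f i))))"
proof -
  have f: "f ` I \<subseteq> mcarrier Ex" using sub by (simp add: subframe_def)
  obtain S S' where S: "adjoint_pair Ex S S'" "\<And>x. x \<in> mcarrier Ex \<Longrightarrow> x - frame_sum Ex I f x = S' (S x)"
    using X.subframe_defect[OF sub] by blast
  note [simp] = X.adjoint_closed[OF S(1)] X.adjoint_closed'[OF S(1)]
  have z: "z \<in> mcarrier Ez" unfolding z_def using xs ys by (intro W.carrier_sum) auto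
  have fr: "frame_sum Ex I f (xs k) \<in> mcarrier Ex" if "k \<in> T" for k
    using X.frame_sum_closed[OF f xs[OF that]] .
  have "(\<Sum>i\<in>I. ip Ey (slice T xs ys (f i)) (slice T xs ys (f i))) =
      (\<Sum>i\<in>I. ip Ez z (m (f i) (slice T xs ys (f i))))"
    unfolding z_def using f by (intro sum.cong refl) (subst ip_m_simple(2), auto)
  also have "\<dots> = ip Ez z (\<Sum>i\<in>I. m (f i) (slice T xs ys (f i)))"
    using z f by (subst W.ip_sum_right) auto
  also have "\<dots> = ip Ez z (\<Sum>k\<in>T. m (frame_sum Ex I f (xs k)) (ys k))"
    by (simp add: sum_m_slice[OF f])
  finally have "ip Ez z z - (\<Sum>i\<in>I. ip Ey (slice T xs ys (f i)) (slice T xs ys (f i))) =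
      ip Ez z (z - (\<Sum>k\<in>T. m (frame_sum Ex I f (xs k)) (ys k)))"
    using z fr ys by (subst W.ip_diff_right) (auto intro!: W.carrier_sum)
  also have "z - (\<Sum>k\<in>T. m (frame_sum Ex I f (xs k)) (ys k)) = (\<Sum>k\<in>T. m (S' (S (xs k))) (ys k))"
    unfolding z_def sum_subtractf[symmetric] using fr xs ys S(2)
    by (intro sum.cong refl) (simp add: m_diff[symmetric])
  also have "ip Ez z (\<Sum>k\<in>T. m (S' (S (xs k))) (ys k)) =
      (\<Sum>k\<in>T. \<Sum>l\<in>T. ip Ez (m (xs l) (ys l)) (m (S' (S (xs k))) (ys k)))"
    unfolding z_def using xs ys
    by (subst W.ip_sum_right) (auto intro!: sum.cong W.ip_sum_left W.carrier_sum)
  also have "\<dots> = (\<Sum>k\<in>T. \<Sum>l\<in>T. ip Ez (m (S (xs l)) (ys l)) (m (S (xs k)) (ys k)))"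
    using xs ys by (intro sum.cong refl) (simp add: ip_m X.adjoint_ip[OF S(1)])
  also have "\<dots> = ip Ez (\<Sum>l\<in>T. m (S (xs l)) (ys l)) (\<Sum>k\<in>T. m (S (xs k)) (ys k))"
    using xs ys
    by (subst W.ip_sum_right) (auto intro!: sum.cong W.ip_sum_left[symmetric] W.carrier_sum)
  finally show ?thesis
    using xs ys by (auto intro!: W.nonneg_ip W.carrier_sum)
qed

end

text \<open>
  On the tensor product, \<open>1 - \<Sum>\<^sub>i \<Sum>\<^sub>j \<theta>\<close> is the sum of \<open>1 - \<Sum>\<^sub>i T\<^sub>i T\<^sub>i\<^sup>*\<close> and of the operators
  \<open>T\<^sub>i (1 - \<Sum>\<^sub>j \<theta>) T\<^sub>i\<^sup>*\<close>, where \<open>T\<^sub>i\<close> creates \<open>f i\<close> and the inner sum is the frame operator of \<open>g i\<close>.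
\<close>

lemma subframe_product:
  assumes f: "subframe Ex I f" and g: "\<And>i. i \<in> I \<Longrightarrow> subframe Ey (J i) (g i)"
  shows "subframe Ez (Sigma I J) (\<lambda>(i, j). m (f i) (g i j))"
proof (rule W.subframe_of_dense[OF _ _ dense_simple_span])
  have fI: "finite I" "\<And>i. i \<in> I \<Longrightarrow> f i \<in> mcarrier Ex" using f by (auto simp: subframe_def)
  have gJ: "\<And>i. i \<in> I \<Longrightarrow> finite (J i)" "\<And>i j. i \<in> I \<Longrightarrow> j \<in> J i \<Longrightarrow> g i j \<in> mcarrier Ey"
    using g by (auto simp: subframe_def image_subset_iff)
  show "finite (Sigma I J)" using fI gJ by auto
  show "(\<lambda>(i, j). m (f i) (g i j)) ` Sigma I J \<subseteq> mcarrier Ez" using fI gJ by auto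
  let ?h = "\<lambda>(i, j). m (f i) (g i j)"
  fix z assume "z \<in> simple_span"
  then obtain T :: "'z set" and xs ys where T: "finite T" "\<And>k. k \<in> T \<Longrightarrow> xs k \<in> mcarrier Ex"
    "\<And>k. k \<in> T \<Longrightarrow> ys k \<in> mcarrier Ey" and z: "z = (\<Sum>k\<in>T. m (xs k) (ys k))"
    using simple_spanE[of z] by blast
  let ?w = "\<lambda>i. slice T xs ys (f i)"
  note w = slice_closed[OF T(2,3)]
  note ipm = ip_m_simple[OF T(2,3)]
  have "(\<Sum>ij\<in>Sigma I J. ip Ez z (?h ij) * ip Ez (?h ij) z) =
      (\<Sum>i\<in>I. \<Sum>j\<in>J i. ip Ez z (m (f i) (g i j)) * ip Ez (m (f i) (g i j)) z)"
    by (subst sum.Sigma) (use fI gJ in \<open>auto simp: case_prod_unfold\<close>)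
  also have "\<dots> = (\<Sum>i\<in>I. \<Sum>j\<in>J i. ip Ey (?w i) (g i j) * ip Ey (g i j) (?w i))"
    unfolding z by (intro sum.cong refl) (simp add: ipm fI gJ)
  also have "\<dots> = (\<Sum>i\<in>I. ip Ey (?w i) (frame_sum Ey (J i) (g i) (?w i)))"
    using gJ w by (intro sum.cong refl Y.ip_frame_sum[symmetric]) auto
  finally have eq: "ip Ez z z - (\<Sum>ij\<in>Sigma I J. ip Ez z (?h ij) * ip Ez (?h ij) z)
     = (ip Ez z z - (\<Sum>i\<in>I. ip Ey (?w i) (?w i))) +
       (\<Sum>i\<in>I. ip Ey (?w i) (?w i) - ip Ey (?w i) (frame_sum Ey (J i) (g i) (?w i)))"
    by (simp add: sum_subtractf)
  have p1: "nonneg (ip Ez z z - (\<Sum>i\<in>I. ip Ey (?w i) (?w i)))"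
    unfolding z by (rule nonneg_slice_defect[OF T(2,3) f])
  have p2: "nonneg (ip Ey (?w i) (?w i) - ip Ey (?w i) (frame_sum Ey (J i) (g i) (?w i)))" if i: "i \<in> I" for i
  proof -
    obtain v where v: "v \<in> mcarrier Ey"
      "ip Ey (?w i) (?w i) - ip Ey (?w i) (frame_sum Ey (J i) (g i) (?w i)) = ip Ey v v"
      by (rule Y.subframe_diff[OF g[OF i] w[where x="f i"]])
    show ?thesis unfolding v(2) by (rule Y.nonneg_ip[OF v(1)])
  qed
  show "nonneg (ip Ez z z - (\<Sum>ij\<in>Sigma I J. ip Ez z (?h ij) * ip Ez (?h ij) z))"
    unfolding eq by (intro nonneg_add nonneg_sum p1 p2)
qed

end

context correspondence_tensor
begin

text \<open>
  Product families contain approximate units of the tensor product.  The vectors are first replaced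
  by finite sums \<open>\<Sum>\<^sub>k xs k \<otimes> ys k\<close>.  Then a family \<open>f\<close> is chosen for the left legs, and after it, for
  every \<open>i\<close>, a family \<open>g i\<close> for the slices along \<open>f i\<close>.  Frame operators of subframes are
  contractions, so the initial replacement is harmless.
\<close>

lemma ex_approximating_product:
  assumes fin: "finite Ws" and Ws: "Ws \<subseteq> mcarrier Ez" and e: "0 < e"
  shows "\<exists>(I :: (nat \<times> 'x) set) f (J :: nat \<times> 'x \<Rightarrow> (nat \<times> 'y) set) g.
    subframe Ex I f \<and> (\<forall>i\<in>I. subframe Ey (J i) (g i)) \<and>
    (\<forall>z\<in>Ws. mnorm Ez (z - frame_sum Ez (Sigma I J) (\<lambda>(i, j). m (f i) (g i j)) z) \<le> e)"
proof -
  have "\<exists>z'\<in>simple_span. mnorm Ez (z - z') < e / 3" if "z \<in> Ws" for z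
  proof -
    have "z \<in> mcarrier Ez" "0 < e / 3" using that Ws e by auto
    then show ?thesis using dense_simple_span unfolding dense_in_def by blast
  qed
  then have "\<forall>z\<in>Ws. \<exists>z'. z' \<in> simple_span \<and> mnorm Ez (z - z') < e / 3" by blast
  from bchoice[OF this] obtain a where a: "\<And>z. z \<in> Ws \<Longrightarrow> a z \<in> simple_span"
    "\<And>z. z \<in> Ws \<Longrightarrow> mnorm Ez (z - a z) < e / 3" by blast
  let ?P = "\<lambda>z (T :: 'z set) xs ys. finite T \<and> (\<forall>k\<in>T. xs k \<in> mcarrier Ex) \<and>
      (\<forall>k\<in>T. ys k \<in> mcarrier Ey) \<and> a z = (\<Sum>k\<in>T. m (xs k) (ys k))"
  have "\<exists>T xs ys. ?P z T xs ys" if "z \<in> Ws" for z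
    by (rule simple_spanE[OF a(1)[OF that]]) blast
  then have "\<forall>z\<in>Ws. \<exists>T xs ys. ?P z T xs ys" by blast
  from bchoice[OF this] obtain T where "\<forall>z\<in>Ws. \<exists>xs ys. ?P z (T z) xs ys" by blast
  from bchoice[OF this] obtain xs where "\<forall>z\<in>Ws. \<exists>ys. ?P z (T z) (xs z) ys" by blast
  from bchoice[OF this] obtain ys where rep: "\<forall>z\<in>Ws. ?P z (T z) (xs z) (ys z)" by blast
  have T: "\<And>z. z \<in> Ws \<Longrightarrow> finite (T z)"
    and xs: "\<And>z k. z \<in> Ws \<Longrightarrow> k \<in> T z \<Longrightarrow> xs z k \<in> mcarrier Ex"
    and ys: "\<And>z k. z \<in> Ws \<Longrightarrow> k \<in> T z \<Longrightarrow> ys z k \<in> mcarrier Ey"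
    and az: "\<And>z. z \<in> Ws \<Longrightarrow> a z = (\<Sum>k\<in>T z. m (xs z k) (ys z k))"
    using rep by blast+
  \<comment> \<open>\<open>C\<close> and, below, \<open>D\<close> bound the sums of norms by which the errors get multiplied; adding \<open>1\<close> keeps them positive\<close>
  define C where "C = 1 + (\<Sum>z\<in>Ws. \<Sum>k\<in>T z. mnorm Ey (ys z k))"
  have C: "1 \<le> C" unfolding C_def by (simp add: sum_nonneg)
  have Cz: "(\<Sum>k\<in>T z. mnorm Ey (ys z k)) \<le> C" if "z \<in> Ws" for z
    using member_le_sum[OF that, of "\<lambda>z. \<Sum>k\<in>T z. mnorm Ey (ys z k)"] fin
    by (simp add: C_def sum_nonneg)
  let ?B = "(\<Union>z\<in>Ws. xs z ` T z)"
  have "finite ?B" "?B \<subseteq> mcarrier Ex" "0 < e / (6 * C)" using fin T xs e C by auto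
  from X.ex_approximating_subframe[OF this]
  obtain I :: "(nat \<times> 'x) set" and f where f: "subframe Ex I f"
    and fa: "\<And>x. x \<in> ?B \<Longrightarrow> mnorm Ex (x - frame_sum Ex I f x) \<le> e / (6 * C)"
    by blast
  have fI: "finite I" "f ` I \<subseteq> mcarrier Ex" using f by (auto simp: subframe_def)
  define D where "D = 1 + (\<Sum>i\<in>I. mnorm Ex (f i))"
  have D: "1 \<le> D" unfolding D_def by (simp add: sum_nonneg)
  let ?s = "\<lambda>z i. slice (T z) (xs z) (ys z) (f i)"
  have sc: "?s z i \<in> mcarrier Ey" if "z \<in> Ws" for z i
    by (rule slice_closed) (use xs ys that in auto)
  have "\<forall>i. \<exists>(J :: (nat \<times> 'y) set) g. subframe Ey J g \<and>
      (\<forall>z\<in>Ws. mnorm Ey (?s z i - frame_sum Ey J g (?s z i)) \<le> e / (6 * D))"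
  proof
    fix i
    have "(\<lambda>z. ?s z i) ` Ws \<subseteq> mcarrier Ey" by (rule image_subsetI) (rule sc)
    moreover have "finite ((\<lambda>z. ?s z i) ` Ws)" "0 < e / (6 * D)" using fin e D by auto
    ultimately have "finite ((\<lambda>z. ?s z i) ` Ws)" "(\<lambda>z. ?s z i) ` Ws \<subseteq> mcarrier Ey" "0 < e / (6 * D)"
      by blast+
    from Y.ex_approximating_subframe[OF this]
    show "\<exists>(J :: (nat \<times> 'y) set) g. subframe Ey J g \<and>
      (\<forall>z\<in>Ws. mnorm Ey (?s z i - frame_sum Ey J g (?s z i)) \<le> e / (6 * D))" by blast
  qed
  from choice[OF this] obtain J :: "nat \<times> 'x \<Rightarrow> (nat \<times> 'y) set" where
    "\<forall>i. \<exists>g. subframe Ey (J i) g \<and>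
      (\<forall>z\<in>Ws. mnorm Ey (?s z i - frame_sum Ey (J i) g (?s z i)) \<le> e / (6 * D))" by blast
  from choice[OF this] obtain g where g: "\<And>i. subframe Ey (J i) (g i)"
    and ga: "\<And>i z. z \<in> Ws \<Longrightarrow> mnorm Ey (?s z i - frame_sum Ey (J i) (g i) (?s z i)) \<le> e / (6 * D)"
    by blast
  have gJ: "finite (J i)" "g i ` J i \<subseteq> mcarrier Ey" for i using g[of i] by (auto simp: subframe_def)
  let ?G = "frame_sum Ez (Sigma I J) (\<lambda>(i, j). m (f i) (g i j))"
  have sub: "subframe Ez (Sigma I J) (\<lambda>(i, j). m (f i) (g i j))"
    by (rule subframe_product[OF f g])
  then have Gadj: "adjoint_pair Ez ?G ?G" by (intro W.frame_sum_adjoint) (simp add: subframe_def)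
  note Gc [simp] = W.adjoint_closed[OF Gadj]
  have "mnorm Ez (z - ?G z) \<le> e" if z: "z \<in> Ws" for z
  proof -
    note xz = xs[OF z] and yz = ys[OF z]
    have zc: "z \<in> mcarrier Ez" using z Ws by auto
    have azc: "a z \<in> mcarrier Ez" unfolding az[OF z] using xz yz by (intro W.carrier_sum) auto
    define b where "b = (\<Sum>i\<in>I. m (f i) (?s z i))"
    have bc: "b \<in> mcarrier Ez" unfolding b_def using fI sc[OF z] by (intro W.carrier_sum) auto
    have Ga: "?G (a z) = (\<Sum>i\<in>I. m (f i) (frame_sum Ey (J i) (g i) (?s z i)))"
      unfolding az[OF z] by (rule frame_sum_product[OF xz yz fI(2) gJ(2) fI(1) gJ(1)])
    have frc: "frame_sum Ex I f (xs z k) \<in> mcarrier Ex" if "k \<in> T z" for k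
      by (rule X.frame_sum_closed[OF fI(2) xz[OF that]])
    have "a z - b = (\<Sum>k\<in>T z. m (xs z k - frame_sum Ex I f (xs z k)) (ys z k))"
      unfolding b_def az[OF z]
        sum_m_slice[where T = "T z" and xs = "xs z" and ys = "ys z", OF xz yz fI(2), simplified]
        sum_subtractf[symmetric]
      using xz yz frc by (intro sum.cong refl) (simp add: m_diff)
    then have "mnorm Ez (a z - b) \<le> (\<Sum>k\<in>T z. mnorm Ez (m (xs z k - frame_sum Ex I f (xs z k)) (ys z k)))"
      using xz yz frc by (simp only:) (intro W.mnorm_sum, auto)
    also have "\<dots> \<le> (\<Sum>k\<in>T z. e / (6 * C) * mnorm Ey (ys z k))"
    proof (rule sum_mono)
      fix k assume k: "k \<in> T z"
      then have "xs z k \<in> ?B" using z by auto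
      from mult_right_mono[OF fa[OF this], of "mnorm Ey (ys z k)"]
      show "mnorm Ez (m (xs z k - frame_sum Ex I f (xs z k)) (ys z k)) \<le> e / (6 * C) * mnorm Ey (ys z k)"
        using mnorm_m[of "xs z k - frame_sum Ex I f (xs z k)" "ys z k"] xz[OF k] yz[OF k] frc[OF k] by simp
    qed
    also have "\<dots> \<le> e / (6 * C) * C"
      unfolding sum_distrib_left[symmetric] using Cz[OF z] e C by (intro mult_left_mono) auto
    also have "\<dots> = e / 6" using C by simp
    finally have ab: "mnorm Ez (a z - b) \<le> e / 6" .
    have frs: "frame_sum Ey (J i) (g i) (?s z i) \<in> mcarrier Ey" for i
      by (rule Y.frame_sum_closed[OF gJ(2) sc[OF z]])
    have "b - ?G (a z) = (\<Sum>i\<in>I. m (f i) (?s z i - frame_sum Ey (J i) (g i) (?s z i)))"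
      unfolding Ga b_def sum_subtractf[symmetric]
      using fI sc[OF z] frs by (intro sum.cong refl) (auto simp: m_diff)
    then have "mnorm Ez (b - ?G (a z)) \<le> (\<Sum>i\<in>I. mnorm Ez (m (f i) (?s z i - frame_sum Ey (J i) (g i) (?s z i))))"
      using fI sc[OF z] frs by (simp only:) (intro W.mnorm_sum, auto)
    also have "\<dots> \<le> (\<Sum>i\<in>I. mnorm Ex (f i) * (e / (6 * D)))"
    proof (rule sum_mono)
      fix i assume "i \<in> I"
      then have "f i \<in> mcarrier Ex" using fI by auto
      then show "mnorm Ez (m (f i) (?s z i - frame_sum Ey (J i) (g i) (?s z i))) \<le> mnorm Ex (f i) * (e / (6 * D))"
        using mnorm_m[of "f i" "?s z i - frame_sum Ey (J i) (g i) (?s z i)"] sc[OF z] frs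
          mult_left_mono[OF ga[OF z, of i], of "mnorm Ex (f i)"] by simp
    qed
    also have "\<dots> = (\<Sum>i\<in>I. mnorm Ex (f i)) * (e / (6 * D))" by (rule sum_distrib_right[symmetric])
    also have "\<dots> \<le> D * (e / (6 * D))" using e D by (intro mult_right_mono) (auto simp: D_def)
    also have "\<dots> = e / 6" using D by simp
    finally have bG: "mnorm Ez (b - ?G (a z)) \<le> e / 6" .
    have "mnorm Ez (?G (a z) - ?G z) \<le> mnorm Ez (a z - z)"
      using W.subframe_contraction[OF sub, of "a z - z"] zc azc by (simp add: W.adjoint_diff[OF Gadj])
    then show ?thesis
      using W.mnorm_triangle_diff[of z "a z" "?G z"] W.mnorm_triangle_diff[of "a z" b "?G z"]
        W.mnorm_triangle_diff[of b "?G (a z)" "?G z"] a(2)[OF z] ab bG zc azc bc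
        W.mnorm_minus_commute[of z "a z"]
      by simp
  qed
  with f g show ?thesis by blast
qed

context
  fixes \<tau> :: "'a \<Rightarrow> complex"
  assumes \<tau>: "tracial_state \<tau>"
begin

abbreviation "\<sigma> \<equiv> weight_of \<tau>"

lemma sum_weight: "(\<Sum>i\<in>I. \<sigma> (h i)) = ereal (\<Sum>i\<in>I. Re (\<tau> (h i)))"
  by (simp add: weight_of_def)

lemma weight_zero: "\<sigma> 0 = 0"
  using linear_0[OF bounded_linear.linear[OF tracial_state_linear[OF \<tau>]]] by (simp add: weight_of_def)

lemma Tr_weight_zero: "Tr Ey \<sigma> (lact Ey 0) = 0"
proof -
  have eq: "(\<Sum>x\<in>H. \<sigma> (ip Ey x (lact Ey 0 x))) = 0" if "subframe Ey H (\<lambda>x. x)" for H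
    using that by (intro sum.neutral) (auto simp: subframe_def Y.lact_zero weight_zero)
  have "subframe Ey {} (\<lambda>x. x)" by (rule subframe_empty[OF Y.hilbert_module_axioms])
  then show ?thesis unfolding Tr_subframe
    by (intro antisym SUP_least) (auto simp: eq intro!: SUP_upper2[of "{}"])
qed

text \<open>
  Subframes \<open>H\<close> of the first factor and \<open>L x\<close>, \<open>x \<in> H\<close>, of the second combine to a subframe of the tensor
  product, at which the functional defining \<open>Tr Ez\<close> has the same value.
\<close>

lemma iterated_Tr_le:
  "Tr Ex (\<lambda>c. Tr Ey \<sigma> (lact Ey c)) (lact Ex a) \<le> Tr Ez \<sigma> (lact Ez a)"
  unfolding Tr_subframe[of Ex]
proof (rule SUP_least)
  fix H assume "H \<in> {H. subframe Ex H (\<lambda>x. x)}"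
  then have H: "subframe Ex H (\<lambda>x. x)" by simp
  then have Hc: "finite H" "\<And>x. x \<in> H \<Longrightarrow> x \<in> mcarrier Ex" by (auto simp: subframe_def)
  let ?c = "\<lambda>x. ip Ex x (lact Ex a x)"
  let ?r = "\<lambda>x L. \<Sum>y\<in>L. Re (\<tau> (ip Ey y (lact Ey (?c x) y)))"
  have "(\<Sum>x\<in>H. SUP L\<in>{L. subframe Ey L (\<lambda>y. y)}. ereal (?r x L)) \<le> Tr Ez \<sigma> (lact Ez a)"
  proof (rule sum_SUP_le[OF Hc(1)])
    show "{L. subframe Ey L (\<lambda>y. y)} \<noteq> {}"
      using subframe_empty[OF Y.hilbert_module_axioms] by blast
    fix L assume "\<And>x. x \<in> H \<Longrightarrow> L x \<in> {L. subframe Ey L (\<lambda>y. y)}"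
    then have L: "\<And>x. x \<in> H \<Longrightarrow> subframe Ey (L x) (\<lambda>y. y)" by simp
    then have Lc: "\<And>x. x \<in> H \<Longrightarrow> finite (L x)" "\<And>x y. x \<in> H \<Longrightarrow> y \<in> L x \<Longrightarrow> y \<in> mcarrier Ey"
      by (auto simp: subframe_def)
    have sub: "subframe Ez (Sigma H L) (\<lambda>(x, y). m x y)"
      by (rule subframe_product[OF H, where g = "\<lambda>_ y. y"]) (rule L)
    have "ereal (\<Sum>x\<in>H. ?r x (L x)) =
        (\<Sum>p\<in>Sigma H L. \<sigma> (ip Ez ((\<lambda>(x, y). m x y) p) (lact Ez a ((\<lambda>(x, y). m x y) p))))"
      unfolding sum_weight using Hc Lc
      by (subst sum.Sigma) (auto intro!: sum.cong simp: m_lact ip_m)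
    also have "\<dots> \<le> Tr Ez \<sigma> (lact Ez a)"
      by (rule W.Tr_ge_subframe[OF sub, where \<sigma> = "weight_of \<tau>"])
        (auto simp: W.lact_vector_scaleC weight_zero)
    finally show "ereal (\<Sum>x\<in>H. ?r x (L x)) \<le> Tr Ez \<sigma> (lact Ez a)" .
  qed
  then show "(\<Sum>x\<in>H. Tr Ey \<sigma> (lact Ey (?c x))) \<le> Tr Ez \<sigma> (lact Ez a)"
    by (simp add: Tr_subframe[of Ey] sum_weight)
qed

text \<open>
  This is where traciality enters.  Expanding the frame operator of \<open>f\<close> on the left gives terms
  \<open>\<tau>(\<langle>z, h\<rangle>\<langle>h, z\<rangle>) = \<tau>(\<langle>h, z\<rangle>\<langle>z, h\<rangle>)\<close> with \<open>h = b\<^sup>* f k\<close>; summed over \<open>z \<in> H\<close>, they are the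
  values at \<open>h\<close> of the frame operator of \<open>H\<close>, which is at most \<open>1\<close>.
\<close>

lemma sum_weight_subframe_swap:
  assumes H: "subframe Ez H (\<lambda>z. z)" and K: "finite K" "f ` K \<subseteq> mcarrier Ez"
  shows "(\<Sum>z\<in>H. Re (\<tau> (ip Ez (lact Ez b z) (frame_sum Ez K f (lact Ez b z))))) \<le>
    (\<Sum>k\<in>K. Re (\<tau> (ip Ez (f k) (lact Ez (b * star b) (f k)))))"
proof -
  note lin = bounded_linear.linear[OF tracial_state_linear[OF \<tau>]]
  have Hc: "finite H" "\<And>z. z \<in> H \<Longrightarrow> z \<in> mcarrier Ez" using H by (auto simp: subframe_def)
  have Kc: "\<And>k. k \<in> K \<Longrightarrow> f k \<in> mcarrier Ez" using K by auto
  let ?h = "\<lambda>k. lact Ez (star b) (f k)"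
  have "(\<Sum>z\<in>H. Re (\<tau> (ip Ez (lact Ez b z) (frame_sum Ez K f (lact Ez b z))))) =
      (\<Sum>z\<in>H. \<Sum>k\<in>K. Re (\<tau> (ip Ez (?h k) z * ip Ez z (?h k))))"
  proof (rule sum.cong[OF refl])
    fix z assume z: "z \<in> H"
    have "ip Ez (lact Ez b z) (frame_sum Ez K f (lact Ez b z)) = (\<Sum>k\<in>K. ip Ez z (?h k) * ip Ez (?h k) z)"
      using Hc(2)[OF z] Kc K(2)
      by (subst W.ip_frame_sum) (auto simp: W.lact_ip star_star intro!: sum.cong)
    then show "Re (\<tau> (ip Ez (lact Ez b z) (frame_sum Ez K f (lact Ez b z)))) =
        (\<Sum>k\<in>K. Re (\<tau> (ip Ez (?h k) z * ip Ez z (?h k))))"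
      by (simp add: linear_sum[OF lin] tracial_state_trace[OF \<tau>, of "ip Ez z _"])
  qed
  also have "\<dots> = (\<Sum>k\<in>K. \<Sum>z\<in>H. Re (\<tau> (ip Ez (?h k) z * ip Ez z (?h k))))" by (rule sum.swap)
  also have "\<dots> = (\<Sum>k\<in>K. Re (\<tau> (ip Ez (?h k) (frame_sum Ez H (\<lambda>z. z) (?h k)))))"
    using Kc Hc by (intro sum.cong refl) (subst W.ip_frame_sum, auto simp: linear_sum[OF lin])
  also have "\<dots> \<le> (\<Sum>k\<in>K. Re (\<tau> (ip Ez (f k) (lact Ez (b * star b) (f k)))))"
  proof (rule sum_mono)
    fix k assume "k \<in> K"
    then have k: "f k \<in> mcarrier Ez" "?h k \<in> mcarrier Ez" using Kc by auto
    obtain v where v: "v \<in> mcarrier Ez"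
      "ip Ez (?h k) (?h k) - ip Ez (?h k) (frame_sum Ez H (\<lambda>z. z) (?h k)) = ip Ez v v"
      using W.subframe_diff[OF H k(2)] by blast
    obtain c where "ip Ez v v = star c * c" using W.ip_pos[OF v(1)] by (auto simp: positives_def)
    then have "0 \<le> Re (\<tau> (ip Ez (?h k) (?h k)) - \<tau> (ip Ez (?h k) (frame_sum Ez H (\<lambda>z. z) (?h k))))"
      using tracial_state_pos[OF \<tau>, of c] v(2) by (simp add: linear_diff[OF lin, symmetric])
    moreover have "ip Ez (?h k) (?h k) = ip Ez (f k) (lact Ez (b * star b) (f k))"
      using k by (simp add: W.lact_ip star_star W.lact_mult)
    ultimately show "Re (\<tau> (ip Ez (?h k) (frame_sum Ez H (\<lambda>z. z) (?h k)))) \<le>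
        Re (\<tau> (ip Ez (f k) (lact Ez (b * star b) (f k))))" by simp
  qed
  finally show ?thesis .
qed

text \<open>
  A subframe \<open>H\<close> of the tensor product is tested against an approximate unit made of a product family,
  and the previous lemma exchanges the two families.  The exchange turns \<open>b\<^sup>* b\<close> into \<open>b b\<^sup>*\<close>.
\<close>

lemma Tr_le_iterated:
  "Tr Ez \<sigma> (lact Ez (star b * b)) \<le> Tr Ex (\<lambda>c. Tr Ey \<sigma> (lact Ey c)) (lact Ex (b * star b))"
  (is "_ \<le> ?R")
  unfolding Tr_subframe[of Ez]
proof (rule SUP_least)
  fix H assume "H \<in> {H. subframe Ez H (\<lambda>x. x)}"
  then have H: "subframe Ez H (\<lambda>x. x)" by simp
  then have Hc: "finite H" "\<And>z. z \<in> H \<Longrightarrow> z \<in> mcarrier Ez" by (auto simp: subframe_def)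
  note lin = bounded_linear.linear[OF tracial_state_linear[OF \<tau>]]
  let ?z = "\<lambda>z. lact Ez b z"
  define C where "C = 1 + (\<Sum>z\<in>H. mnorm Ez (?z z))"
  have C: "1 \<le> C" unfolding C_def by (simp add: sum_nonneg)
  let ?s = "\<Sum>z\<in>H. Re (\<tau> (ip Ez (?z z) (?z z)))"
  have "ereal ?s \<le> ?R"
  proof (rule ereal_le_epsilon2)
    fix e :: real assume e: "0 < e"
    have "finite (?z ` H)" "?z ` H \<subseteq> mcarrier Ez" "0 < e / C" using Hc C e by auto
    from ex_approximating_product[OF this]
    obtain I :: "(nat \<times> 'x) set" and f and J :: "nat \<times> 'x \<Rightarrow> (nat \<times> 'y) set" and g where
      f: "subframe Ex I f" and g: "\<And>i. i \<in> I \<Longrightarrow> subframe Ey (J i) (g i)" and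
      ap: "\<And>z. z \<in> H \<Longrightarrow> mnorm Ez (?z z - frame_sum Ez (Sigma I J) (\<lambda>(i, j). m (f i) (g i j)) (?z z)) \<le> e / C"
      by blast
    have fI: "finite I" "\<And>i. i \<in> I \<Longrightarrow> f i \<in> mcarrier Ex" using f by (auto simp: subframe_def)
    have gJ: "\<And>i. i \<in> I \<Longrightarrow> finite (J i)" "\<And>i j. i \<in> I \<Longrightarrow> j \<in> J i \<Longrightarrow> g i j \<in> mcarrier Ey"
      using g by (auto simp: subframe_def image_subset_iff)
    let ?h = "\<lambda>(i, j). m (f i) (g i j)"
    let ?G = "frame_sum Ez (Sigma I J) ?h"
    have K: "finite (Sigma I J)" "?h ` Sigma I J \<subseteq> mcarrier Ez" using fI gJ by auto
    let ?c = "\<lambda>i. ip Ex (f i) (lact Ex (b * star b) (f i))"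
    have "?s \<le> (\<Sum>z\<in>H. Re (\<tau> (ip Ez (?z z) (?G (?z z)))) + mnorm Ez (?z z) * (e / C))"
    proof (rule sum_mono)
      fix z assume z: "z \<in> H"
      have c: "?z z \<in> mcarrier Ez" "?G (?z z) \<in> mcarrier Ez"
        using Hc(2)[OF z] W.frame_sum_closed[OF K(2)] by auto
      have "Re (\<tau> (ip Ez (?z z) (?z z))) - Re (\<tau> (ip Ez (?z z) (?G (?z z)))) = Re (\<tau> (ip Ez (?z z) (?z z - ?G (?z z))))"
        using c by (simp add: W.ip_diff_right linear_diff[OF lin])
      also have "\<dots> \<le> mnorm Ez (?z z) * mnorm Ez (?z z - ?G (?z z))"
        using c by (intro order_trans[OF tracial_state_le_norm[OF \<tau>]] W.norm_ip_le) auto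
      also have "\<dots> \<le> mnorm Ez (?z z) * (e / C)" by (intro mult_left_mono ap z) simp
      finally show "Re (\<tau> (ip Ez (?z z) (?z z))) \<le> Re (\<tau> (ip Ez (?z z) (?G (?z z)))) + mnorm Ez (?z z) * (e / C)"
        by simp
    qed
    also have "\<dots> = (\<Sum>z\<in>H. Re (\<tau> (ip Ez (?z z) (?G (?z z))))) + (\<Sum>z\<in>H. mnorm Ez (?z z)) * (e / C)"
      by (simp only: sum.distrib sum_distrib_right)
    also have "\<dots> \<le> (\<Sum>k\<in>Sigma I J. Re (\<tau> (ip Ez (?h k) (lact Ez (b * star b) (?h k))))) + C * (e / C)"
      using e C by (intro add_mono sum_weight_subframe_swap[OF H K] mult_right_mono) (auto simp: C_def)
    also have "C * (e / C) = e" using C by simp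
    also have "(\<Sum>k\<in>Sigma I J. Re (\<tau> (ip Ez (?h k) (lact Ez (b * star b) (?h k))))) =
        (\<Sum>i\<in>I. \<Sum>j\<in>J i. Re (\<tau> (ip Ey (g i j) (lact Ey (?c i) (g i j)))))"
      using fI gJ by (subst sum.Sigma) (auto intro!: sum.cong simp: m_lact ip_m)
    finally have 1: "ereal ?s \<le> ereal (\<Sum>i\<in>I. \<Sum>j\<in>J i. Re (\<tau> (ip Ey (g i j) (lact Ey (?c i) (g i j))))) + ereal e"
      by simp
    have "ereal (\<Sum>i\<in>I. \<Sum>j\<in>J i. Re (\<tau> (ip Ey (g i j) (lact Ey (?c i) (g i j))))) =
        (\<Sum>i\<in>I. \<Sum>j\<in>J i. \<sigma> (ip Ey (g i j) (lact Ey (?c i) (g i j))))"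
      by (simp add: sum_weight)
    also have "\<dots> \<le> (\<Sum>i\<in>I. Tr Ey \<sigma> (lact Ey (?c i)))"
      by (intro sum_mono Y.Tr_ge_subframe g weight_zero) (auto simp: Y.lact_vector_scaleC)
    also have "\<dots> \<le> ?R"
      by (rule X.Tr_ge_subframe[OF f, where \<sigma> = "\<lambda>c. Tr Ey (weight_of \<tau>) (lact Ey c)"])
        (auto simp: X.lact_vector_scaleC Tr_weight_zero)
    finally have "ereal (\<Sum>i\<in>I. \<Sum>j\<in>J i. Re (\<tau> (ip Ey (g i j) (lact Ey (?c i) (g i j))))) \<le> ?R" .
    from add_right_mono[OF this, of "ereal e"] 1 show "ereal ?s \<le> ?R + ereal e" by (rule order_trans[rotated])
  qed
  moreover have "(\<Sum>x\<in>H. \<sigma> (ip Ez x (lact Ez (star b * b) x))) = ereal ?s"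
    unfolding sum_weight using Hc by (auto intro!: arg_cong[where f=ereal] sum.cong simp: W.lact_ip W.lact_mult)
  ultimately show "(\<Sum>x\<in>H. \<sigma> (ip Ez x (lact Ez (star b * b) x))) \<le> ?R" by simp
qed

text \<open>
  Applying \<open>Tr_le_iterated\<close> to \<open>b\<close> and to \<open>b\<^sup>*\<close>, with \<open>iterated_Tr_le\<close> in between, leads back to
  \<open>b\<^sup>* b\<close>; so no square root of \<open>a\<close> is needed.
\<close>

theorem Tr_tensor:
  assumes "a \<in> positives"
  shows "Tr Ez \<sigma> (lact Ez a) = Tr Ex (\<lambda>c. Tr Ey \<sigma> (lact Ey c)) (lact Ex a)"
proof -
  obtain b where b: "a = star b * b" using assms by (auto simp: positives_def)
  have "Tr Ez \<sigma> (lact Ez (star b * b)) \<le> Tr Ex (\<lambda>c. Tr Ey \<sigma> (lact Ey c)) (lact Ex (b * star b))"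
    by (rule Tr_le_iterated)
  also have "\<dots> \<le> Tr Ez \<sigma> (lact Ez (b * star b))" by (rule iterated_Tr_le)
  also have "\<dots> \<le> Tr Ex (\<lambda>c. Tr Ey \<sigma> (lact Ey c)) (lact Ex (star b * b))"
    using Tr_le_iterated[of "star b"] by (simp add: star_star)
  finally show ?thesis using iterated_Tr_le[of a] by (simp add: b)
qed

end

end

section \<open>Noetherian right LCM monoids and joins\<close>

lemma invertible_one: "(1::'p::monoid_mult) \<in> invertibles"
  by (auto simp: invertibles_def)

lemma invertible_factors:
  fixes x y :: "'p::right_lcm_monoid"
  assumes "x * y \<in> invertibles"
  shows "x \<in> invertibles" "y \<in> invertibles"
proof -
  obtain v where v: "x * y * v = 1" "v * (x * y) = 1" using assms by (auto simp: invertibles_def)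
  have 1: "x * (y * v) = 1" using v(1) by (simp add: mult.assoc)
  then have "x * (y * v * x) = x * 1" by (simp add: mult.assoc[symmetric])
  then have 2: "y * v * x = 1" by (rule left_cancel)
  from 1 2 show "x \<in> invertibles" by (auto simp: invertibles_def)
  have "y * (v * x) = 1" "v * x * y = 1" using 2 v(2) by (simp_all add: mult.assoc)
  then show "y \<in> invertibles" by (auto simp: invertibles_def)
qed

lemma prod_list_noninvertible:
  fixes xs :: "'p::right_lcm_monoid list"
  shows "filter (\<lambda>x. x \<notin> invertibles) xs \<noteq> [] \<Longrightarrow> prod_list xs \<notin> invertibles"
  by (induction xs) (auto split: if_splits dest: invertible_factors)

lemma prod_list_split:
  fixes xs :: "'p::right_lcm_monoid list"
  assumes "2 \<le> length (filter (\<lambda>x. x \<notin> invertibles) xs)"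
  shows "\<exists>p q. prod_list xs = p * q \<and> p \<notin> invertibles \<and> q \<notin> invertibles"
  using assms
proof (induction xs)
  case (Cons x xs)
  show ?case
  proof (cases "x \<in> invertibles")
    case True
    with Cons obtain p q where "prod_list xs = p * q" "p \<notin> invertibles" "q \<notin> invertibles" by auto
    then show ?thesis
      by (intro exI[of _ "x * p"] exI[of _ q]) (auto simp: mult.assoc dest: invertible_factors)
  next
    case False
    with Cons.prems have "filter (\<lambda>x. x \<notin> invertibles) xs \<noteq> []" by auto
    from prod_list_noninvertible[OF this] False show ?thesis
      by (intro exI[of _ x] exI[of _ "prod_list xs"]) simp
  qed
qed simp

text \<open>
  Every noninvertible element is an atom or a product of two noninvertible ones, and these are proper
  factors, so the Noetherian condition makes this a valid induction.
\<close>

lemma noninvertible_induct [consumes 1, case_names atom mult]: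
  fixes r :: "'p::noetherian_right_lcm_monoid"
  assumes "r \<notin> invertibles"
    and atom: "\<And>s. s \<in> atoms \<Longrightarrow> P s"
    and mult: "\<And>p q. p \<notin> invertibles \<Longrightarrow> q \<notin> invertibles \<Longrightarrow> P p \<Longrightarrow> P q \<Longrightarrow> P (p * q)"
  shows "P r"
proof -
  have "wf {(p, q :: 'p). proper_factor p q}"
    using noetherian by (auto simp: wf_iff_no_infinite_down_chain)
  then show ?thesis using assms(1)
  proof (induction r rule: wf_induct_rule)
    case (less r)
    show ?case
    proof (cases "r \<in> atoms")
      case False
      then obtain xs where "prod_list xs = r" "2 \<le> length (filter (\<lambda>x. x \<notin> invertibles) xs)"
        using less.prems by (auto simp: atoms_def not_le)
      then obtain p q where r: "r = p * q" and pq: "p \<notin> invertibles" "q \<notin> invertibles"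
        using prod_list_split by metis
      have "proper_factor p r" "proper_factor q r"
        unfolding proper_factor_def r using pq
        by (intro exI[of _ 1] exI[of _ q], simp, intro exI[of _ p] exI[of _ 1], simp)
      then show ?thesis unfolding r using less.IH pq by (intro mult) (auto simp: r)
    qed (rule atom)
  qed
qed

lemma right_ideal_self: "r \<in> right_ideal (r::'p::monoid_mult)"
  unfolding right_ideal_def by (rule range_eqI[of _ _ 1]) simp

lemma is_right_lcm_iff: "is_right_lcm r U \<longleftrightarrow> (\<Inter>q\<in>U. right_ideal q) = right_ideal (r::'p::monoid_mult)"
proof
  assume "is_right_lcm r U"
  then have "r \<in> (\<Inter>q\<in>U. right_ideal q)" and le: "(\<Inter>q\<in>U. right_ideal q) \<subseteq> right_ideal r"
    by (auto simp: is_right_lcm_def)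
  moreover have "r * x \<in> right_ideal q" if "r \<in> right_ideal q" for x q
    using that by (auto simp: right_ideal_def mult.assoc)
  ultimately have "right_ideal r \<subseteq> (\<Inter>q\<in>U. right_ideal q)" by (auto simp: right_ideal_def[of r])
  with le show "(\<Inter>q\<in>U. right_ideal q) = right_ideal r" by blast
next
  assume "(\<Inter>q\<in>U. right_ideal q) = right_ideal r"
  then show "is_right_lcm r U" using right_ideal_self[of r] by (simp add: is_right_lcm_def)
qed

lemma right_ideal_eqD:
  fixes r r' :: "'p::right_lcm_monoid"
  assumes "right_ideal r = right_ideal r'"
  obtains u where "u \<in> invertibles" "r' = r * u"
proof -
  obtain x y where x: "r' = r * x" and y: "r = r' * y"
    using right_ideal_self[of r] right_ideal_self[of r'] assms unfolding right_ideal_def by blast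
  have "r * (x * y) = r * 1" using x y by (simp add: mult.assoc[symmetric])
  moreover have "r' * (y * x) = r' * 1" using x y by (simp add: mult.assoc[symmetric])
  ultimately have "x * y = 1" "y * x = 1" using left_cancel by blast+
  then show thesis using that x by (auto simp: invertibles_def)
qed

lemma right_ideal_mult_invertible:
  fixes r :: "'p::monoid_mult"
  assumes "u \<in> invertibles"
  shows "right_ideal (r * u) = right_ideal r"
proof -
  obtain v where v: "u * v = 1" using assms by (auto simp: invertibles_def)
  have "r * x = r * u * (v * x)" for x by (metis mult.assoc mult_1_right v)
  then show ?thesis unfolding right_ideal_def by (auto simp: mult.assoc)
qed

text \<open>
  The intersection of the principal right ideals of the members, where \<open>None\<close>, standing for \<open>\<infinity>\<close>, has
  no multiples.  In this language a join exists precisely when the set is a principal right ideal.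
\<close>

definition common_multiples :: "'p::monoid_mult option set \<Rightarrow> 'p set" where
  "common_multiples K = {y. \<forall>k\<in>K. \<exists>x. k = Some x \<and> y \<in> right_ideal x}"

lemma common_multiples_Some: "None \<notin> K \<Longrightarrow> common_multiples K = (\<Inter>q\<in>the ` K. right_ideal q)"
  unfolding common_multiples_def by auto (metis not_None_eq option.sel)+

lemma
  fixes V :: "'p::right_lcm_monoid option set \<Rightarrow> 'p option"
  assumes V: "join_choice V" and fin: "finite K"
  shows join_Some: "V K = Some r \<Longrightarrow> common_multiples K = right_ideal r"
    and join_exists: "common_multiples K = right_ideal r \<Longrightarrow> \<exists>r'. V K = Some r'"
proof -
  have one: "right_ideal (1::'p) = UNIV" by (auto simp: right_ideal_def)
  have ex: "None \<notin> K \<and> is_right_lcm r (the ` K)" if "common_multiples K = right_ideal r"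
  proof -
    have "r \<in> common_multiples K" using that right_ideal_self by blast
    then have "None \<notin> K" by (auto simp: common_multiples_def)
    with that show ?thesis by (simp add: is_right_lcm_iff common_multiples_Some)
  qed
  show "\<exists>r'. V K = Some r'" if "common_multiples K = right_ideal r"
  proof (cases "K = {}")
    case True then show ?thesis using V by (simp add: join_choice_def)
  next
    case False
    with V fin ex[OF that] show ?thesis unfolding join_choice_def by metis
  qed
  show "common_multiples K = right_ideal r" if r: "V K = Some r"
  proof (cases "K = {}")
    case True then show ?thesis using V r one by (auto simp: join_choice_def common_multiples_def)
  next
    case False
    have "if None \<notin> K \<and> (\<exists>r. is_right_lcm r (the ` K))
         then \<exists>r. V K = Some r \<and> is_right_lcm r (the ` K) else V K = None"
      using V fin False unfolding join_choice_def by blast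
    with r have "None \<notin> K" "is_right_lcm r (the ` K)" by (auto split: if_splits)
    then show ?thesis by (simp add: is_right_lcm_iff common_multiples_Some)
  qed
qed

lemma join_left_factor:
  fixes V :: "'p::right_lcm_monoid option set \<Rightarrow> 'p option"
  assumes V: "join_choice V" and fin: "finite K" "finite L"
    and eq: "common_multiples K = (*) p ` common_multiples L"
  shows "V L = None \<and> V K = None \<or>
    (\<exists>r u. V L = Some r \<and> u \<in> invertibles \<and> V K = Some (p * r * u))"
proof (cases "V L")
  case None
  have "V K = None"
  proof (rule ccontr)
    assume "V K \<noteq> None"
    then obtain s where "V K = Some s" by blast
    then have s: "(*) p ` common_multiples L = right_ideal s" using join_Some[OF V fin(1)] eq by simp
    then obtain r where r: "s = p * r" using right_ideal_self[of s] by blast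
    have "(*) p ` common_multiples L = (*) p ` right_ideal r"
      unfolding s r right_ideal_def by (auto simp: mult.assoc image_image)
    moreover have "inj ((*) p)" using left_cancel by (rule injI)
    ultimately have "common_multiples L = right_ideal r" by (simp add: inj_image_eq_iff)
    then show False using join_exists[OF V fin(2)] None by force
  qed
  with None show ?thesis by simp
next
  case (Some r)
  have "(*) p ` right_ideal r = right_ideal (p * r)"
    unfolding right_ideal_def by (auto simp: mult.assoc image_image)
  then have K: "common_multiples K = right_ideal (p * r)" using join_Some[OF V fin(2) Some] eq by simp
  then obtain s where s: "V K = Some s" using join_exists[OF V fin(1)] by blast
  have "right_ideal (p * r) = right_ideal s" using join_Some[OF V fin(1) s] K by simp
  then obtain u where "u \<in> invertibles" "s = p * r * u" by (rule right_ideal_eqD)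
  with Some s show ?thesis by blast
qed

text \<open>
  The defining property of \<open>l2\<close>: since \<open>pP \<inter> xP\<close> is \<open>(p \<or> x)P\<close> or empty, cancelling \<open>p\<close> shows that
  \<open>p y\<close> is a multiple of \<open>l j\<close> precisely when \<open>y\<close> is one of \<open>l2 j\<close>.
\<close>

lemma recursive_step_divides:
  fixes l :: "nat \<Rightarrow> 'p::right_lcm_monoid option"
  assumes step: "recursive_step n l i p q l1 l2" and j: "j \<in> {1..n}"
  shows "p * y \<in> common_multiples {l j} \<longleftrightarrow> y \<in> common_multiples {l2 j}"
proof (cases "j = i")
  case True
  have "l i = Some (p * q)" "l2 i = Some q" using step by (auto simp: recursive_step_def)
  then show ?thesis unfolding True
    by (auto simp: common_multiples_def right_ideal_def mult.assoc intro: left_cancel)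
next
  case False
  have sj: "case l j of None \<Rightarrow> l2 j = None
        | Some x \<Rightarrow> if \<exists>r. is_right_lcm r {p, x}
            then \<exists>r. is_right_lcm r {p, x} \<and> l2 j = Some (left_quotient p r) else l2 j = None"
    using step j False unfolding recursive_step_def by blast
  show ?thesis
  proof (cases "l j")
    case None with sj show ?thesis by (simp add: common_multiples_def)
  next
    case (Some x)
    show ?thesis
    proof (cases "\<exists>r. is_right_lcm r {p, x}")
      case True
      then obtain r where r: "is_right_lcm r {p, x}" and l2: "l2 j = Some (left_quotient p r)"
        using sj Some by auto
      have int: "right_ideal p \<inter> right_ideal x = right_ideal r" using r by (simp add: is_right_lcm_iff)
      then obtain t where t: "r = p * t" using right_ideal_self[of r] by (auto simp: right_ideal_def)
      have "left_quotient p r = t"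
        unfolding left_quotient_def t by (rule the_equality) (auto intro: left_cancel)
      moreover have "p * y \<in> right_ideal x \<longleftrightarrow> p * y \<in> right_ideal r"
        using int by (auto simp: right_ideal_def[of p])
      moreover have "p * y \<in> right_ideal r \<longleftrightarrow> y \<in> right_ideal t"
        unfolding t right_ideal_def by (auto simp: mult.assoc intro: left_cancel)
      ultimately show ?thesis by (simp add: common_multiples_def Some l2)
    next
      case False
      then have "right_ideal p \<inter> right_ideal x = {}" using ex_right_lcm by blast
      then have "p * y \<notin> right_ideal x" by (auto simp: right_ideal_def[of p])
      with False sj show ?thesis by (simp add: common_multiples_def Some)
    qed
  qed
qed

text \<open>
  Together with \<open>join_left_factor\<close> this says that \<open>{p} \<union> l(U)\<close> has the join \<open>p (\<or>l2(U))\<close>, up to an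
  invertible factor, and has none when \<open>\<or>l2(U) = \<infinity>\<close>.
\<close>

lemma recursive_step_common_multiples:
  fixes l :: "nat \<Rightarrow> 'p::right_lcm_monoid option"
  assumes step: "recursive_step n l i p q l1 l2" and U: "U \<subseteq> {1..n}"
  shows "common_multiples (insert (Some p) (l ` U)) = (*) p ` common_multiples (l2 ` U)"
proof -
  have K: "y \<in> common_multiples (insert (Some p) (l ` U)) \<longleftrightarrow>
      (\<exists>x. y = p * x) \<and> (\<forall>j\<in>U. y \<in> common_multiples {l j})" for y
    by (auto simp: common_multiples_def right_ideal_def)
  have L: "x \<in> common_multiples (l2 ` U) \<longleftrightarrow> (\<forall>j\<in>U. p * x \<in> common_multiples {l j})" for x
  proof -
    have "x \<in> common_multiples (l2 ` U) \<longleftrightarrow> (\<forall>j\<in>U. x \<in> common_multiples {l2 j})"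
      by (auto simp: common_multiples_def)
    also have "\<dots> \<longleftrightarrow> (\<forall>j\<in>U. p * x \<in> common_multiples {l j})"
      using recursive_step_divides[OF step, of _ x] U by (intro ball_cong refl) auto
    finally show ?thesis .
  qed
  show ?thesis
  proof (intro equalityI subsetI)
    fix y assume "y \<in> common_multiples (insert (Some p) (l ` U))"
    then obtain x where x: "y = p * x" "\<forall>j\<in>U. y \<in> common_multiples {l j}" unfolding K by blast
    have "x \<in> common_multiples (l2 ` U)" unfolding L using x(2) unfolding x(1) .
    then show "y \<in> (*) p ` common_multiples (l2 ` U)" unfolding x(1) by (rule imageI)
  next
    fix y assume "y \<in> (*) p ` common_multiples (l2 ` U)"
    then obtain x where x: "x \<in> common_multiples (l2 ` U)" "y = p * x" by (rule imageE)
    have "\<forall>j\<in>U. p * x \<in> common_multiples {l j}" using x(1) unfolding L .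
    then show "y \<in> common_multiples (insert (Some p) (l ` U))" unfolding K x(2) by blast
  qed
qed

section \<open>Induced traces along products\<close>

lemma mono_Tr:
  assumes E: "correspondence E" and a: "a \<in> positives" and k: "0 \<le> k"
    and le: "\<And>c. c \<in> positives \<Longrightarrow> \<sigma> c \<le> ereal k * \<sigma>' c"
  shows "Tr E \<sigma> (lact E a) \<le> ereal k * Tr E \<sigma>' (lact E a)"
  unfolding Tr_subframe[of E \<sigma>]
proof (rule SUP_least)
  interpret correspondence E by fact
  fix H assume "H \<in> {H. subframe E H (\<lambda>x. x)}"
  then have H: "subframe E H (\<lambda>x. x)" by simp
  obtain b where b: "a = star b * b" using a by (auto simp: positives_def)
  have pos: "ip E x (lact E a x) \<in> positives" if "x \<in> H" for x
  proof -
    have x: "x \<in> mcarrier E" using that H by (auto simp: subframe_def)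
    then have "ip E x (lact E a x) = ip E (lact E b x) (lact E b x)"
      by (simp add: b lact_mult lact_ip)
    then show ?thesis using x by (simp add: ip_pos)
  qed
  have "(\<Sum>x\<in>H. \<sigma> (ip E x (lact E a x))) \<le> (\<Sum>x\<in>H. ereal k * \<sigma>' (ip E x (lact E a x)))"
    by (intro sum_mono le pos)
  also have "\<dots> = ereal k * (\<Sum>x\<in>H. \<sigma>' (ip E x (lact E a x)))"
    using sum_distrib_right_ereal[OF k, of "\<lambda>x. \<sigma>' (ip E x (lact E a x))" H]
    by (simp add: mult.commute[of "ereal k"])
  also have "\<dots> \<le> ereal k * Tr E \<sigma>' (lact E a)"
    unfolding Tr_subframe using H k by (intro ereal_mult_left_mono SUP_upper) auto
  finally show "(\<Sum>x\<in>H. \<sigma> (ip E x (lact E a x))) \<le> ereal k * Tr E \<sigma>' (lact E a)" .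
qed

lemma cong_Tr:
  assumes E: "correspondence E" and a: "a \<in> positives"
    and eq: "\<And>c. c \<in> positives \<Longrightarrow> \<sigma> c = \<sigma>' c"
  shows "Tr E \<sigma> (lact E a) = Tr E \<sigma>' (lact E a)"
  using mono_Tr[OF E a, of 1 \<sigma> \<sigma>'] mono_Tr[OF E a, of 1 \<sigma>' \<sigma>] eq by (simp add: one_ereal_def[symmetric])

lemma Tr_nonneg: "correspondence E \<Longrightarrow> 0 \<le> Tr E \<sigma> T"
  unfolding Tr_subframe
  by (rule SUP_upper2[of "{}"]) (auto intro: subframe_empty correspondence.axioms)

text \<open>
  What the subinvariance and well-definedness conditions say about single atoms.  Induction along
  factorisations extends both properties to \<open>F\<^sub>r(\<tau>)\<close> for every noninvertible \<open>r\<close>.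
\<close>

locale subinvariant_trace = product_system X mul j
  for X :: "'p::noetherian_right_lcm_monoid \<Rightarrow> ('a::cstar_algebra, 'x::complex_vector) corr"
    and mul :: "'p \<Rightarrow> 'p \<Rightarrow> 'x \<Rightarrow> 'x \<Rightarrow> 'x"
    and j :: "'a \<Rightarrow> 'x" +
  fixes \<tau> :: "'a \<Rightarrow> complex"
  assumes trace: "tracial_state \<tau>"
    and atom_finite: "s \<in> atoms \<Longrightarrow>
      \<exists>k\<ge>0. \<forall>a\<in>positives. F X s (weight_of \<tau>) a \<le> ereal k * weight_of \<tau> a"
    and atom_unit: "s \<in> atoms \<Longrightarrow> u \<in> invertibles \<Longrightarrow> a \<in> positives \<Longrightarrow>
      F X (s * u) (weight_of \<tau>) a = F X s (weight_of \<tau>) a"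
begin

lemma F_mult:
  assumes "p \<notin> invertibles" "a \<in> positives"
  shows "F X (p * q) (weight_of \<tau>) a = F X p (F X q (weight_of \<tau>)) a"
proof -
  have p: "p \<noteq> 1" using assms(1) invertible_one by blast
  interpret correspondence_tensor "X p" "X q" "X (p * q)" "mul p q"
    by (intro correspondence_tensor.intro correspondence_tensor_axioms.intro fibre mul_tensor p)
  have "F X q (weight_of \<tau>) = (\<lambda>c. Tr (X q) (weight_of \<tau>) (lact (X q) c))" by (rule ext) (simp add: F_def)
  then show ?thesis using Tr_tensor[OF trace assms(2)] by (simp add: F_def)
qed

text \<open>
  For an atom this is assumed.  For a product \<open>pq\<close> the invertible factor is absorbed by \<open>q\<close>, because
  \<open>F\<^sub>p\<^sub>q\<^sub>u(\<tau>) = F\<^sub>p(F\<^sub>q\<^sub>u(\<tau>))\<close>.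
\<close>

lemma F_unit:
  assumes "r \<notin> invertibles" "u \<in> invertibles" "a \<in> positives"
  shows "F X (r * u) (weight_of \<tau>) a = F X r (weight_of \<tau>) a"
  using assms(1,3)
proof (induction r arbitrary: a rule: noninvertible_induct)
  case (atom s)
  then show ?case using atom_unit assms(2) by blast
next
  case (mult p q)
  have "F X (p * q * u) (weight_of \<tau>) a = F X p (F X (q * u) (weight_of \<tau>)) a"
    using F_mult[OF mult.hyps(1) mult.prems] by (simp add: mult.assoc)
  also have "\<dots> = F X p (F X q (weight_of \<tau>)) a"
    unfolding F_def[of X p] by (rule cong_Tr[OF fibre mult.prems]) (rule mult.IH(2))
  finally show ?case using F_mult[OF mult.hyps(1) mult.prems] by simp
qed

text \<open>
  Domination by a multiple of \<open>\<tau>\<close>, rather than mere finiteness, passes through \<open>F\<^sub>p\<^sub>q(\<tau>) = F\<^sub>p(F\<^sub>q(\<tau>))\<close>.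
\<close>

lemma F_bounded:
  assumes "r \<notin> invertibles"
  shows "\<exists>k\<ge>0. \<forall>a\<in>positives. F X r (weight_of \<tau>) a \<le> ereal k * weight_of \<tau> a"
  using assms
proof (induction r rule: noninvertible_induct)
  case (atom s)
  then show ?case by (rule atom_finite)
next
  case (mult p q)
  then obtain k k' where k: "0 \<le> k" "\<And>a. a \<in> positives \<Longrightarrow> F X p (weight_of \<tau>) a \<le> ereal k * weight_of \<tau> a"
    and k': "0 \<le> k'" "\<And>a. a \<in> positives \<Longrightarrow> F X q (weight_of \<tau>) a \<le> ereal k' * weight_of \<tau> a" by blast
  have "F X (p * q) (weight_of \<tau>) a \<le> ereal (k' * k) * weight_of \<tau> a" if a: "a \<in> positives" for a
  proof -
    have "F X (p * q) (weight_of \<tau>) a = F X p (F X q (weight_of \<tau>)) a" by (rule F_mult[OF mult.hyps(1) a])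
    also have "\<dots> \<le> ereal k' * F X p (weight_of \<tau>) a"
      unfolding F_def[of X p] by (rule mono_Tr[OF fibre a k'])
    also have "\<dots> \<le> ereal k' * (ereal k * weight_of \<tau> a)" using k(2)[OF a] k'(1) by (intro ereal_mult_left_mono) auto
    finally show ?thesis by (simp add: mult.assoc[symmetric])
  qed
  then show ?case using k(1) k'(1) by (intro exI[of _ "k' * k"]) auto
qed

lemma F_real:
  assumes "r \<notin> invertibles" "a \<in> positives"
  shows "\<exists>x. F X r (weight_of \<tau>) a = ereal x"
proof -
  obtain k where "F X r (weight_of \<tau>) a \<le> ereal k * weight_of \<tau> a" using F_bounded[OF assms(1)] assms(2) by blast
  moreover have "0 \<le> F X r (weight_of \<tau>) a" unfolding F_def by (rule Tr_nonneg[OF fibre])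
  ultimately show ?thesis by (cases "F X r (weight_of \<tau>) a") (auto simp: weight_of_def)
qed

text \<open>
  The comparison of two terms of the alternating sums.  A single real number \<open>d\<close> describes both of them,
  so that sums of such terms can be rearranged in the reals.
\<close>

lemma weighted_join_left_factor:
  fixes V :: "'p option set \<Rightarrow> 'p option"
  assumes N: "\<And>r. 0 < N r" "\<And>r s. N (r * s) = N r * N s" "\<And>u. u \<in> invertibles \<Longrightarrow> N u = 1"
    and V: "join_choice V" and p: "p \<notin> invertibles" and a: "a \<in> positives"
    and fin: "finite K" "finite L" and eq: "common_multiples K = (*) p ` common_multiples L"
  shows "\<exists>d. weighted N \<beta> (\<lambda>r. F X p (F X r (weight_of \<tau>)) a) (V L) = ereal d \<and>
    weighted N \<beta> (\<lambda>r. F X r (weight_of \<tau>) a) (V K) = ereal (N p powr (- \<beta>) * d)"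
  using join_left_factor[OF V fin eq]
proof (elim disjE conjE exE)
  assume "V L = None" "V K = None"
  then show ?thesis by (intro exI[of _ 0]) (simp add: weighted_def)
next
  fix r u assume L: "V L = Some r" and u: "u \<in> invertibles" and K: "V K = Some (p * r * u)"
  have pr: "p * r \<notin> invertibles" using p invertible_factors(1) by blast
  obtain x where x: "F X (p * r) (weight_of \<tau>) a = ereal x" using F_real[OF pr a] by blast
  have "F X p (F X r (weight_of \<tau>)) a = ereal x" using F_mult[OF p a] x by simp
  moreover have "F X (p * r * u) (weight_of \<tau>) a = ereal x" using F_unit[OF pr u a] x by simp
  moreover have "N (p * r * u) = N p * N r" by (simp add: N(2,3) u)
  ultimately show ?thesis
    using N(1)[of p] N(1)[of r]
    by (intro exI[of _ "N r powr (- \<beta>) * x"]) (simp add: weighted_def L K powr_mult)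
qed

end

lemma sum_Pow_insert:
  fixes f :: "'i set \<Rightarrow> 'b::comm_monoid_add"
  assumes "finite I" "i \<notin> I"
  shows "(\<Sum>U\<in>Pow (insert i I). f U) = (\<Sum>U\<in>Pow I. f U) + (\<Sum>U\<in>Pow I. f (insert i U))"
proof -
  have inj: "inj_on (insert i) (Pow I)" using assms(2) by (auto simp: inj_on_def)
  have "(\<Sum>U\<in>Pow (insert i I). f U) = (\<Sum>U\<in>Pow I. f U) + (\<Sum>U\<in>insert i ` Pow I. f U)"
    unfolding Pow_insert using assms by (intro sum.union_disjoint) auto
  then show ?thesis by (simp add: sum.reindex[OF inj])
qed

text \<open>
  Subinvariance for \<open>J = {s}\<close> reads \<open>N(s)\<^sup>-\<^sup>\<beta> F\<^sub>s(\<tau>) \<le> \<tau>\<close>.  For invertible \<open>u\<close> both \<open>s\<close> and \<open>s u\<close> are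
  right LCMs of \<open>{s}\<close>, so well-definedness gives \<open>F\<^sub>s\<^sub>u(\<tau>) = F\<^sub>s(\<tau>)\<close>.
\<close>

lemma subinvariant_traceI:
  fixes X :: "'p::noetherian_right_lcm_monoid \<Rightarrow> ('a::cstar_algebra, 'x::complex_vector) corr"
  assumes X: "product_system X mul j" and N: "\<And>r. 0 < N r" and V: "join_choice V"
    and \<tau>: "tracial_state \<tau>" and wd: "trace_well_defined X (weight_of \<tau>)"
    and sub: "\<And>s a. s \<in> atoms \<Longrightarrow> a \<in> positives \<Longrightarrow>
      0 \<le> weight_of \<tau> a - weighted N \<beta> (\<lambda>r. F X r (weight_of \<tau>) a) (V {Some s})"
  shows "subinvariant_trace X mul j \<tau>"
proof -
  let ?w = "weight_of \<tau>"
  have wd': "F X r ?w a = F X s ?w a"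
    if "s \<in> atoms" "right_ideal s = right_ideal r" "a \<in> positives" for s r a
  proof -
    have "is_right_lcm r {s}" "is_right_lcm s {s}" using that by (simp_all add: is_right_lcm_iff)
    then show ?thesis
      using wd that(1,3) unfolding trace_well_defined_def
      by (metis empty_subsetI finite.emptyI finite_insert insert_not_empty insert_subset)
  qed
  have bound: "F X s ?w a \<le> ereal (N r powr \<beta>) * ?w a"
    if s: "s \<in> atoms" and a: "a \<in> positives" and r: "V {Some s} = Some r" for s a r
  proof -
    have "right_ideal s = right_ideal r"
      using join_Some[OF V _ r] by (simp add: common_multiples_def)
    then have Fr: "F X r ?w a = F X s ?w a" using wd' s a by blast
    have ge: "0 \<le> F X s ?w a"
      unfolding F_def by (rule Tr_nonneg[OF product_system.fibre[OF X]])
    have le: "0 \<le> ?w a - ereal (N r powr (- \<beta>)) * F X s ?w a"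
      using sub[OF s a] by (simp add: r weighted_def Fr)
    show ?thesis
    proof (cases "F X s ?w a")
      case (real f)
      then have "N r powr (- \<beta>) * f \<le> Re (\<tau> a)" using le by (simp add: weight_of_def)
      then have "N r powr \<beta> * (N r powr (- \<beta>) * f) \<le> N r powr \<beta> * Re (\<tau> a)"
        by (rule mult_left_mono) simp
      moreover have "N r powr \<beta> * N r powr (- \<beta>) = 1"
        using N[of r] by (simp add: powr_add[symmetric])
      ultimately show ?thesis using real by (simp add: weight_of_def mult.assoc[symmetric])
    qed (use le ge N[of r] in \<open>auto simp: weight_of_def\<close>)
  qed
  have ex: "\<exists>r. V {Some s} = Some r" for s
    using join_exists[OF V, of "{Some s}" s] by (simp add: common_multiples_def)
  show ?thesis
  proof (intro subinvariant_trace.intro subinvariant_trace_axioms.intro X \<tau>)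
    fix s :: 'p assume s: "s \<in> atoms"
    obtain r where "V {Some s} = Some r" using ex by blast
    with bound[OF s] show "\<exists>k\<ge>0. \<forall>a\<in>positives. F X s ?w a \<le> ereal k * ?w a"
      by (intro exI[of _ "N r powr \<beta>"]) auto
    show "F X (s * u) ?w a = F X s ?w a" if "u \<in> invertibles" "a \<in> positives" for u a
      by (rule wd'[OF s _ that(2)]) (simp add: right_ideal_mult_invertible[OF that(1)])
  qed
qed

theorem proposition4p7:
  fixes X :: "'p::noetherian_right_lcm_monoid \<Rightarrow> ('a::cstar_algebra, 'x::complex_vector) corr"
    and mul :: "'p \<Rightarrow> 'p \<Rightarrow> 'x \<Rightarrow> 'x \<Rightarrow> 'x"
    and j :: "'a \<Rightarrow> 'x"
    and N :: "'p \<Rightarrow> real"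
    and \<beta> :: real
    and \<tau> :: "'a \<Rightarrow> complex"
    and V :: "'p option set \<Rightarrow> 'p option"
    and n i :: nat
    and l l1 l2 :: "nat \<Rightarrow> 'p option"
    and p q :: 'p
  assumes "product_system X mul j"
    and "\<And>r. essential (X r)"
    and "compactly_aligned X mul"
    and "\<And>r. 0 < N r"
    and "\<And>r s. N (r * s) = N r * N s"
    and "\<And>u. u \<in> invertibles \<Longrightarrow> N u = 1"
    and "join_choice V"
    and "tracial_state \<tau>"
    and "trace_well_defined X (weight_of \<tau>)"
    and "\<And>J a. finite J \<Longrightarrow> J \<subseteq> atoms \<Longrightarrow> a \<in> positives \<Longrightarrow>
      0 \<le> weight_of \<tau> a +
        (\<Sum>U\<in>Pow J - {{}}. ereal ((-1) ^ card U) *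
           weighted N \<beta> (\<lambda>r. F X r (weight_of \<tau>) a) (V (Some ` U)))"
    and "\<not> leaf n l"
    and "recursive_step n l i p q l1 l2"
  shows "\<forall>a\<in>positives.
    Z X N \<beta> V n l (weight_of \<tau>) a =
      Z X N \<beta> V n l1 (weight_of \<tau>) a +
      ereal (1 / N p powr \<beta>) *
        (\<Sum>U\<in>Pow {1..n}. ereal ((-1) ^ card U) *
           weighted N \<beta> (\<lambda>r. F X p (F X r (weight_of \<tau>)) a) (V (l2 ` U)))"
proof
  fix a :: 'a assume a: "a \<in> positives"
  let ?w = "weight_of \<tau>" and ?c = "N p powr (- \<beta>)" and ?I = "{1..n} - {i}"
  have sub: "0 \<le> ?w a - weighted N \<beta> (\<lambda>r. F X r ?w a) (V {Some s})"
    if "s \<in> atoms" "a \<in> positives" for s and a :: 'a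
  proof -
    have "Pow {s} - {{}} = {{s}}" by auto
    moreover have "ereal (- 1) * x = - x" for x by (cases x) auto
    ultimately show ?thesis
      using assms(10)[of "{s}" a] that by (simp add: minus_ereal_def)
  qed
  interpret subinvariant_trace X mul j \<tau>
    by (rule subinvariant_traceI[OF assms(1,4,7,8,9) sub])
  note step = assms(12)
  have p: "p \<notin> invertibles" and i: "i \<in> {1..n}" and li: "l i = Some (p * q)" and l1i: "l1 i = Some p"
    and l1: "\<And>k. k \<in> ?I \<Longrightarrow> l1 k = l k"
    using step by (auto simp: recursive_step_def atoms_def)
  have ins: "{1..n} = insert i ?I" "finite ?I" "i \<notin> ?I" using i by auto
  let ?W = "\<lambda>K. weighted N \<beta> (\<lambda>r. F X r ?w a) (V K)"
  let ?W2 = "\<lambda>U. weighted N \<beta> (\<lambda>r. F X p (F X r ?w) a) (V (l2 ` U))"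
  have fin: "finite U" if "U \<subseteq> {1..n}" for U using that by (rule finite_subset) simp
  have "\<exists>d. ?W2 U = ereal d \<and> ?W (insert (Some p) (l ` U)) = ereal (?c * d)" if "U \<subseteq> {1..n}" for U
    using fin[OF that]
    by (intro weighted_join_left_factor assms(4,5,6,7) p a recursive_step_common_multiples[OF step that]) auto
  then have "\<forall>U\<in>Pow {1..n}. \<exists>d. ?W2 U = ereal d \<and> ?W (insert (Some p) (l ` U)) = ereal (?c * d)"
    by blast
  from bchoice[OF this] obtain d where
    d: "\<And>U. U \<subseteq> {1..n} \<Longrightarrow> ?W2 U = ereal (d U)"
       "\<And>U. U \<subseteq> {1..n} \<Longrightarrow> ?W (insert (Some p) (l ` U)) = ereal (?c * d U)"
    by blast
  \<comment> \<open>inserting \<open>p\<close> changes nothing here, because \<open>p\<close> divides \<open>l i = p q\<close>\<close>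
  have d': "?W (l ` U) = ereal (?c * d U)" if U: "U \<subseteq> {1..n}" "i \<in> U" for U
  proof -
    have "l i \<in> l ` U" using U(2) by simp
    then have "common_multiples (insert (Some p) (l ` U)) = common_multiples (l ` U)"
      unfolding li by (force simp: common_multiples_def right_ideal_def mult.assoc)
    then have "common_multiples (l ` U) = (*) p ` common_multiples (l2 ` U)"
      using recursive_step_common_multiples[OF step U(1)] by simp
    then have "\<exists>e. ?W2 U = ereal e \<and> ?W (l ` U) = ereal (?c * e)"
      using fin[OF U(1)] by (intro weighted_join_left_factor assms(4,5,6,7) p a) auto
    then show ?thesis using d(1)[OF U(1)] by auto
  qed
  \<comment> \<open>\<open>A\<close> may be infinite through the term of \<open>U = {}\<close>; it is common to both sides and never cancelled\<close>
  define A where "A = (\<Sum>U\<in>Pow ?I. ereal ((-1) ^ card U) * ?W (l ` U))"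
  define D where "D = (\<Sum>U\<in>Pow ?I. (-1) ^ card U * d U)"
  define D' where "D' = (\<Sum>U\<in>Pow ?I. (-1) ^ card U * d (insert i U))"
  have sub': "U \<subseteq> {1..n}" "insert i U \<subseteq> {1..n}" "card (insert i U) = Suc (card U)"
    if "U \<in> Pow ?I" for U
  proof -
    have "i \<notin> U" "finite U" using that fin[of U] by auto
    then show "U \<subseteq> {1..n}" "insert i U \<subseteq> {1..n}" "card (insert i U) = Suc (card U)"
      using that i by auto
  qed
  have Z: "Z X N \<beta> V n l ?w a = A + ereal (- (?c * D'))"
  proof -
    have "(\<Sum>U\<in>Pow ?I. ereal ((-1) ^ card (insert i U)) * ?W (l ` insert i U)) = ereal (- (?c * D'))"
    proof -
      have "(\<Sum>U\<in>Pow ?I. ereal ((-1) ^ card (insert i U)) * ?W (l ` insert i U)) =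
          (\<Sum>U\<in>Pow ?I. ereal (- (?c * ((-1) ^ card U * d (insert i U)))))"
      proof (rule sum.cong[OF refl])
        fix U assume "U \<in> Pow ?I"
        note U = sub'[OF this]
        have "?W (l ` insert i U) = ereal (?c * d (insert i U))" by (rule d'[OF U(2)]) simp
        then show "ereal ((-1) ^ card (insert i U)) * ?W (l ` insert i U) =
            ereal (- (?c * ((-1) ^ card U * d (insert i U))))" unfolding U(3) by (simp only:) simp
      qed
      also have "\<dots> = ereal (- (?c * D'))"
        unfolding D'_def sum_distrib_left sum_negf[symmetric] by (rule sum_ereal)
      finally show ?thesis .
    qed
    then show ?thesis
      unfolding Z_def by (subst ins(1), subst sum_Pow_insert[OF ins(2,3)]) (simp only: A_def)
  qed
  have l1U0: "l1 ` U = l ` U" if "U \<in> Pow ?I" for U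
    by (rule image_cong[OF refl], rule l1) (use that in auto)
  have Z1: "Z X N \<beta> V n l1 ?w a = A + ereal (- (?c * D))"
  proof -
    have "(\<Sum>U\<in>Pow ?I. ereal ((-1) ^ card (insert i U)) * ?W (l1 ` insert i U)) = ereal (- (?c * D))"
    proof -
      have l1U: "l1 ` insert i U = insert (Some p) (l ` U)" if "U \<in> Pow ?I" for U
        using l1U0[OF that] by (simp add: l1i)
      have "(\<Sum>U\<in>Pow ?I. ereal ((-1) ^ card (insert i U)) * ?W (l1 ` insert i U)) =
          (\<Sum>U\<in>Pow ?I. ereal (- (?c * ((-1) ^ card U * d U))))"
      proof (rule sum.cong[OF refl])
        fix U assume *: "U \<in> Pow ?I"
        note U = sub'[OF this]
        have "?W (l1 ` insert i U) = ereal (?c * d U)" unfolding l1U[OF *] by (rule d(2)[OF U(1)])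
        then show "ereal ((-1) ^ card (insert i U)) * ?W (l1 ` insert i U) =
            ereal (- (?c * ((-1) ^ card U * d U)))" unfolding U(3) by (simp only:) simp
      qed
      also have "\<dots> = ereal (- (?c * D))"
        unfolding D_def sum_distrib_left sum_negf[symmetric] by (rule sum_ereal)
      finally show ?thesis .
    qed
    moreover have "(\<Sum>U\<in>Pow ?I. ereal ((-1) ^ card U) * ?W (l1 ` U)) = A"
      unfolding A_def by (intro sum.cong refl) (simp only: l1U0)
    ultimately show ?thesis
      unfolding Z_def by (subst ins(1), subst sum_Pow_insert[OF ins(2,3)]) (simp only:)
  qed
  have Z2: "(\<Sum>U\<in>Pow {1..n}. ereal ((-1) ^ card U) * ?W2 U) = ereal (D - D')"
  proof -
    have "(\<Sum>U\<in>Pow ?I. ereal ((-1) ^ card U) * ?W2 U) = (\<Sum>U\<in>Pow ?I. ereal ((-1) ^ card U * d U))"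
      by (intro sum.cong refl) (simp only: d(1)[OF sub'(1)] times_ereal.simps)
    moreover have "(\<Sum>U\<in>Pow ?I. ereal ((-1) ^ card (insert i U)) * ?W2 (insert i U)) =
        (\<Sum>U\<in>Pow ?I. ereal (- ((-1) ^ card U * d (insert i U))))"
      by (intro sum.cong refl)
        (simp only: d(1)[OF sub'(2)] sub'(3) times_ereal.simps power_Suc mult_minus_left mult_1)
    ultimately show ?thesis
      by (subst ins(1), subst sum_Pow_insert[OF ins(2,3)]) (simp add: D_def D'_def sum_negf)
  qed
  have "1 / N p powr \<beta> = ?c" by (simp add: powr_minus_divide)
  then show "Z X N \<beta> V n l ?w a = Z X N \<beta> V n l1 ?w a + ereal (1 / N p powr \<beta>) *
      (\<Sum>U\<in>Pow {1..n}. ereal ((-1) ^ card U) * ?W2 U)"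
    unfolding Z Z1 Z2 by (simp add: add.assoc algebra_simps)
qed

end
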